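(* Assume $R$ is a $\mathbb Q$-algebra and $\mathfrak l(t)\in R[[t]]$ is a power series, invertible under composition, such that $F(x,y)=\mathfrak l\bigl(\mathfrak l^{-1}(x)+\mathfrak l^{-1}(y)\bigr)$ (i.e. $\mathfrak l(x+y)=\mathfrak l(x)+_F\mathfrak l(y)$). Then there is an isomorphism $$\widetilde\phi_{F,F_a}:\mathbf H_F\to\mathbf H_{F_a},\qquad T^F_i\mapsto\frac{\mathfrak l(x_\gamma)}{\mathfrak l(x_i)}+\frac{\mathfrak l(x_i)-\mathfrak l(x_\gamma)}{\mathfrak l(x_i)}\delta_i,$$ namely the restriction of the isomorphism $Q^F_W\to Q^{F_a}_W$, $u\delta_w\mapsto\phi_{F,F_a}(u)\delta_w$, where $\phi_{F,F_a}(x_\lambda)=\mathfrak l(x_\lambda)$ for $\lambda\in\Gamma\oplus\Lambda$.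
   Context: $R$ is a commutative ring, $F$ a one-dimensional commutative formal group law over $R$, $x+_Fy=F(x,y)$; $F_a(x,y)=x+y$ is the additive formal group law over $R$. Fix a semi-simple root datum $\Sigma\hookrightarrow\Lambda^\vee$ with $\Lambda_r\subseteq\Lambda\subseteq\Lambda_w$ (root and weight lattices), simple roots $\alpha_1,\dots,\alpha_n$, Weyl group $W$ with simple reflections $s_1,\dots,s_n$. For a lattice $M$, $R[[M]]_F$ is the quotient of $R[[x_\lambda:\lambda\in M]]$ by the (closed) ideal generated by $x_0$ and $x_\lambda+_Fx_\mu-x_{\lambda+\mu}$. Standing assumption: $x_\alpha$ is a non-zero-divisor in $R[[\Lambda]]_F$ for all $\alpha\in\Sigma$. $\Gamma=\mathbb Z\gamma$, $S_F=R[[\Gamma\oplus\Lambda]]_F$, with $w(x_\gamma)=x_\gamma$, $w(x_\lambda)=x_{w(\lambda)}$ for $w\in W$. $Q^F=S_F[1/x_\alpha:\alpha\in\Sigma]$; $Q^F_W$ is the free left $Q^F$-module with basis $\delta_w$ ($w\in W$) and product $u\delta_w\cdot u'\delta_{w'}=u\,w(u')\delta_{ww'}$. Write $x_i=x_{\alpha_i}$, $\delta_i=\delta_{s_i}$, $T^F_i=\frac{x_\gamma}{x_i}(1-\delta_i)+\delta_i$. $\mathbf H_F$ is the $R$-subalgebra of $Q^F_W$ generated by $S_F$ and $T_1^F,\dots,T_n^F$; $\mathbf H_{F_a}$ is the same construction for $F_a$. The ring isomorphism $\phi_{F,F_a}:S_F\to S_{F_a}$ is given by $x_\lambda\mapsto\mathfrak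 l(x_\lambda)$ and extends to localizations. *)

theory Defs
  imports
    "HOL-Library.Multiset"
    "HOL-Library.Product_Plus"
    "HOL-Computational_Algebra.Formal_Power_Series"
    "HOL-Algebra.QuotRing"
    "HOL-Algebra.Generated_Rings"
    "HOL-Algebra.Generated_Groups"
    "HOL-Algebra.Bij"
begin

section \<open>Power series in arbitrarily many variables\<close>

text \<open>
  Monomials in the variables \<open>v :: 'v\<close> are multisets, and the degree of a monomial is its size.
  For a lattice \<open>M\<close>, the ring of power series in the variables \<open>x\<^sub>\<lambda>\<close> (\<open>\<lambda> \<in> M\<close>) is the completion of the
  polynomial ring at the augmentation ideal \<open>x\<^sub>\<lambda> \<mapsto> 0\<close>. If there are infinitely many variables, a
  series therefore has only finitely many monomials in each degree, i.e. its truncations are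
  polynomials; for finitely many variables this is no restriction.
\<close>

typedef (overloaded) ('v, 'r :: zero) pseries =
  "{f :: 'v multiset \<Rightarrow> 'r. \<forall>d. finite {m. size m \<le> d \<and> f m \<noteq> 0}}"
  morphisms pcoeff Abs_pseries
  by (rule exI[of _ "\<lambda>_. 0"]) simp

setup_lifting type_definition_pseries

lemma pseries_eqI: "(\<And>m. pcoeff f m = pcoeff g m) \<Longrightarrow> f = g"
  by (simp add: pcoeff_inject[symmetric] ext)

lemma finite_pcoeff: "finite {m. size m \<le> d \<and> pcoeff f m \<noteq> 0}"
  using pcoeff[of f] by simp

lemma finite_submultisets: "finite {a. a \<subseteq># (m :: 'v multiset)}"
proof (induction m)
  case (add x m)
  have "{a. a \<subseteq># add_mset x m} \<subseteq> {a. a \<subseteq># m} \<union> add_mset x ` {a. a \<subseteq># m}"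
  proof
    fix a assume "a \<in> {a. a \<subseteq># add_mset x m}"
    then have a: "a \<subseteq># add_mset x m" by simp
    show "a \<in> {a. a \<subseteq># m} \<union> add_mset x ` {a. a \<subseteq># m}"
    proof (cases "x \<in># a")
      case True
      then obtain b where "a = add_mset x b" by (meson mset_add)
      with a show ?thesis by auto
    next
      case False
      have "a \<subseteq># m"
      proof (rule mset_subset_eqI)
        fix y show "count a y \<le> count m y"
          using mset_subset_eq_count[OF a, of y] False by (cases "y = x") (auto simp: not_in_iff)
      qed
      then show ?thesis by simp
    qed
  qed
  with add show ?case by (meson finite_Un finite_imageI finite_subset)
qed simp

lemma finite_splittings: "finite {(a, b). a + b = (m :: 'v multiset)}"
proof (rule finite_subset)
  show "{(a, b). a + b = m} \<subseteq> (\<lambda>a. (a, m - a)) ` {a. a \<subseteq># m}" by force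
qed (simp add: finite_submultisets)

instantiation pseries :: (type, comm_ring_1) comm_ring_1
begin

lift_definition zero_pseries :: "('a, 'b) pseries" is "\<lambda>_. 0" by simp

lift_definition one_pseries :: "('a, 'b) pseries" is "\<lambda>m. if m = {#} then 1 else 0" by simp

lift_definition plus_pseries :: "('a, 'b) pseries \<Rightarrow> ('a, 'b) pseries \<Rightarrow> ('a, 'b) pseries"
  is "\<lambda>f g m. f m + g m"
proof -
  fix f g :: "'a multiset \<Rightarrow> 'b" and d
  assume "\<And>d. finite {m. size m \<le> d \<and> f m \<noteq> 0}" "\<And>d. finite {m. size m \<le> d \<and> g m \<noteq> 0}"
  then have "finite ({m. size m \<le> d \<and> f m \<noteq> 0} \<union> {m. size m \<le> d \<and> g m \<noteq> 0})" by simp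
  then show "finite {m. size m \<le> d \<and> f m + g m \<noteq> 0}" by (rule rev_finite_subset) auto
qed

lift_definition uminus_pseries :: "('a, 'b) pseries \<Rightarrow> ('a, 'b) pseries" is "\<lambda>f m. - f m" by simp

lift_definition minus_pseries :: "('a, 'b) pseries \<Rightarrow> ('a, 'b) pseries \<Rightarrow> ('a, 'b) pseries"
  is "\<lambda>f g m. f m - g m"
proof -
  fix f g :: "'a multiset \<Rightarrow> 'b" and d
  assume "\<And>d. finite {m. size m \<le> d \<and> f m \<noteq> 0}" "\<And>d. finite {m. size m \<le> d \<and> g m \<noteq> 0}"
  then have "finite ({m. size m \<le> d \<and> f m \<noteq> 0} \<union> {m. size m \<le> d \<and> g m \<noteq> 0})" by simp
  then show "finite {m. size m \<le> d \<and> f m - g m \<noteq> 0}" by (rule rev_finite_subset) auto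
qed

lift_definition times_pseries :: "('a, 'b) pseries \<Rightarrow> ('a, 'b) pseries \<Rightarrow> ('a, 'b) pseries"
  is "\<lambda>f g m. \<Sum>(a, b) | a + b = m. f a * g b"
proof -
  fix f g :: "'a multiset \<Rightarrow> 'b" and d
  assume "\<And>d. finite {m. size m \<le> d \<and> f m \<noteq> 0}" "\<And>d. finite {m. size m \<le> d \<and> g m \<noteq> 0}"
  then have "finite ((\<lambda>(a, b). a + b) `
      ({m. size m \<le> d \<and> f m \<noteq> 0} \<times> {m. size m \<le> d \<and> g m \<noteq> 0}))" by simp
  then show "finite {m. size m \<le> d \<and> (\<Sum>(a, b) | a + b = m. f a * g b) \<noteq> 0}"
  proof (rule rev_finite_subset, safe)
    fix m assume d: "size m \<le> d" and nz: "(\<Sum>(a, b) | a + b = m. f a * g b) \<noteq> 0"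
    from nz obtain p where p: "p \<in> {(a, b). a + b = m}" "(case p of (a, b) \<Rightarrow> f a * g b) \<noteq> 0"
      by (meson sum.not_neutral_contains_not_neutral)
    obtain a b where ab: "p = (a, b)" by fastforce
    from p ab have "a + b = m" "f a \<noteq> 0" "g b \<noteq> 0" by auto
    with d show "m \<in> (\<lambda>(a, b). a + b) `
        ({m. size m \<le> d \<and> f m \<noteq> 0} \<times> {m. size m \<le> d \<and> g m \<noteq> 0})" by force
  qed
qed

instance
proof
  fix f g h :: "('a, 'b) pseries"
  show "f + g + h = f + (g + h)" by transfer (simp add: algebra_simps)
  show "f + g = g + f" by transfer (simp add: algebra_simps)
  show "0 + f = f" by transfer simp
  show "- f + f = 0" by transfer simp
  show "f - g = f + - g" by transfer simp
  show "(0 :: ('a, 'b) pseries) \<noteq> 1"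
  proof
    assume "(0 :: ('a, 'b) pseries) = 1"
    then have "pcoeff (0 :: ('a, 'b) pseries) {#} = pcoeff 1 {#}" by simp
    then show False by (simp add: zero_pseries.rep_eq one_pseries.rep_eq)
  qed
  show "f * g = g * f"
    by (transfer, rule ext,
        rule sum.reindex_bij_witness[where i = "\<lambda>(a, b). (b, a)" and j = "\<lambda>(a, b). (b, a)"])
      (auto simp: algebra_simps)
  show "(f + g) * h = f * h + g * h"
    by transfer (simp add: algebra_simps case_prod_unfold sum.distrib)
  show "1 * f = f"
  proof (rule pseries_eqI)
    fix m
    have "pcoeff (1 * f) m = (\<Sum>(a, b) | a + b = m. (if a = {#} then 1 else 0) * pcoeff f b)"
      by (simp add: times_pseries.rep_eq one_pseries.rep_eq)
    also have "\<dots> = (\<Sum>(a, b) \<in> {({#} :: 'a multiset, m)}. (if a = {#} then 1 else 0) * pcoeff f b)"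
      by (rule sum.mono_neutral_right) (auto simp: finite_splittings split: if_splits)
    finally show "pcoeff (1 * f) m = pcoeff f m" by simp
  qed
  show "f * g * h = f * (g * h)"
  proof (rule pseries_eqI)
    fix m
    let ?f = "pcoeff f" and ?g = "pcoeff g" and ?h = "pcoeff h"
    have "pcoeff (f * g * h) m
        = (\<Sum>p | fst p + snd p = m. \<Sum>q | fst q + snd q = fst p. ?f (fst q) * ?g (snd q) * ?h (snd p))"
      by (simp add: times_pseries.rep_eq case_prod_unfold sum_distrib_right)
    also have "\<dots> = (\<Sum>(p, q) \<in> (SIGMA p : {p. fst p + snd p = m}. {q. fst q + snd q = fst p}).
        ?f (fst q) * ?g (snd q) * ?h (snd p))"
      using finite_splittings by (subst sum.Sigma) (auto simp: case_prod_unfold)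
    also have "\<dots> = (\<Sum>(p, q) \<in> (SIGMA p : {p. fst p + snd p = m}. {q. fst q + snd q = snd p}).
        ?f (fst p) * (?g (fst q) * ?h (snd q)))"
      by (rule sum.reindex_bij_witness[
            where i = "\<lambda>(p, q). ((fst p + fst q, snd q), (fst p, fst q))"
              and j = "\<lambda>(p, q). ((fst q, snd q + snd p), (snd q, snd p))"])
        (auto simp: algebra_simps)
    also have "\<dots> = (\<Sum>p | fst p + snd p = m. \<Sum>q | fst q + snd q = snd p.
        ?f (fst p) * (?g (fst q) * ?h (snd q)))"
      using finite_splittings by (subst sum.Sigma) (auto simp: case_prod_unfold)
    also have "\<dots> = pcoeff (f * (g * h)) m"
      by (simp add: times_pseries.rep_eq case_prod_unfold sum_distrib_left)
    finally show "pcoeff (f * g * h) m = pcoeff (f * (g * h)) m" .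
  qed
qed

end

lift_definition Const :: "'r \<Rightarrow> ('v, 'r :: zero) pseries" is "\<lambda>r m. if m = {#} then r else 0"
  by simp

lift_definition Var :: "'v \<Rightarrow> ('v, 'r :: comm_ring_1) pseries" is "\<lambda>v m. if m = {#v#} then 1 else 0"
proof -
  fix v :: 'v and d
  show "finite {m. size m \<le> d \<and> (if m = {#v#} then 1 else 0) \<noteq> (0 :: 'r)}"
    by (rule finite_subset[of _ "{{#v#}}"]) auto
qed

text \<open>
  Substitution of series without constant term for the variables. The monomial \<open>m\<close> contributes only
  in degrees at least \<open>size m\<close>, so the coefficients of the result are the finite sums below. The
  values of \<open>psubst\<close> and \<open>fps_at\<close> on series with a constant term are irrelevant.
\<close>

lift_definition psubst ::
  "('v \<Rightarrow> ('w, 'r :: comm_ring_1) pseries) \<Rightarrow> ('v, 'r) pseries \<Rightarrow> ('w, 'r) pseries"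
  is "\<lambda>\<sigma> f n. \<Sum>m | size m \<le> size n \<and> pcoeff f m \<noteq> 0. pcoeff f m * pcoeff (\<Prod>v\<in>#m. \<sigma> v) n"
proof -
  fix \<sigma> :: "'v \<Rightarrow> ('w, 'r) pseries" and f :: "('v, 'r) pseries" and d
  let ?S = "{m. size m \<le> d \<and> pcoeff f m \<noteq> 0}"
  have "finite (\<Union>m\<in>?S. {n. size n \<le> d \<and> pcoeff (\<Prod>v\<in>#m. \<sigma> v) n \<noteq> 0})"
    by (intro finite_UN_I finite_pcoeff)
  then show "finite {n. size n \<le> d \<and>
      (\<Sum>m | size m \<le> size n \<and> pcoeff f m \<noteq> 0. pcoeff f m * pcoeff (\<Prod>v\<in>#m. \<sigma> v) n) \<noteq> 0}"
  proof (rule rev_finite_subset, safe)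
    fix n assume d: "size n \<le> d" and
      nz: "(\<Sum>m | size m \<le> size n \<and> pcoeff f m \<noteq> 0. pcoeff f m * pcoeff (\<Prod>v\<in>#m. \<sigma> v) n) \<noteq> 0"
    from nz obtain m where m: "size m \<le> size n" "pcoeff f m \<noteq> 0"
      "pcoeff f m * pcoeff (\<Prod>v\<in>#m. \<sigma> v) n \<noteq> 0"
      by (auto dest: sum.not_neutral_contains_not_neutral)
    from m d have "m \<in> ?S" by simp
    moreover from m(3) d have "n \<in> {n. size n \<le> d \<and> pcoeff (\<Prod>v\<in>#m. \<sigma> v) n \<noteq> 0}" by auto
    ultimately show "n \<in> (\<Union>m\<in>?S. {n. size n \<le> d \<and> pcoeff (\<Prod>v\<in>#m. \<sigma> v) n \<noteq> 0})"
      by (rule UN_I)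
  qed
qed

lift_definition fps_at :: "'r fps \<Rightarrow> ('v, 'r :: comm_ring_1) pseries \<Rightarrow> ('v, 'r) pseries"
  is "\<lambda>l g n. \<Sum>k\<le>size n. fps_nth l k * pcoeff (g ^ k) n"
proof -
  fix l :: "'r fps" and g :: "('v, 'r) pseries" and d
  have "finite (\<Union>k\<le>d. {n. size n \<le> d \<and> pcoeff (g ^ k) n \<noteq> 0})"
    by (intro finite_UN_I finite_pcoeff) simp
  then show "finite {n. size n \<le> d \<and> (\<Sum>k\<le>size n. fps_nth l k * pcoeff (g ^ k) n) \<noteq> 0}"
  proof (rule rev_finite_subset, safe)
    fix n assume d: "size n \<le> d" and nz: "(\<Sum>k\<le>size n. fps_nth l k * pcoeff (g ^ k) n) \<noteq> 0"
    from nz obtain k where k: "k \<le> size n" "fps_nth l k * pcoeff (g ^ k) n \<noteq> 0"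
      by (auto dest: sum.not_neutral_contains_not_neutral)
    from k d have "k \<in> {..d}" by simp
    moreover from k(2) d have "n \<in> {n. size n \<le> d \<and> pcoeff (g ^ k) n \<noteq> 0}" by auto
    ultimately show "n \<in> (\<Union>k\<le>d. {n. size n \<le> d \<and> pcoeff (g ^ k) n \<noteq> 0})"
      by (rule UN_I)
  qed
qed


section \<open>Formal group laws and formal group algebras\<close>

datatype xy = X | Y
datatype xyz = X1 | X2 | X3

text \<open>\<open>fgl_plus F f g\<close> is \<open>f +\<^sub>F g = F(f, g)\<close>.\<close>

definition fgl_plus ::
  "(xy, 'r :: comm_ring_1) pseries \<Rightarrow> ('v, 'r) pseries \<Rightarrow> ('v, 'r) pseries \<Rightarrow> ('v, 'r) pseries" where
  "fgl_plus F f g = psubst (case_xy f g) F"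

definition formal_group_law :: "(xy, 'r :: comm_ring_1) pseries \<Rightarrow> bool" where
  "formal_group_law F \<longleftrightarrow>
     fgl_plus F (Var X) 0 = (Var X :: (xy, 'r) pseries) \<and>
     fgl_plus F 0 (Var Y) = (Var Y :: (xy, 'r) pseries) \<and>
     fgl_plus F (Var X) (Var Y) = (fgl_plus F (Var Y) (Var X) :: (xy, 'r) pseries) \<and>
     fgl_plus F (fgl_plus F (Var X1) (Var X2)) (Var X3) =
       (fgl_plus F (Var X1) (fgl_plus F (Var X2) (Var X3)) :: (xyz, 'r) pseries)"

definition additive_fgl :: "(xy, 'r :: comm_ring_1) pseries" where
  "additive_fgl = Var X + Var Y"

definition type_ring :: "'a :: comm_ring_1 ring" where
  "type_ring = \<lparr>carrier = UNIV, mult = (*), one = 1, zero = 0, add = (+)\<rparr>"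

text \<open>
  Closure for the topology given by degree: \<open>f\<close> is a limit of elements of \<open>I\<close> iff it agrees with
  some element of \<open>I\<close> below every given degree.
\<close>

definition pclosure :: "('v, 'r :: zero) pseries set \<Rightarrow> ('v, 'r) pseries set" where
  "pclosure I = {f. \<forall>d. \<exists>g\<in>I. \<forall>m. size m < d \<longrightarrow> pcoeff f m = pcoeff g m}"

definition fga_ideal ::
  "(xy, 'r :: comm_ring_1) pseries \<Rightarrow> ('m :: ab_group_add, 'r) pseries set" where
  "fga_ideal F = pclosure (genideal type_ring
     (insert (Var 0) {fgl_plus F (Var a) (Var b) - Var (a + b) | a b. True}))"

definition fga :: "(xy, 'r :: comm_ring_1) pseries \<Rightarrow> ('m :: ab_group_add, 'r) pseries set ring" where
  "fga F = type_ring Quot fga_ideal F"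

definition fga_class ::
  "(xy, 'r :: comm_ring_1) pseries \<Rightarrow> ('m :: ab_group_add, 'r) pseries \<Rightarrow> ('m, 'r) pseries set" where
  "fga_class F f = fga_ideal F +>\<^bsub>type_ring\<^esub> f"

text \<open>The element \<open>x\<^sub>\<lambda>\<close> of the formal group algebra.\<close>

definition xg :: "(xy, 'r :: comm_ring_1) pseries \<Rightarrow> 'm :: ab_group_add \<Rightarrow> ('m, 'r) pseries set" where
  "xg F a = fga_class F (Var a)"


section \<open>Root data\<close>

definition zscale :: "int \<Rightarrow> 'l :: ab_group_add \<Rightarrow> 'l" where
  "zscale k x = (\<Sum>i<nat k. x) - (\<Sum>i<nat (- k). x)"

definition zcomb :: "('l \<Rightarrow> int) \<Rightarrow> 'l :: ab_group_add set \<Rightarrow> 'l" where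
  "zcomb c B = (\<Sum>b\<in>B. zscale (c b) b)"

definition zspan :: "'l :: ab_group_add set \<Rightarrow> 'l set" where
  "zspan B = {zcomb c A | c A. finite A \<and> A \<subseteq> B}"

definition zbasis :: "'l :: ab_group_add set \<Rightarrow> 'l set \<Rightarrow> bool" where
  "zbasis B L \<longleftrightarrow> finite B \<and> zspan B = L \<and> (\<forall>c. zcomb c B = 0 \<longrightarrow> (\<forall>b\<in>B. c b = 0))"

text \<open>
  The lattice is the whole type \<open>'l\<close>, \<open>cor \<alpha>\<close> is the coroot \<open>\<alpha>\<^sup>\<or>\<close> in the dual lattice, and \<open>cor\<close> is only
  used on the set \<open>\<Sigma>\<close> of roots.
\<close>

definition reflection :: "('l \<Rightarrow> 'l \<Rightarrow> int) \<Rightarrow> 'l \<Rightarrow> 'l :: ab_group_add \<Rightarrow> 'l" where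
  "reflection cor \<alpha> x = x - zscale (cor \<alpha> x) \<alpha>"

definition root_datum :: "'l :: ab_group_add set \<Rightarrow> ('l \<Rightarrow> 'l \<Rightarrow> int) \<Rightarrow> bool" where
  "root_datum \<Sigma> cor \<longleftrightarrow>
     (\<exists>B. zbasis B (UNIV :: 'l set)) \<and> finite \<Sigma> \<and>
     (\<forall>\<alpha>\<in>\<Sigma>. \<forall>x y. cor \<alpha> (x + y) = cor \<alpha> x + cor \<alpha> y) \<and>
     inj_on cor \<Sigma> \<and>
     (\<forall>\<alpha>\<in>\<Sigma>. cor \<alpha> \<alpha> = 2) \<and>
     (\<forall>\<alpha>\<in>\<Sigma>. \<forall>\<beta>\<in>\<Sigma>. reflection cor \<alpha> \<beta> \<in> \<Sigma>) \<and>
     (\<forall>\<alpha>\<in>\<Sigma>. \<forall>\<beta>\<in>\<Sigma>. (\<lambda>x. cor \<beta> x - cor \<beta> \<alpha> * cor \<alpha> x) \<in> cor ` \<Sigma>)"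

text \<open>
  Semi-simple: the root lattice \<open>zspan \<Sigma>\<close> has the same rational span as the whole lattice.
  The inclusions of the root lattice in the lattice and of the lattice in the weight lattice
  (the rational vectors on which all coroots are integral) are then automatic.
\<close>

definition semisimple_root_datum :: "'l :: ab_group_add set \<Rightarrow> ('l \<Rightarrow> 'l \<Rightarrow> int) \<Rightarrow> bool" where
  "semisimple_root_datum \<Sigma> cor \<longleftrightarrow>
     root_datum \<Sigma> cor \<and> (\<forall>x. \<exists>k>0. zscale k x \<in> zspan \<Sigma>)"

definition simple_roots :: "'l :: ab_group_add set \<Rightarrow> nat \<Rightarrow> (nat \<Rightarrow> 'l) \<Rightarrow> bool" where
  "simple_roots \<Sigma> n \<alpha> \<longleftrightarrow>
     \<alpha> ` {1..n} \<subseteq> \<Sigma> \<and> inj_on \<alpha> {1..n} \<and> zbasis (\<alpha> ` {1..n}) (zspan \<Sigma>) \<and>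
     (\<forall>\<beta>\<in>\<Sigma>. \<exists>c. \<beta> = zcomb c (\<alpha> ` {1..n}) \<and>
        ((\<forall>i\<in>{1..n}. 0 \<le> c (\<alpha> i)) \<or> (\<forall>i\<in>{1..n}. c (\<alpha> i) \<le> 0)))"

definition weyl_group :: "'l :: ab_group_add set \<Rightarrow> ('l \<Rightarrow> 'l \<Rightarrow> int) \<Rightarrow> ('l \<Rightarrow> 'l) set" where
  "weyl_group \<Sigma> cor = generate (BijGroup UNIV) (reflection cor ` \<Sigma>)"


section \<open>Localization\<close>

inductive_set mult_closure :: "'a ring \<Rightarrow> 'a set \<Rightarrow> 'a set" for S A where
  one: "\<one>\<^bsub>S\<^esub> \<in> mult_closure S A"
| mult: "a \<in> A \<Longrightarrow> s \<in> mult_closure S A \<Longrightarrow> a \<otimes>\<^bsub>S\<^esub> s \<in> mult_closure S A"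

definition frac_rel :: "'a ring \<Rightarrow> 'a set \<Rightarrow> (('a \<times> 'a) \<times> ('a \<times> 'a)) set" where
  "frac_rel S D = {((a, s), (b, t)). a \<in> carrier S \<and> s \<in> D \<and> b \<in> carrier S \<and> t \<in> D \<and>
     (\<exists>u\<in>D. u \<otimes>\<^bsub>S\<^esub> (a \<otimes>\<^bsub>S\<^esub> t) = u \<otimes>\<^bsub>S\<^esub> (b \<otimes>\<^bsub>S\<^esub> s))}"

definition fraction :: "'a ring \<Rightarrow> 'a set \<Rightarrow> 'a \<Rightarrow> 'a \<Rightarrow> ('a \<times> 'a) set" where
  "fraction S D a s = frac_rel S D `` {(a, s)}"

definition localization :: "'a ring \<Rightarrow> 'a set \<Rightarrow> ('a \<times> 'a) set ring" where
  "localization S D =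
     \<lparr>carrier = (carrier S \<times> D) // frac_rel S D,
      mult = \<lambda>p q. the_elem ((\<lambda>((a, s), (b, t)). fraction S D (a \<otimes>\<^bsub>S\<^esub> b) (s \<otimes>\<^bsub>S\<^esub> t)) ` (p \<times> q)),
      one = fraction S D \<one>\<^bsub>S\<^esub> \<one>\<^bsub>S\<^esub>,
      zero = fraction S D \<zero>\<^bsub>S\<^esub> \<one>\<^bsub>S\<^esub>,
      add = \<lambda>p q. the_elem ((\<lambda>((a, s), (b, t)).
        fraction S D (a \<otimes>\<^bsub>S\<^esub> t \<oplus>\<^bsub>S\<^esub> b \<otimes>\<^bsub>S\<^esub> s) (s \<otimes>\<^bsub>S\<^esub> t)) ` (p \<times> q))\<rparr>"

text \<open>
  The extension \<open>a / s \<mapsto> g a / g s\<close> to a localization of a ring homomorphism \<open>g\<close> into \<open>B\<close> that maps all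
  denominators to units.
\<close>

definition loc_extend :: "'b ring \<Rightarrow> ('a \<Rightarrow> 'b) \<Rightarrow> ('a \<times> 'a) set \<Rightarrow> 'b" where
  "loc_extend B g p = the_elem ((\<lambda>(a, s). g a \<otimes>\<^bsub>B\<^esub> inv\<^bsub>B\<^esub> (g s)) ` p)"


section \<open>The twisted group algebra and the formal affine Hecke algebra\<close>

text \<open>The direct sum of \<open>\<Gamma> = \<int>\<gamma>\<close> and the lattice is \<open>int \<times> 'l\<close>, with \<open>\<gamma> = (1, 0)\<close>.\<close>

type_synonym ('l, 'r) gser = "(int \<times> 'l, 'r) pseries"
type_synonym ('l, 'r) selem = "('l, 'r) gser set"
type_synonym ('l, 'r) qelem = "(('l, 'r) selem \<times> ('l, 'r) selem) set"
type_synonym ('l, 'r) qwelem = "('l \<Rightarrow> 'l) \<Rightarrow> ('l, 'r) qelem"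

definition x_gamma :: "(xy, 'r :: comm_ring_1) pseries \<Rightarrow> ('l :: ab_group_add, 'r) selem" where
  "x_gamma F = xg F (1, 0)"

definition x_lat ::
  "(xy, 'r :: comm_ring_1) pseries \<Rightarrow> 'l :: ab_group_add \<Rightarrow> ('l, 'r) selem" where
  "x_lat F a = xg F (0, a)"

definition x_denoms ::
  "'l :: ab_group_add set \<Rightarrow> (xy, 'r :: comm_ring_1) pseries \<Rightarrow> ('l, 'r) selem set" where
  "x_denoms \<Sigma> F = mult_closure (fga F) (x_lat F ` \<Sigma>)"

definition Q_ring ::
  "'l :: ab_group_add set \<Rightarrow> (xy, 'r :: comm_ring_1) pseries \<Rightarrow> ('l, 'r) qelem ring" where
  "Q_ring \<Sigma> F = localization (fga F) (x_denoms \<Sigma> F)"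

definition q_frac :: "'l :: ab_group_add set \<Rightarrow> (xy, 'r :: comm_ring_1) pseries \<Rightarrow>
    ('l, 'r) selem \<Rightarrow> ('l, 'r) selem \<Rightarrow> ('l, 'r) qelem" where
  "q_frac \<Sigma> F a s = fraction (fga F) (x_denoms \<Sigma> F) a s"

abbreviation q_of :: "'l :: ab_group_add set \<Rightarrow> (xy, 'r :: comm_ring_1) pseries \<Rightarrow>
    ('l, 'r) selem \<Rightarrow> ('l, 'r) qelem" where
  "q_of \<Sigma> F a \<equiv> q_frac \<Sigma> F a \<one>\<^bsub>fga F\<^esub>"

text \<open>
  The actions of \<open>w\<close> on \<open>S\<^sub>F\<close> and on \<open>Q\<^sup>F\<close>: the permutation of the variables by
  \<open>(k, \<lambda>) \<mapsto> (k, w \<lambda>)\<close>, passed to the quotient and to the localization.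
\<close>

definition S_act :: "(xy, 'r :: comm_ring_1) pseries \<Rightarrow> ('l \<Rightarrow> 'l) \<Rightarrow>
    ('l :: ab_group_add, 'r) selem \<Rightarrow> ('l, 'r) selem" where
  "S_act F w C = the_elem ((\<lambda>f. fga_class F (psubst (\<lambda>(k, a). Var (k, w a)) f)) ` C)"

definition Q_act :: "'l :: ab_group_add set \<Rightarrow> (xy, 'r :: comm_ring_1) pseries \<Rightarrow> ('l \<Rightarrow> 'l) \<Rightarrow>
    ('l, 'r) qelem \<Rightarrow> ('l, 'r) qelem" where
  "Q_act \<Sigma> F w = loc_extend (Q_ring \<Sigma> F) (q_of \<Sigma> F \<circ> S_act F w)"

text \<open>
  An element \<open>f\<close> of the twisted group algebra is its family of coefficients: it stands for the finite
  sum of the \<open>f w \<delta>\<^sub>w\<close>.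
\<close>

definition QW_ring :: "'l :: ab_group_add set \<Rightarrow> ('l \<Rightarrow> 'l \<Rightarrow> int) \<Rightarrow>
    (xy, 'r :: comm_ring_1) pseries \<Rightarrow> ('l, 'r) qwelem ring" where
  "QW_ring \<Sigma> cor F =
     (let W = weyl_group \<Sigma> cor; Q = Q_ring \<Sigma> F in
      \<lparr>carrier = {f \<in> W \<rightarrow>\<^sub>E carrier Q. finite {w \<in> W. f w \<noteq> \<zero>\<^bsub>Q\<^esub>}},
       mult = \<lambda>f g. \<lambda>v\<in>W.
         finsum Q (\<lambda>(w, w'). f w \<otimes>\<^bsub>Q\<^esub> Q_act \<Sigma> F w (g w'))
           {(w, w') \<in> W \<times> W. w \<circ> w' = v \<and> f w \<noteq> \<zero>\<^bsub>Q\<^esub> \<and> g w' \<noteq> \<zero>\<^bsub>Q\<^esub>},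
       one = \<lambda>v\<in>W. if v = id then \<one>\<^bsub>Q\<^esub> else \<zero>\<^bsub>Q\<^esub>,
       zero = \<lambda>v\<in>W. \<zero>\<^bsub>Q\<^esub>,
       add = \<lambda>f g. \<lambda>v\<in>W. f v \<oplus>\<^bsub>Q\<^esub> g v\<rparr>)"

text \<open>\<open>qw \<Sigma> cor F u w\<close> is \<open>u \<delta>\<^sub>w\<close>.\<close>

definition qw :: "'l :: ab_group_add set \<Rightarrow> ('l \<Rightarrow> 'l \<Rightarrow> int) \<Rightarrow> (xy, 'r :: comm_ring_1) pseries \<Rightarrow>
    ('l, 'r) qelem \<Rightarrow> ('l \<Rightarrow> 'l) \<Rightarrow> ('l, 'r) qwelem" where
  "qw \<Sigma> cor F u w = (\<lambda>v\<in>weyl_group \<Sigma> cor. if v = w then u else \<zero>\<^bsub>Q_ring \<Sigma> F\<^esub>)"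

definition delta :: "'l :: ab_group_add set \<Rightarrow> ('l \<Rightarrow> 'l \<Rightarrow> int) \<Rightarrow>
    (xy, 'r :: comm_ring_1) pseries \<Rightarrow> ('l \<Rightarrow> 'l) \<Rightarrow> ('l, 'r) qwelem" where
  "delta \<Sigma> cor F w = qw \<Sigma> cor F \<one>\<^bsub>Q_ring \<Sigma> F\<^esub> w"

text \<open>The element \<open>T\<^sub>\<alpha> = (x\<^sub>\<gamma> / x\<^sub>\<alpha>) (1 - \<delta>) + \<delta>\<close>, where \<open>\<delta>\<close> belongs to the reflection at the root \<open>\<alpha>\<close>.\<close>

definition T_elt :: "'l :: ab_group_add set \<Rightarrow> ('l \<Rightarrow> 'l \<Rightarrow> int) \<Rightarrow>
    (xy, 'r :: comm_ring_1) pseries \<Rightarrow> 'l \<Rightarrow> ('l, 'r) qwelem" where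
  "T_elt \<Sigma> cor F \<alpha> =
     qw \<Sigma> cor F (q_frac \<Sigma> F (x_gamma F) (x_lat F \<alpha>)) id \<otimes>\<^bsub>QW_ring \<Sigma> cor F\<^esub>
       (\<one>\<^bsub>QW_ring \<Sigma> cor F\<^esub> \<ominus>\<^bsub>QW_ring \<Sigma> cor F\<^esub> delta \<Sigma> cor F (reflection cor \<alpha>))
     \<oplus>\<^bsub>QW_ring \<Sigma> cor F\<^esub> delta \<Sigma> cor F (reflection cor \<alpha>)"

definition QW_of_S :: "'l :: ab_group_add set \<Rightarrow> ('l \<Rightarrow> 'l \<Rightarrow> int) \<Rightarrow>
    (xy, 'r :: comm_ring_1) pseries \<Rightarrow> ('l, 'r) selem \<Rightarrow> ('l, 'r) qwelem" where
  "QW_of_S \<Sigma> cor F a = qw \<Sigma> cor F (q_of \<Sigma> F a) id"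

definition QW_scalar :: "'l :: ab_group_add set \<Rightarrow> ('l \<Rightarrow> 'l \<Rightarrow> int) \<Rightarrow>
    (xy, 'r :: comm_ring_1) pseries \<Rightarrow> 'r \<Rightarrow> ('l, 'r) qwelem" where
  "QW_scalar \<Sigma> cor F r = QW_of_S \<Sigma> cor F (fga_class F (Const r))"

definition hecke_set :: "'l :: ab_group_add set \<Rightarrow> ('l \<Rightarrow> 'l \<Rightarrow> int) \<Rightarrow> nat \<Rightarrow> (nat \<Rightarrow> 'l) \<Rightarrow>
    (xy, 'r :: comm_ring_1) pseries \<Rightarrow> ('l, 'r) qwelem set" where
  "hecke_set \<Sigma> cor n \<alpha> F = generate_ring (QW_ring \<Sigma> cor F)
     (range (QW_scalar \<Sigma> cor F) \<union> QW_of_S \<Sigma> cor F ` carrier (fga F) \<union>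
      (\<lambda>i. T_elt \<Sigma> cor F (\<alpha> i)) ` {1..n})"

definition hecke_algebra :: "'l :: ab_group_add set \<Rightarrow> ('l \<Rightarrow> 'l \<Rightarrow> int) \<Rightarrow> nat \<Rightarrow> (nat \<Rightarrow> 'l) \<Rightarrow>
    (xy, 'r :: comm_ring_1) pseries \<Rightarrow> ('l, 'r) qwelem ring" where
  "hecke_algebra \<Sigma> cor n \<alpha> F = (QW_ring \<Sigma> cor F)\<lparr>carrier := hecke_set \<Sigma> cor n \<alpha> F\<rparr>"


section \<open>The comparison with the additive formal group law\<close>

definition rational_algebra :: "'r :: comm_ring_1 itself \<Rightarrow> bool" where
  "rational_algebra _ \<longleftrightarrow> (\<exists>h. h \<in> ring_hom (type_ring :: rat ring) (type_ring :: 'r ring))"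

definition compositional_inverses :: "'r :: comm_ring_1 fps \<Rightarrow> 'r fps \<Rightarrow> bool" where
  "compositional_inverses l l' \<longleftrightarrow> fps_nth l 0 = 0 \<and> fps_nth l' 0 = 0 \<and>
     fps_compose l l' = fps_X \<and> fps_compose l' l = fps_X"

text \<open>
  \<open>phi_S\<close> is the continuous map \<open>x\<^sub>\<lambda> \<mapsto> l(x\<^sub>\<lambda>)\<close> from \<open>S\<^sub>F\<close> (for any \<open>F\<close>, whose elements are cosets \<open>C\<close>) to the
  formal group algebra of the additive formal group law.
\<close>

definition phi_S ::
  "'r :: comm_ring_1 fps \<Rightarrow> ('m :: ab_group_add, 'r) pseries set \<Rightarrow> ('m, 'r) pseries set" where
  "phi_S l C = the_elem ((\<lambda>f. fga_class additive_fgl (psubst (\<lambda>a. fps_at l (Var a)) f)) ` C)"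

definition phi_Q :: "'l :: ab_group_add set \<Rightarrow> 'r :: comm_ring_1 fps \<Rightarrow>
    ('l, 'r) qelem \<Rightarrow> ('l, 'r) qelem" where
  "phi_Q \<Sigma> l = loc_extend (Q_ring \<Sigma> additive_fgl) (q_of \<Sigma> additive_fgl \<circ> phi_S l)"

definition phi_QW :: "'l :: ab_group_add set \<Rightarrow> ('l \<Rightarrow> 'l \<Rightarrow> int) \<Rightarrow> 'r :: comm_ring_1 fps \<Rightarrow>
    ('l, 'r) qwelem \<Rightarrow> ('l, 'r) qwelem" where
  "phi_QW \<Sigma> cor l f = (\<lambda>w\<in>weyl_group \<Sigma> cor. phi_Q \<Sigma> l (f w))"

text \<open>\<open>l(x\<^sub>a)\<close> in the localized additive formal group algebra.\<close>

definition l_x :: "'l :: ab_group_add set \<Rightarrow> 'r :: comm_ring_1 fps \<Rightarrow> int \<times> 'l \<Rightarrow> ('l, 'r) qelem" where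
  "l_x \<Sigma> l a = q_of \<Sigma> additive_fgl (fga_class additive_fgl (fps_at l (Var a)))"

end

(*
  Over the additive law, substituting l(x_a) for x_a turns the relation F(x_a, x_b) = x_(a+b) into
  l(x_a + x_b) = l(x_(a+b)). The two-variable divided difference of l shows that g - h and
  l(g) - l(h) divide each other for series g, h without constant term (l has a compositional
  inverse). So the substitutions by l and by its inverse exchange the defining ideals, giving
  mutually inverse isomorphisms of the formal group algebras; x_a and l(x_a) are associates, so these
  extend to the localizations, and they commute with the Weyl group.

  For the Hecke algebras note that T_i - 1 = (x_gamma - x_i) / x_i * (1 - delta_i), while the image
  of the other T_i, minus 1, is (l(x_gamma) - l(x_i)) / l(x_i) * (1 - delta_i). The two coefficients
  are multiples of each other by elements of the formal group algebra, so both generating sets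
  generate the same subalgebra.
*)

theory Submission
  imports Defs
begin

section \<open>Substitution as a continuous ring homomorphism\<close>

text \<open>Passing to \<open>T_i - 1\<close> is forced: the coefficients of \<open>T_i\<close> at 1
  and at the reflection add up to 1, so \<open>T_i\<close> itself cannot be rescaled, while
  \<open>T_i - 1\<close> has the single parameter \<open>x_gamma / x_i - 1\<close>. The rescaling
  factor has to lie in the formal group algebra, because the Hecke algebra contains that algebra but
  not all of its localization. The factor is not obtained by cancelling
  \<open>x_gamma - x_i\<close>, which is neither inverted nor known to be a non-zero-divisor; it
  comes from an explicit quotient series, the divided difference, specialised by substitution. The
  other obstacle is that the variables are indexed by a whole lattice. A ring homomorphism of series
  is not determined by its values on the variables unless it respects the degree filtration, and the
  ideal of relations is a closure. So identities between maps are proved for continuous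
  homomorphisms by comparing variables, and are carried to the quotient, the localization and the
  coefficient families in turn.\<close>

declare zero_pseries.rep_eq [simp] one_pseries.rep_eq [simp] plus_pseries.rep_eq [simp]
  minus_pseries.rep_eq [simp] uminus_pseries.rep_eq [simp] Const.rep_eq [simp] Var.rep_eq [simp]

lemma pcoeff_sum [simp]: "pcoeff (sum f A) m = (\<Sum>a\<in>A. pcoeff (f a) m)"
  by (induction A rule: infinite_finite_induct) auto

lemma pcoeff_mult: "pcoeff (f * g) m = (\<Sum>(a, b) | a + b = m. pcoeff f a * pcoeff g b)"
  by (simp add: times_pseries.rep_eq)

lemma pcoeff_Const_mult [simp]:
  fixes f :: "('v, 'r :: comm_ring_1) pseries"
  shows "pcoeff (Const r * f) m = r * pcoeff f m"
proof -
  have "pcoeff (Const r * f) m = (\<Sum>(a, b) \<in> {({#} :: 'v multiset, m)}. pcoeff (Const r) a * pcoeff f b)"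
    unfolding pcoeff_mult by (intro sum.mono_neutral_right) (auto simp: finite_splittings split: if_splits)
  then show ?thesis by simp
qed

lemma pcoeff_Var_mult: "pcoeff (Var x * f) m = (if x \<in># m then pcoeff f (m - {#x#}) else 0)"
proof (cases "x \<in># m")
  case True
  then have "pcoeff (Var x * f) m = (\<Sum>(a, b) \<in> {({#x#}, m - {#x#})}. pcoeff (Var x) a * pcoeff f b)"
    unfolding pcoeff_mult by (intro sum.mono_neutral_right) (auto simp: finite_splittings split: if_splits)
  then show ?thesis using True by simp
next
  case False
  then show ?thesis by (auto simp: pcoeff_mult intro!: sum.neutral)
qed

lemma Const_0 [simp]: "Const 0 = 0" and Const_1 [simp]: "Const 1 = 1"
  and Const_mult: "Const (r * s) = Const r * Const s"
  by (rule pseries_eqI; simp)+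

section \<open>The filtration by degree\<close>

definition pcong :: "nat \<Rightarrow> ('v, 'r :: zero) pseries \<Rightarrow> ('v, 'r) pseries \<Rightarrow> bool" where
  "pcong d f g \<longleftrightarrow> (\<forall>m. size m < d \<longrightarrow> pcoeff f m = pcoeff g m)"

lemma pcong_refl [simp]: "pcong d f f"
  and pcong_sym: "pcong d f g \<Longrightarrow> pcong d g f"
  and pcong_trans [trans]: "pcong d f g \<Longrightarrow> pcong d g h \<Longrightarrow> pcong d f h"
  by (auto simp: pcong_def)

text \<open>The filtration is separated: each coefficient is seen at the level just above its
  degree. Identities can thus be checked modulo every degree, where series may be replaced by
  polynomials.\<close>

lemma eq_pcongI: "(\<And>d. pcong d f g) \<Longrightarrow> f = g"
  by (rule pseries_eqI) (metis pcong_def lessI)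

lemma pcong_add: "pcong d f f' \<Longrightarrow> pcong d g g' \<Longrightarrow> pcong d (f + g) (f' + g')"
  by (auto simp: pcong_def)

text \<open>In a splitting \<open>a + b = m\<close> neither part is larger than \<open>m\<close>, so
  coefficients of a product below degree \<open>d\<close> involve only coefficients of the factors
  below \<open>d\<close>.\<close>

lemma pcong_mult: "pcong d f f' \<Longrightarrow> pcong d g g' \<Longrightarrow> pcong d (f * g) (f' * g')"
  by (auto simp: pcong_def pcoeff_mult intro!: sum.cong)

lemma mem_pclosure_iff: "f \<in> pclosure I \<longleftrightarrow> (\<forall>d. \<exists>g\<in>I. pcong d f g)"
  by (simp add: pclosure_def pcong_def)

section \<open>Substitution of series without constant term\<close>

definition no_const :: "('v, 'r :: zero) pseries \<Rightarrow> bool" where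
  "no_const f \<longleftrightarrow> pcoeff f {#} = 0"

lemma no_const_Var [simp]: "no_const (Var v)"
  and no_const_0 [simp]: "no_const 0"
  by (auto simp: no_const_def)

lemma no_const_add [simp]: "no_const f \<Longrightarrow> no_const g \<Longrightarrow> no_const (f + g)"
  by (auto simp: no_const_def)

lemma no_const_fps_at [simp]: "fps_nth l 0 = 0 \<Longrightarrow> no_const (fps_at l g)"
  by (simp add: no_const_def fps_at.rep_eq)

definition pmonom :: "'v multiset \<Rightarrow> ('v, 'r :: comm_ring_1) pseries" where
  "pmonom m = (\<Prod>v\<in>#m. Var v)"

lemma pmonom_empty [simp]: "pmonom {#} = 1"
  and pmonom_add_mset [simp]: "pmonom (add_mset x m) = Var x * pmonom m"
  by (simp_all add: pmonom_def)

lemma pcoeff_pmonom [simp]: "pcoeff (pmonom m) n = (if n = m then 1 else 0)"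
  by (induction m arbitrary: n) (auto simp: pcoeff_Var_mult dest!: multi_member_split)

text \<open>Every factor has order at least one, so a product of \<open>size m\<close> of them
  starts in degree \<open>size m\<close>.\<close>

lemma pcoeff_prod_mset_eq_0:
  assumes "\<And>v. no_const (\<sigma> v)" "size n < size m"
  shows "pcoeff (\<Prod>v\<in>#m. \<sigma> v) n = 0"
  using assms(2)
proof (induction m arbitrary: n)
  case (add x m)
  have "pcoeff (\<sigma> x) a * pcoeff (\<Prod>v\<in>#m. \<sigma> v) b = 0" if "a + b = n" for a b
  proof (cases "a = {#}")
    case True
    then show ?thesis using assms(1) by (simp add: no_const_def)
  next
    case False
    then have "0 < size a" by (simp add: nonempty_has_size)
    moreover have "size a + size b < Suc (size m)" using that add.prems by auto
    ultimately have "size b < size m" by simp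
    then show ?thesis using add.IH by simp
  qed
  then show ?case by (auto simp: pcoeff_mult intro!: sum.neutral)
qed simp

text \<open>The index set in \<open>psubst\<close> depends on \<open>f\<close> and \<open>n\<close>.
  Monomials longer than \<open>n\<close> contribute nothing, so any larger finite set will do, and
  several series can be compared over a common one.\<close>

lemma pcoeff_psubst:
  assumes "\<And>v. no_const (\<sigma> v)" "finite A" "{m. size m \<le> size n \<and> pcoeff f m \<noteq> 0} \<subseteq> A"
  shows "pcoeff (psubst \<sigma> f) n = (\<Sum>m\<in>A. pcoeff f m * pcoeff (\<Prod>v\<in>#m. \<sigma> v) n)"
  unfolding psubst.rep_eq
proof (rule sum.mono_neutral_left)
  show "\<forall>m\<in>A - {m. size m \<le> size n \<and> pcoeff f m \<noteq> 0}. pcoeff f m * pcoeff (\<Prod>v\<in>#m. \<sigma> v) n = 0"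
    using pcoeff_prod_mset_eq_0 [of \<sigma>, OF assms(1)] by (metis (mono_tags, lifting) DiffD2 mem_Collect_eq mult_zero_left mult_zero_right not_le)
qed (use assms in auto)

text \<open>The last clause is stronger than continuity: no degree of precision is lost. The clause
  on \<open>Const\<close> makes the map \<open>R\<close>-linear and unital.\<close>

definition continuous_hom :: "(('v, 'r :: comm_ring_1) pseries \<Rightarrow> ('w, 'r) pseries) \<Rightarrow> bool" where
  "continuous_hom h \<longleftrightarrow>
     (\<forall>f g. h (f + g) = h f + h g) \<and> (\<forall>f g. h (f * g) = h f * h g) \<and>
     (\<forall>r. h (Const r) = Const r) \<and> (\<forall>d f g. pcong d f g \<longrightarrow> pcong d (h f) (h g))"

lemma continuous_hom_add: "continuous_hom h \<Longrightarrow> h (f + g) = h f + h g"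
  and continuous_hom_mult: "continuous_hom h \<Longrightarrow> h (f * g) = h f * h g"
  and continuous_hom_Const: "continuous_hom h \<Longrightarrow> h (Const r) = Const r"
  and continuous_hom_pcong: "continuous_hom h \<Longrightarrow> pcong d f g \<Longrightarrow> pcong d (h f) (h g)"
  by (auto simp: continuous_hom_def)

lemma continuous_hom_0: "continuous_hom h \<Longrightarrow> h 0 = 0"
  and continuous_hom_1: "continuous_hom h \<Longrightarrow> h 1 = 1"
  using continuous_hom_Const [of h 0] continuous_hom_Const [of h 1] by auto

lemma continuous_hom_diff: "continuous_hom h \<Longrightarrow> h (f - g) = h f - h g"
  using continuous_hom_add [of h "f - g" g] by simp

lemma continuous_hom_sum: "continuous_hom h \<Longrightarrow> h (sum f A) = (\<Sum>a\<in>A. h (f a))"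
  by (induction A rule: infinite_finite_induct) (auto simp: continuous_hom_0 continuous_hom_add)

lemma continuous_hom_prod_mset: "continuous_hom h \<Longrightarrow> h (\<Prod>v\<in>#m. f v) = (\<Prod>v\<in>#m. h (f v))"
  by (induction m) (auto simp: continuous_hom_1 continuous_hom_mult)

lemma continuous_hom_comp:
  "continuous_hom h \<Longrightarrow> continuous_hom k \<Longrightarrow> continuous_hom (\<lambda>f. h (k f))"
  unfolding continuous_hom_def by simp

lemma continuous_hom_id: "continuous_hom (\<lambda>f. f)"
  unfolding continuous_hom_def by simp

text \<open>A polynomial approximation. It keeps degree \<open>d\<close> itself, one more than
  \<open>pcong d\<close> asks for, so that its index set is literally the one in
  \<open>finite_pcoeff\<close>.\<close>

definition ptrunc :: "nat \<Rightarrow> ('v, 'r :: comm_ring_1) pseries \<Rightarrow> ('v, 'r) pseries" where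
  "ptrunc d f = (\<Sum>m | size m \<le> d \<and> pcoeff f m \<noteq> 0. Const (pcoeff f m) * pmonom m)"

lemma pcong_ptrunc: "pcong d f (ptrunc d f)"
  unfolding pcong_def ptrunc_def
proof (intro allI impI)
  fix n :: "'a multiset" assume "size n < d"
  then show "pcoeff f n = pcoeff (\<Sum>m | size m \<le> d \<and> pcoeff f m \<noteq> 0. Const (pcoeff f m) * pmonom m) n"
    using finite_pcoeff [of d f] by (simp add: if_distrib [of "(*) _"] sum.delta cong: if_cong)
qed

text \<open>The two maps agree on polynomials, and these are dense. This is the device by which all
  later identities between substitutions reduce to variables.\<close>

lemma continuous_hom_eqI:
  assumes h: "continuous_hom h" and k: "continuous_hom k" and "\<And>v. h (Var v) = k (Var v)"
  shows "h f = k f"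
proof (rule eq_pcongI)
  fix d
  have "h (ptrunc d f) = k (ptrunc d f)"
    by (simp add: ptrunc_def pmonom_def continuous_hom_sum continuous_hom_mult
        continuous_hom_Const continuous_hom_prod_mset assms)
  then show "pcong d (h f) (k f)"
    using continuous_hom_pcong [OF h pcong_ptrunc [of d f]] continuous_hom_pcong [OF k pcong_ptrunc [of d f]]
    by (metis pcong_sym pcong_trans)
qed

lemma psubst_term:
  assumes "\<And>v. no_const (\<sigma> v)"
  shows "psubst \<sigma> (Const r * pmonom m) = Const r * (\<Prod>v\<in>#m. \<sigma> v)"
proof (rule pseries_eqI)
  fix n
  have "pcoeff (psubst \<sigma> (Const r * pmonom m)) n
      = (\<Sum>k\<in>{m}. pcoeff (Const r * pmonom m) k * pcoeff (\<Prod>v\<in>#k. \<sigma> v) n)"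
    by (rule pcoeff_psubst [OF assms]) (auto split: if_splits)
  then show "pcoeff (psubst \<sigma> (Const r * pmonom m)) n = pcoeff (Const r * (\<Prod>v\<in>#m. \<sigma> v)) n" by simp
qed

lemma psubst_Var:
  assumes "\<And>v. no_const (\<sigma> v)"
  shows "psubst \<sigma> (Var v) = \<sigma> v"
  using psubst_term [OF assms, where r = 1 and m = "{#v#}"] by (simp add: pmonom_def)

lemma psubst_add:
  assumes "\<And>v. no_const (\<sigma> v)"
  shows "psubst \<sigma> (f + g) = psubst \<sigma> f + psubst \<sigma> g"
proof (rule pseries_eqI)
  fix n :: "'b multiset"
  let ?A = "{m. size m \<le> size n \<and> pcoeff f m \<noteq> 0} \<union> {m. size m \<le> size n \<and> pcoeff g m \<noteq> 0}"
  have eq: "pcoeff (psubst \<sigma> h) n = (\<Sum>m\<in>?A. pcoeff h m * pcoeff (\<Prod>v\<in>#m. \<sigma> v) n)"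
    if "h \<in> {f, g, f + g}" for h
    by (rule pcoeff_psubst [OF assms]) (use that in \<open>auto simp: finite_pcoeff\<close>)
  show "pcoeff (psubst \<sigma> (f + g)) n = pcoeff (psubst \<sigma> f + psubst \<sigma> g) n"
    by (simp add: eq algebra_simps sum.distrib)
qed

lemma psubst_0: "psubst \<sigma> 0 = 0"
  by (rule pseries_eqI) (simp add: psubst.rep_eq)

lemma psubst_sum:
  assumes "\<And>v. no_const (\<sigma> v)"
  shows "psubst \<sigma> (sum f A) = (\<Sum>a\<in>A. psubst \<sigma> (f a))"
  by (induction A rule: infinite_finite_induct) (auto simp: psubst_0 psubst_add [OF assms])

lemma psubst_pcong: "pcong d f g \<Longrightarrow> pcong d (psubst \<sigma> f) (psubst \<sigma> g)"
  unfolding pcong_def psubst.rep_eq by (auto intro!: sum.cong)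

text \<open>Multiplicativity is clear for polynomials, and it extends to all series by continuity.\<close>

lemma continuous_hom_psubst:
  assumes \<sigma>: "\<And>v. no_const (\<sigma> v)"
  shows "continuous_hom (psubst \<sigma>)"
proof -
  have "psubst \<sigma> (f * g) = psubst \<sigma> f * psubst \<sigma> g" for f g
  proof (rule eq_pcongI)
    fix d
    have *: "Const r * pmonom a * (Const s * pmonom b) = Const (r * s) * pmonom (a + b)"
      for r s a b
      by (simp add: Const_mult pmonom_def algebra_simps)
    have "psubst \<sigma> (ptrunc d f * ptrunc d g) = psubst \<sigma> (ptrunc d f) * psubst \<sigma> (ptrunc d g)"
      by (simp add: ptrunc_def sum_product psubst_sum [OF \<sigma>] psubst_term [OF \<sigma>] *)
        (simp add: Const_mult algebra_simps)
    moreover have "pcong d (psubst \<sigma> (f * g)) (psubst \<sigma> (ptrunc d f * ptrunc d g))"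
      "pcong d (psubst \<sigma> f * psubst \<sigma> g) (psubst \<sigma> (ptrunc d f) * psubst \<sigma> (ptrunc d g))"
      by (intro psubst_pcong pcong_mult pcong_ptrunc)+
    ultimately show "pcong d (psubst \<sigma> (f * g)) (psubst \<sigma> f * psubst \<sigma> g)"
      by (metis pcong_sym pcong_trans)
  qed
  moreover have "psubst \<sigma> (Const r) = Const r" for r
    using psubst_term [OF \<sigma>, where m = "{#}"] by (simp add: pmonom_def)
  ultimately show ?thesis
    using \<sigma> by (simp add: continuous_hom_def psubst_add psubst_pcong)
qed

section \<open>Power series in one variable\<close>

lemma unit_multiset: "m = replicate_mset (size m) ()"
  by (induction m) auto

text \<open>
  A power series in one variable is a series in the variables of type \<^typ>\<open>unit\<close>, so that \<open>fps_at\<close>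
  is a substitution as well.
\<close>

lift_definition pseries_of_fps :: "'r fps \<Rightarrow> (unit, 'r :: comm_ring_1) pseries" is "\<lambda>l m. fps_nth l (size m)"
proof -
  fix l :: "'r fps" and d
  have "{m. size m \<le> d \<and> fps_nth l (size m) \<noteq> 0} \<subseteq> (\<lambda>k. replicate_mset k ()) ` {..d}"
    using unit_multiset by blast
  then show "finite {m :: unit multiset. size m \<le> d \<and> fps_nth l (size m) \<noteq> 0}"
    by (rule finite_subset) simp
qed

lemma fps_at_eq_psubst:
  assumes "no_const g"
  shows "fps_at l g = psubst (\<lambda>_. g) (pseries_of_fps l)"
proof (rule pseries_eqI)
  fix n :: "'a multiset"
  let ?A = "(\<lambda>k. replicate_mset k ()) ` {..size n}"
  have "pcoeff (psubst (\<lambda>_. g) (pseries_of_fps l)) n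
      = (\<Sum>m\<in>?A. pcoeff (pseries_of_fps l) m * pcoeff (\<Prod>v\<in>#m. g) n)"
    using unit_multiset by (intro pcoeff_psubst) (use assms in auto)
  also have "\<dots> = (\<Sum>k\<le>size n. fps_nth l k * pcoeff (g ^ k) n)"
    by (subst sum.reindex) (auto simp: inj_on_def pseries_of_fps.rep_eq dest: arg_cong [of _ _ size])
  finally show "pcoeff (fps_at l g) n = pcoeff (psubst (\<lambda>_. g) (pseries_of_fps l)) n"
    by (simp add: fps_at.rep_eq)
qed

text \<open>With \<open>g\<close> fixed, both sides are continuous homomorphisms in the one-variable
  series, and both send its variable to \<open>h g\<close>.\<close>

lemma continuous_hom_fps_at:
  assumes h: "continuous_hom h" and "no_const g" "no_const (h g)"
  shows "h (fps_at l g) = fps_at l (h g)"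
proof -
  have "h (psubst (\<lambda>_. g) f) = psubst (\<lambda>_. h g) f" for f :: "(unit, 'b) pseries"
    by (rule continuous_hom_eqI [where h = "\<lambda>f. h (psubst (\<lambda>_. g) f)"])
      (simp_all add: assms psubst_Var continuous_hom_comp [OF h] continuous_hom_psubst)
  then show ?thesis using assms by (simp add: fps_at_eq_psubst)
qed

lemma unit_multiset_eq_iff: "m = n \<longleftrightarrow> size m = size n" for m n :: "unit multiset"
proof
  assume "size m = size n"
  have "m = replicate_mset (size m) ()" by (rule unit_multiset)
  also have "\<dots> = n" unfolding \<open>size m = size n\<close> by (rule unit_multiset [symmetric])
  finally show "m = n" .
qed simp

lemma pseries_of_fps_mult: "pseries_of_fps (l * l') = pseries_of_fps l * pseries_of_fps l'"
proof (rule pseries_eqI)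
  fix m :: "unit multiset"
  have diff_eq_size: "size m - size a = size b" if "size a + size b = size m" for a b :: "unit multiset"
    using that by simp
  have "pcoeff (pseries_of_fps l * pseries_of_fps l') m
      = (\<Sum>(a, b) | a + b = m. fps_nth l (size a) * fps_nth l' (size b))"
    by (simp add: pcoeff_mult pseries_of_fps.rep_eq)
  also have "\<dots> = (\<Sum>i=0..size m. fps_nth l i * fps_nth l' (size m - i))"
    by (rule sum.reindex_bij_witness [where j = "\<lambda>(a, b). size a"
          and i = "\<lambda>i. (replicate_mset i (), replicate_mset (size m - i) ())"])
      (auto simp: unit_multiset_eq_iff diff_eq_size)
  finally show "pcoeff (pseries_of_fps (l * l')) m = pcoeff (pseries_of_fps l * pseries_of_fps l') m"
    by (simp add: pseries_of_fps.rep_eq fps_mult_nth)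
qed

lemma pseries_of_fps_power: "pseries_of_fps (l ^ k) = pseries_of_fps l ^ k"
proof (induction k)
  case 0
  show ?case by (rule pseries_eqI) (simp add: pseries_of_fps.rep_eq)
qed (simp add: pseries_of_fps_mult)

text \<open>The universal case, with the variable itself in place of \<open>g\<close>, is the
  coefficient formula of \<open>fps_compose\<close>. Substituting \<open>g\<close> for the variable
  commutes with \<open>fps_at\<close> and gives the general case.\<close>

lemma fps_at_compose:
  assumes "fps_nth l' 0 = 0" "no_const g"
  shows "fps_at l (fps_at l' g) = fps_at (fps_compose l l') g"
proof -
  have *: "fps_at l (pseries_of_fps l') = pseries_of_fps (fps_compose l l')"
    by (rule pseries_eqI)
      (simp add: fps_at.rep_eq pseries_of_fps.rep_eq fps_compose_nth atMost_atLeast0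
        flip: pseries_of_fps_power)
  have "fps_at (fps_compose l l') g = psubst (\<lambda>_. g) (fps_at l (pseries_of_fps l'))"
    using assms by (simp add: fps_at_eq_psubst *)
  also have "\<dots> = fps_at l (psubst (\<lambda>_. g) (pseries_of_fps l'))"
  proof (rule continuous_hom_fps_at)
    show "continuous_hom (psubst (\<lambda>_ :: unit. g))" using assms by (intro continuous_hom_psubst)
    show "no_const (pseries_of_fps l')" using assms by (simp add: no_const_def pseries_of_fps.rep_eq)
    show "no_const (psubst (\<lambda>_. g) (pseries_of_fps l'))"
      using assms by (simp flip: fps_at_eq_psubst)
  qed
  finally show ?thesis using assms by (simp add: fps_at_eq_psubst)
qed

lemma fps_at_X:
  assumes "no_const g"
  shows "fps_at fps_X g = g"
proof -
  have "pseries_of_fps fps_X = (Var () :: (unit, 'b) pseries)"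
    by (rule pseries_eqI) (simp add: pseries_of_fps.rep_eq unit_multiset_eq_iff)
  then show ?thesis using assms psubst_Var [of "\<lambda>_. g"] by (simp add: fps_at_eq_psubst)
qed

lemma fps_at_0: "fps_nth l 0 = 0 \<Longrightarrow> fps_at l 0 = 0"
  by (rule pseries_eqI) (auto simp: fps_at.rep_eq power_0_left intro!: sum.neutral)


section \<open>Divided differences\<close>

text \<open>This is \<open>(l(X) - l(Y)) / (X - Y)\<close>. As \<open>X^(k+1) - Y^(k+1)\<close> is
  \<open>X - Y\<close> times the sum of all monomials of degree \<open>k\<close>, every such
  monomial gets the coefficient of \<open>l\<close> at \<open>k + 1\<close>.\<close>

lift_definition divided_difference :: "'r fps \<Rightarrow> (xy, 'r :: comm_ring_1) pseries"
  is "\<lambda>l m. fps_nth l (Suc (size m))"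
proof -
  fix d
  \<comment> \<open>A coefficient that depends on the degree alone is admissible only because two
    variables give finitely many monomials in each degree.\<close>
  have "finite {m :: xy multiset. size m \<le> d}"
  proof (rule finite_subset)
    show "{m. size m \<le> d} \<subseteq> (\<lambda>(i, j). replicate_mset i X + replicate_mset j Y) ` ({..d} \<times> {..d})"
    proof safe
      fix m :: "xy multiset" assume "size m \<le> d"
      have m: "m = replicate_mset (count m X) X + replicate_mset (count m Y) Y"
      proof (rule multiset_eqI)
        show "count m v = count (replicate_mset (count m X) X + replicate_mset (count m Y) Y) v" for v
          by (cases v) auto
      qed
      have "count m X \<le> d" "count m Y \<le> d"
        using \<open>size m \<le> d\<close> count_le_size [of m X] count_le_size [of m Y] by linarith+
      then show "m \<in> (\<lambda>(i, j). replicate_mset i X + replicate_mset j Y) ` ({..d} \<times> {..d})"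
        by (intro image_eqI [of _ _ "(count m X, count m Y)"]) (simp_all only: prod.case m [symmetric] mem_Sigma_iff atMost_iff)
    qed
  qed simp
  then show "finite {m :: xy multiset. size m \<le> d \<and> fps_nth l (Suc (size m)) \<noteq> 0}" for l :: "'r fps"
    by (rule rev_finite_subset) auto
qed

lemma pcoeff_Var_power:
  "pcoeff (Var v ^ k) m = (if m = replicate_mset k v then 1 else 0)"
  using pcoeff_pmonom [of "replicate_mset k v" m] by (simp add: pmonom_def)

text \<open>On the right, monomials containing both variables cancel, and pure powers of
  \<open>X\<close> or \<open>Y\<close> survive with opposite signs. On the left the empty monomial
  cancels instead.\<close>

lemma fps_at_Var_diff:
  "fps_at l (Var X) - fps_at l (Var Y) = divided_difference l * (Var X - Var Y)"
proof (rule pseries_eqI)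
  fix m :: "xy multiset"
  have *: "pcoeff (fps_at l (Var v)) m = (if set_mset m \<subseteq> {v} then fps_nth l (size m) else 0)" for v
  proof -
    have "m = replicate_mset k v \<longleftrightarrow> k = size m \<and> set_mset m \<subseteq> {v}" for k
      by (metis count_replicate_mset set_mset_replicate_mset_subset set_mset_subset_singletonD
          size_replicate_mset subset_singleton_iff)
    then show ?thesis
      by (simp add: fps_at.rep_eq pcoeff_Var_power if_distrib [of "(*) _"] cong: if_cong)
  qed
  have **: "pcoeff (Var v * divided_difference l) m = (if v \<in># m then fps_nth l (size m) else 0)" for v
    by (simp add: pcoeff_Var_mult divided_difference.rep_eq size_Diff_singleton Suc_diff_1 nonempty_has_size)
      (metis Suc_pred nonempty_has_size empty_iff set_mset_empty)
  have "set_mset m \<subseteq> {X} \<longleftrightarrow> Y \<notin># m" "set_mset m \<subseteq> {Y} \<longleftrightarrow> X \<notin># m"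
    by (metis (full_types) insertCI singletonD subset_iff xy.exhaust xy.distinct(1))+
  then show "pcoeff (fps_at l (Var X) - fps_at l (Var Y)) m
      = pcoeff (divided_difference l * (Var X - Var Y)) m"
    by (simp add: right_diff_distrib mult.commute [of "divided_difference l"] * **)
qed

text \<open>Specialise \<open>X\<close> and \<open>Y\<close> to \<open>g\<close> and
  \<open>h\<close>: the image of the divided difference is an explicit quotient, so no cancellation
  is involved.\<close>

lemma diff_dvd_fps_at_diff:
  assumes "fps_nth l 0 = 0" "no_const g" "no_const h"
  shows "g - h dvd fps_at l g - fps_at l h"
proof -
  let ?s = "psubst (case_xy g h)"
  have nc: "no_const (case_xy g h v)" for v using assms by (cases v) auto
  then have hom: "continuous_hom ?s" by (rule continuous_hom_psubst)
  have Var: "?s (Var X) = g" "?s (Var Y) = h" using nc by (simp_all add: psubst_Var)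
  have "?s (fps_at l (Var v)) = fps_at l (?s (Var v))" for v
    using assms by (cases v) (simp_all add: continuous_hom_fps_at [OF hom] Var)
  then have "fps_at l g - fps_at l h = ?s (divided_difference l * (Var X - Var Y))"
    by (simp add: continuous_hom_diff [OF hom] Var flip: fps_at_Var_diff)
  then show ?thesis by (simp add: continuous_hom_mult [OF hom] continuous_hom_diff [OF hom] Var)
qed

lemma dvd_fps_at: "fps_nth l 0 = 0 \<Longrightarrow> no_const g \<Longrightarrow> g dvd fps_at l g"
  using diff_dvd_fps_at_diff [of l g 0] by (simp add: fps_at_0)

section \<open>Localization\<close>

text \<open>Maps out of quotients apply a formula to all representatives at once. Their value is
  meaningful once the image is a single point, that is, once the formula is independent of the
  representative.\<close>

lemma the_elem_image_eq:
  assumes "x \<in> A" "\<And>y. y \<in> A \<Longrightarrow> f y = c"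
  shows "the_elem (f ` A) = c"
proof -
  have "f ` A = {c}" using assms by auto
  then show ?thesis by simp
qed

lemma the_elem_pairs_image_eq:
  assumes "(a, s) \<in> p" "(b, t) \<in> q"
    and "\<And>a s b t. (a, s) \<in> p \<Longrightarrow> (b, t) \<in> q \<Longrightarrow> f a s b t = c"
  shows "the_elem ((\<lambda>((a, s), (b, t)). f a s b t) ` (p \<times> q)) = c"
  by (rule the_elem_image_eq [of "((a, s), (b, t))"]) (use assms in auto)

section \<open>Units, cross-multiplication, isomorphisms\<close>

lemma ring_hom_Units:
  assumes "monoid A" "h \<in> ring_hom A B" "u \<in> Units A"
  shows "h u \<in> Units B"
proof -
  interpret A: monoid A by fact
  obtain v where v: "v \<in> carrier A" "u \<otimes>\<^bsub>A\<^esub> v = \<one>\<^bsub>A\<^esub>" "v \<otimes>\<^bsub>A\<^esub> u = \<one>\<^bsub>A\<^esub>"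
    using assms(3) by (auto simp: Units_def)
  have u: "u \<in> carrier A" using assms(3) by (rule A.Units_closed)
  show ?thesis unfolding Units_def
  proof (intro CollectI conjI bexI [of _ "h v"])
    show "h v \<otimes>\<^bsub>B\<^esub> h u = \<one>\<^bsub>B\<^esub>" "h u \<otimes>\<^bsub>B\<^esub> h v = \<one>\<^bsub>B\<^esub>"
      using ring_hom_mult [OF assms(2)] ring_hom_one [OF assms(2)] u v by metis+
  qed (use u v ring_hom_closed [OF assms(2)] in auto)
qed

lemma (in comm_monoid) Units_factor:
  assumes "a \<otimes> b \<in> Units G" "a \<in> carrier G" "b \<in> carrier G"
  shows "a \<in> Units G" "b \<in> Units G"
proof -
  obtain c where c: "c \<in> carrier G" "c \<otimes> (a \<otimes> b) = \<one>" using assms(1) by (auto simp: Units_def)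
  then have "a \<otimes> (b \<otimes> c) = \<one>" "b \<otimes> (a \<otimes> c) = \<one>" using assms by (simp_all add: m_ac)
  then have "b \<otimes> c \<otimes> a = \<one>" "a \<otimes> c \<otimes> b = \<one>" using assms c by (simp_all add: m_comm)
  then show "a \<in> Units G" "b \<in> Units G"
    using assms c \<open>a \<otimes> (b \<otimes> c) = \<one>\<close> \<open>b \<otimes> (a \<otimes> c) = \<one>\<close> unfolding Units_def by blast+
qed

lemma (in comm_monoid) inv_mult_swap:
  assumes "s \<in> Units G" "t \<in> Units G" "a \<in> carrier G" "b \<in> carrier G" "a \<otimes> t = b \<otimes> s"
  shows "a \<otimes> inv s = b \<otimes> inv t"
proof -
  have [simp]: "s \<in> carrier G" "t \<in> carrier G" using assms by auto
  have "a \<otimes> inv s \<otimes> t = (a \<otimes> t) \<otimes> inv s" using assms(1-4) by (simp add: m_ac)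
  also have "\<dots> = b" using assms by (simp add: m_assoc)
  finally have "(a \<otimes> inv s \<otimes> t) \<otimes> inv t = b \<otimes> inv t" by simp
  then show ?thesis using assms(1-4) by (simp add: m_assoc)
qed

lemma ring_iso_if_inverses:
  assumes "h \<in> ring_hom A B" "k \<in> ring_hom B A"
    and "\<And>x. x \<in> carrier A \<Longrightarrow> k (h x) = x" "\<And>y. y \<in> carrier B \<Longrightarrow> h (k y) = y"
  shows "h \<in> ring_iso A B"
  unfolding ring_iso_def
  using assms by (auto intro!: bij_betw_byWitness [where f' = k] dest: ring_hom_closed)

section \<open>Rings of fractions\<close>

locale cring_denominators = cring S for S :: "'a ring" (structure) +
  fixes D
  assumes D_subset: "D \<subseteq> carrier S" and one_D: "\<one> \<in> D"
    and mult_D: "s \<in> D \<Longrightarrow> t \<in> D \<Longrightarrow> s \<otimes> t \<in> D"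
begin

lemma D_closed [simp]: "s \<in> D \<Longrightarrow> s \<in> carrier S"
  using D_subset by blast

declare one_D [simp] mult_D [simp]

abbreviation "Loc \<equiv> localization S D"
abbreviation "fr \<equiv> fraction S D"

lemma equiv_frac_rel: "equiv (carrier S \<times> D) (frac_rel S D)"
proof (rule equivI)
  show "frac_rel S D \<subseteq> (carrier S \<times> D) \<times> (carrier S \<times> D)" by (auto simp: frac_rel_def)
  show "refl_on (carrier S \<times> D) (frac_rel S D)" by (auto simp: refl_on_def frac_rel_def)
  show "sym (frac_rel S D)" by (auto simp: sym_def frac_rel_def) metis
  show "trans (frac_rel S D)"
  proof (rule transI)
    fix x y z assume "(x, y) \<in> frac_rel S D" "(y, z) \<in> frac_rel S D"
    then obtain a s b t c r u v where xyz: "x = (a, s)" "y = (b, t)" "z = (c, r)"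
      and [simp]: "a \<in> carrier S" "s \<in> D" "b \<in> carrier S" "t \<in> D" "c \<in> carrier S" "r \<in> D" "u \<in> D" "v \<in> D"
      and u: "u \<otimes> (a \<otimes> t) = u \<otimes> (b \<otimes> s)" and v: "v \<otimes> (b \<otimes> r) = v \<otimes> (c \<otimes> t)"
      unfolding frac_rel_def by auto
    \<comment> \<open>The middle denominator \<open>t\<close> cannot be cancelled, so it is put into
      the witness together with \<open>u\<close> and \<open>v\<close>.\<close>
    have "(u \<otimes> v \<otimes> t) \<otimes> (a \<otimes> r) = (v \<otimes> r) \<otimes> (u \<otimes> (a \<otimes> t))" by (simp add: m_ac)
    also have "\<dots> = (u \<otimes> s) \<otimes> (v \<otimes> (b \<otimes> r))" by (simp add: u) (simp add: m_ac)
    also have "\<dots> = (u \<otimes> v \<otimes> t) \<otimes> (c \<otimes> s)" by (simp add: v) (simp add: m_ac)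
    finally have "\<exists>w\<in>D. w \<otimes> (a \<otimes> r) = w \<otimes> (c \<otimes> s)" by (intro bexI [of _ "u \<otimes> v \<otimes> t"]) simp_all
    then show "(x, z) \<in> frac_rel S D" by (simp add: xyz frac_rel_def)
  qed
qed

lemma frac_eq_iff:
  assumes "a \<in> carrier S" "s \<in> D" "b \<in> carrier S" "t \<in> D"
  shows "fr a s = fr b t \<longleftrightarrow> (\<exists>u\<in>D. u \<otimes> (a \<otimes> t) = u \<otimes> (b \<otimes> s))"
  unfolding fraction_def
  using eq_equiv_class_iff [OF equiv_frac_rel, of "(a, s)" "(b, t)"] assms by (simp add: frac_rel_def)

lemma frac_eqI:
  assumes "u \<otimes> (a \<otimes> t) = u \<otimes> (b \<otimes> s)" "u \<in> D" "a \<in> carrier S" "s \<in> D" "b \<in> carrier S" "t \<in> D"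
  shows "fr a s = fr b t"
  using assms frac_eq_iff by blast

lemma frac_carrier [simp]: "a \<in> carrier S \<Longrightarrow> s \<in> D \<Longrightarrow> fr a s \<in> carrier Loc"
  unfolding localization_def fraction_def by (simp add: quotientI)

lemma frac_cases:
  assumes "p \<in> carrier Loc"
  obtains a s where "p = fr a s" "a \<in> carrier S" "s \<in> D"
  using assms unfolding localization_def fraction_def by (auto elim!: quotientE)

lemma mem_frac_iff:
  assumes "a \<in> carrier S" "s \<in> D"
  shows "(b, t) \<in> fr a s \<longleftrightarrow> b \<in> carrier S \<and> t \<in> D \<and> fr a s = fr b t"
  using assms frac_eq_iff [of a s b t] by (auto simp: fraction_def frac_rel_def)

lemma frac_mem: "a \<in> carrier S \<Longrightarrow> s \<in> D \<Longrightarrow> (a, s) \<in> fr a s"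
  by (simp add: mem_frac_iff)

lemma the_elem_frac:
  assumes "a \<in> carrier S" "s \<in> D"
    and "\<And>b t. b \<in> carrier S \<Longrightarrow> t \<in> D \<Longrightarrow> fr a s = fr b t \<Longrightarrow> f (b, t) = f (a, s)"
  shows "the_elem (f ` fr a s) = f (a, s)"
proof (rule the_elem_image_eq [OF frac_mem [OF assms(1,2)]])
  show "f p = f (a, s)" if "p \<in> fr a s" for p
    using that mem_frac_iff [OF assms(1,2)] assms(3) by (cases p) blast
qed

text \<open>The witnesses \<open>u\<close> and \<open>v\<close> for changing the two representatives
  multiply to a witness for changing the product.\<close>

lemma frac_mult [simp]:
  assumes [simp]: "a \<in> carrier S" "s \<in> D" "b \<in> carrier S" "t \<in> D"
  shows "fr a s \<otimes>\<^bsub>Loc\<^esub> fr b t = fr (a \<otimes> b) (s \<otimes> t)"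
proof -
  have "fr (a' \<otimes> b') (s' \<otimes> t') = fr (a \<otimes> b) (s \<otimes> t)"
    if "(a', s') \<in> fr a s" "(b', t') \<in> fr b t" for a' s' b' t'
  proof -
    from that have [simp]: "a' \<in> carrier S" "s' \<in> D" "b' \<in> carrier S" "t' \<in> D"
      and "fr a' s' = fr a s" "fr b' t' = fr b t"
      by (auto simp: mem_frac_iff)
    then obtain u v where [simp]: "u \<in> D" "v \<in> D"
      and u: "u \<otimes> (a' \<otimes> s) = u \<otimes> (a \<otimes> s')" and v: "v \<otimes> (b' \<otimes> t) = v \<otimes> (b \<otimes> t')"
      by (auto simp: frac_eq_iff)
    have "(u \<otimes> v) \<otimes> ((a' \<otimes> b') \<otimes> (s \<otimes> t)) = (u \<otimes> (a' \<otimes> s)) \<otimes> (v \<otimes> (b' \<otimes> t))" by (simp add: m_ac)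
    also have "\<dots> = (u \<otimes> v) \<otimes> ((a \<otimes> b) \<otimes> (s' \<otimes> t'))" by (simp add: u v) (simp add: m_ac)
    finally show ?thesis by (rule frac_eqI) simp_all
  qed
  then have "the_elem ((\<lambda>((a, s), (b, t)). fr (a \<otimes> b) (s \<otimes> t)) ` (fr a s \<times> fr b t)) = fr (a \<otimes> b) (s \<otimes> t)"
    by (intro the_elem_pairs_image_eq [of a s _ b t] frac_mem assms)
  then show ?thesis by (simp add: localization_def)
qed

text \<open>Each of the two cross-multiplied summands uses one of the two equations, so
  \<open>u \<otimes> v\<close> is a witness here as well.\<close>

lemma frac_add [simp]:
  assumes [simp]: "a \<in> carrier S" "s \<in> D" "b \<in> carrier S" "t \<in> D"
  shows "fr a s \<oplus>\<^bsub>Loc\<^esub> fr b t = fr (a \<otimes> t \<oplus> b \<otimes> s) (s \<otimes> t)"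
proof -
  have "fr (a' \<otimes> t' \<oplus> b' \<otimes> s') (s' \<otimes> t') = fr (a \<otimes> t \<oplus> b \<otimes> s) (s \<otimes> t)"
    if "(a', s') \<in> fr a s" "(b', t') \<in> fr b t" for a' s' b' t'
  proof -
    from that have [simp]: "a' \<in> carrier S" "s' \<in> D" "b' \<in> carrier S" "t' \<in> D"
      and "fr a' s' = fr a s" "fr b' t' = fr b t"
      by (auto simp: mem_frac_iff)
    then obtain u v where [simp]: "u \<in> D" "v \<in> D"
      and u: "u \<otimes> (a' \<otimes> s) = u \<otimes> (a \<otimes> s')" and v: "v \<otimes> (b' \<otimes> t) = v \<otimes> (b \<otimes> t')"
      by (auto simp: frac_eq_iff)
    have "(u \<otimes> v) \<otimes> ((a' \<otimes> t' \<oplus> b' \<otimes> s') \<otimes> (s \<otimes> t))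
        = (v \<otimes> t \<otimes> t') \<otimes> (u \<otimes> (a' \<otimes> s)) \<oplus> (u \<otimes> s \<otimes> s') \<otimes> (v \<otimes> (b' \<otimes> t))"
      by (simp add: l_distr r_distr m_ac)
    also have "\<dots> = (u \<otimes> v) \<otimes> ((a \<otimes> t \<oplus> b \<otimes> s) \<otimes> (s' \<otimes> t'))"
      by (simp add: u v) (simp add: l_distr r_distr m_ac)
    finally show ?thesis by (rule frac_eqI) simp_all
  qed
  then have "the_elem ((\<lambda>((a, s), (b, t)). fr (a \<otimes> t \<oplus> b \<otimes> s) (s \<otimes> t)) ` (fr a s \<times> fr b t)) = fr (a \<otimes> t \<oplus> b \<otimes> s) (s \<otimes> t)"
    by (intro the_elem_pairs_image_eq [of a s _ b t] frac_mem assms)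
  then show ?thesis by (simp add: localization_def)
qed

lemma one_Loc: "\<one>\<^bsub>Loc\<^esub> = fr \<one> \<one>" and zero_Loc: "\<zero>\<^bsub>Loc\<^esub> = fr \<zero> \<one>"
  by (simp_all add: localization_def)

lemma cring_Loc: "cring Loc"
proof (rule cringI)
  show "abelian_group Loc"
  proof (rule abelian_groupI)
    fix x assume "x \<in> carrier Loc"
    then obtain a s where x: "x = fr a s" and [simp]: "a \<in> carrier S" "s \<in> D" by (rule frac_cases)
    have "fr (\<ominus> a) s \<oplus>\<^bsub>Loc\<^esub> x = \<zero>\<^bsub>Loc\<^esub>"
      by (simp add: x zero_Loc l_minus l_neg) (rule frac_eqI [where u = \<one>]; simp)
    then show "\<exists>y\<in>carrier Loc. y \<oplus>\<^bsub>Loc\<^esub> x = \<zero>\<^bsub>Loc\<^esub>"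
      by (intro bexI [of _ "fr (\<ominus> a) s"]) simp_all
    show "\<zero>\<^bsub>Loc\<^esub> \<oplus>\<^bsub>Loc\<^esub> x = x" by (simp add: x zero_Loc)
  next
    fix x y z assume "x \<in> carrier Loc" "y \<in> carrier Loc" "z \<in> carrier Loc"
    then show "x \<oplus>\<^bsub>Loc\<^esub> y \<oplus>\<^bsub>Loc\<^esub> z = x \<oplus>\<^bsub>Loc\<^esub> (y \<oplus>\<^bsub>Loc\<^esub> z)"
      by (elim frac_cases) (simp add: l_distr r_distr m_ac a_ac)
  next
    fix x y assume "x \<in> carrier Loc" "y \<in> carrier Loc"
    then show "x \<oplus>\<^bsub>Loc\<^esub> y = y \<oplus>\<^bsub>Loc\<^esub> x" "x \<oplus>\<^bsub>Loc\<^esub> y \<in> carrier Loc"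
      by (auto elim!: frac_cases simp: m_ac a_ac)
  qed (simp add: zero_Loc)
  show "Group.comm_monoid Loc"
  proof (rule comm_monoidI)
    fix x y z assume "x \<in> carrier Loc" "y \<in> carrier Loc" "z \<in> carrier Loc"
    then show "x \<otimes>\<^bsub>Loc\<^esub> y \<otimes>\<^bsub>Loc\<^esub> z = x \<otimes>\<^bsub>Loc\<^esub> (y \<otimes>\<^bsub>Loc\<^esub> z)"
      by (elim frac_cases) (simp add: m_ac)
  next
    fix x y assume "x \<in> carrier Loc" "y \<in> carrier Loc"
    then show "x \<otimes>\<^bsub>Loc\<^esub> y = y \<otimes>\<^bsub>Loc\<^esub> x" "x \<otimes>\<^bsub>Loc\<^esub> y \<in> carrier Loc"
      by (auto elim!: frac_cases simp: m_ac)
  next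
    fix x assume "x \<in> carrier Loc"
    then show "\<one>\<^bsub>Loc\<^esub> \<otimes>\<^bsub>Loc\<^esub> x = x" by (elim frac_cases) (simp add: one_Loc)
  qed (simp add: one_Loc)
next
  fix x y z assume "x \<in> carrier Loc" "y \<in> carrier Loc" "z \<in> carrier Loc"
  then obtain a s b t c r where "x = fr a s" "y = fr b t" "z = fr c r"
    and [simp]: "a \<in> carrier S" "s \<in> D" "b \<in> carrier S" "t \<in> D" "c \<in> carrier S" "r \<in> D"
    by (metis frac_cases)
  then show "(x \<oplus>\<^bsub>Loc\<^esub> y) \<otimes>\<^bsub>Loc\<^esub> z = x \<otimes>\<^bsub>Loc\<^esub> z \<oplus>\<^bsub>Loc\<^esub> y \<otimes>\<^bsub>Loc\<^esub> z"
    by simp (rule frac_eqI [where u = \<one>]; simp add: l_distr r_distr m_ac)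
qed

sublocale L: cring Loc by (rule cring_Loc)

section \<open>The canonical map and its universal property\<close>

abbreviation "loc_of a \<equiv> fr a \<one>"

lemma loc_of_hom: "loc_of \<in> ring_hom S Loc"
  by (rule ring_hom_memI) (simp_all add: one_Loc)

lemma loc_of_Units:
  assumes [simp]: "s \<in> D"
  shows "loc_of s \<in> Units Loc" "inv\<^bsub>Loc\<^esub> (loc_of s) = fr \<one> s"
proof -
  have eq: "loc_of s \<otimes>\<^bsub>Loc\<^esub> fr \<one> s = \<one>\<^bsub>Loc\<^esub>"
    by (simp add: one_Loc) (rule frac_eqI [where u = \<one>]; simp)
  show "loc_of s \<in> Units Loc"
    by (rule L.Units_factor [of _ "fr \<one> s"]) (simp_all only: eq L.Units_one_closed, simp_all)
  show "inv\<^bsub>Loc\<^esub> (loc_of s) = fr \<one> s" using eq by (intro L.comm_inv_char) simp_all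
qed

lemma frac_eq_mult_inv: "a \<in> carrier S \<Longrightarrow> s \<in> D \<Longrightarrow> fr a s = loc_of a \<otimes>\<^bsub>Loc\<^esub> inv\<^bsub>Loc\<^esub> (loc_of s)"
  by (simp add: loc_of_Units)

text \<open>Uniqueness of extensions: a homomorphism takes \<open>a / s\<close> to an element whose
  product with the image of \<open>s\<close> is the image of \<open>a\<close>, and the image of
  \<open>s\<close> is a unit.\<close>

lemma loc_hom_eqI:
  assumes "cring B" "h \<in> ring_hom Loc B" "k \<in> ring_hom Loc B"
    and eq: "\<And>a. a \<in> carrier S \<Longrightarrow> h (loc_of a) = k (loc_of a)" and "p \<in> carrier Loc"
  shows "h p = k p"
proof -
  interpret B: cring B by fact
  obtain a s where p: "p = fr a s" and [simp]: "a \<in> carrier S" "s \<in> D"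
    using assms(5) by (rule frac_cases)
  have "fr a s \<otimes>\<^bsub>Loc\<^esub> loc_of s = loc_of a" by simp (rule frac_eqI [where u = \<one>]; simp add: m_comm)
  then have "f (fr a s) \<otimes>\<^bsub>B\<^esub> f (loc_of s) = f (loc_of a)" if "f \<in> ring_hom Loc B" for f
    using ring_hom_mult [OF that, of "fr a s" "loc_of s"] by simp
  from this [OF assms(2)] this [OF assms(3)]
  have "h (fr a s) \<otimes>\<^bsub>B\<^esub> h (loc_of s) = k (fr a s) \<otimes>\<^bsub>B\<^esub> h (loc_of s)"
    by (simp add: eq)
  moreover have "h (loc_of s) \<in> Units B"
    using ring_hom_Units [OF L.monoid_axioms assms(2)] loc_of_Units by simp
  moreover have "h (fr a s) \<in> carrier B" "k (fr a s) \<in> carrier B"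
    using assms(2,3) by (auto intro: ring_hom_closed)
  ultimately show ?thesis
    unfolding p by (metis B.Units_closed B.Units_l_cancel B.m_comm)
qed

context
  fixes B :: "'b ring" and g
  assumes cring_B: "cring B" and g: "g \<in> ring_hom S B" and g_D: "g ` D \<subseteq> Units B"
begin

interpretation B: cring B by (rule cring_B)

text \<open>The witness \<open>u\<close> of an equality of fractions is itself a denominator, hence
  becomes a unit of \<open>B\<close> and can be cancelled there.\<close>

lemma loc_extend_frac:
  assumes [simp]: "a \<in> carrier S" "s \<in> D"
  shows "loc_extend B g (fr a s) = g a \<otimes>\<^bsub>B\<^esub> inv\<^bsub>B\<^esub> (g s)"
proof -
  have "g b \<otimes>\<^bsub>B\<^esub> inv\<^bsub>B\<^esub> (g t) = g a \<otimes>\<^bsub>B\<^esub> inv\<^bsub>B\<^esub> (g s)"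
    if [simp]: "b \<in> carrier S" "t \<in> D" and eq: "fr a s = fr b t" for b t
  proof (rule B.inv_mult_swap)
    obtain u where [simp]: "u \<in> D" and u: "u \<otimes>\<^bsub>S\<^esub> (b \<otimes>\<^bsub>S\<^esub> s) = u \<otimes>\<^bsub>S\<^esub> (a \<otimes>\<^bsub>S\<^esub> t)"
      using eq by (auto simp: frac_eq_iff)
    then have "g u \<otimes>\<^bsub>B\<^esub> (g b \<otimes>\<^bsub>B\<^esub> g s) = g u \<otimes>\<^bsub>B\<^esub> (g a \<otimes>\<^bsub>B\<^esub> g t)"
      by (simp flip: ring_hom_mult [OF g])
    then show "g b \<otimes>\<^bsub>B\<^esub> g s = g a \<otimes>\<^bsub>B\<^esub> g t"
      using g_D by (simp add: B.Units_l_cancel ring_hom_closed [OF g] image_subset_iff)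
  qed (use g_D that in \<open>auto simp: ring_hom_closed [OF g]\<close>)
  then have "the_elem ((\<lambda>(a, s). g a \<otimes>\<^bsub>B\<^esub> inv\<^bsub>B\<^esub> (g s)) ` fr a s)
      = (case (a, s) of (a, s) \<Rightarrow> g a \<otimes>\<^bsub>B\<^esub> inv\<^bsub>B\<^esub> (g s))"
    by (intro the_elem_frac [OF assms]) (unfold prod.case)
  then show ?thesis unfolding loc_extend_def by simp
qed

lemma loc_extend_of: "a \<in> carrier S \<Longrightarrow> loc_extend B g (loc_of a) = g a"
  by (simp add: loc_extend_frac ring_hom_one [OF g] ring_hom_closed [OF g])

lemma loc_extend_hom: "loc_extend B g \<in> ring_hom Loc B"
proof -
  have [simp]: "g a \<in> carrier B" if "a \<in> carrier S" for a using that g by (rule ring_hom_closed [rotated])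
  have [simp]: "g s \<in> Units B" if "s \<in> D" for s using that g_D by blast
  have inv: "inv\<^bsub>B\<^esub> (g s \<otimes>\<^bsub>B\<^esub> g t) = inv\<^bsub>B\<^esub> (g s) \<otimes>\<^bsub>B\<^esub> inv\<^bsub>B\<^esub> (g t)" if "s \<in> D" "t \<in> D" for s t
  proof (rule B.comm_inv_char)
    have "g s \<otimes>\<^bsub>B\<^esub> g t \<otimes>\<^bsub>B\<^esub> (inv\<^bsub>B\<^esub> (g s) \<otimes>\<^bsub>B\<^esub> inv\<^bsub>B\<^esub> (g t))
        = (g s \<otimes>\<^bsub>B\<^esub> inv\<^bsub>B\<^esub> (g s)) \<otimes>\<^bsub>B\<^esub> (g t \<otimes>\<^bsub>B\<^esub> inv\<^bsub>B\<^esub> (g t))"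
      using that by (simp add: B.m_ac)
    also have "\<dots> = \<one>\<^bsub>B\<^esub>" using that by simp
    finally show "g s \<otimes>\<^bsub>B\<^esub> g t \<otimes>\<^bsub>B\<^esub> (inv\<^bsub>B\<^esub> (g s) \<otimes>\<^bsub>B\<^esub> inv\<^bsub>B\<^esub> (g t)) = \<one>\<^bsub>B\<^esub>" .
  qed (use that in auto)
  show ?thesis
  proof (rule ring_hom_memI)
    fix x y assume "x \<in> carrier Loc" "y \<in> carrier Loc"
    then obtain a s b t where xy: "x = fr a s" "y = fr b t"
      and [simp]: "a \<in> carrier S" "s \<in> D" "b \<in> carrier S" "t \<in> D"
      by (metis frac_cases)
    show "loc_extend B g (x \<otimes>\<^bsub>Loc\<^esub> y) = loc_extend B g x \<otimes>\<^bsub>B\<^esub> loc_extend B g y"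
      by (simp add: xy loc_extend_frac ring_hom_mult [OF g] inv B.m_ac)
    have "(g a \<otimes>\<^bsub>B\<^esub> g t) \<otimes>\<^bsub>B\<^esub> (inv\<^bsub>B\<^esub> (g s) \<otimes>\<^bsub>B\<^esub> inv\<^bsub>B\<^esub> (g t)) = g a \<otimes>\<^bsub>B\<^esub> inv\<^bsub>B\<^esub> (g s) \<otimes>\<^bsub>B\<^esub> (g t \<otimes>\<^bsub>B\<^esub> inv\<^bsub>B\<^esub> (g t))"
      "(g b \<otimes>\<^bsub>B\<^esub> g s) \<otimes>\<^bsub>B\<^esub> (inv\<^bsub>B\<^esub> (g s) \<otimes>\<^bsub>B\<^esub> inv\<^bsub>B\<^esub> (g t)) = g b \<otimes>\<^bsub>B\<^esub> inv\<^bsub>B\<^esub> (g t) \<otimes>\<^bsub>B\<^esub> (g s \<otimes>\<^bsub>B\<^esub> inv\<^bsub>B\<^esub> (g s))"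
      by (simp_all add: B.m_ac del: B.Units_r_inv)
    then show "loc_extend B g (x \<oplus>\<^bsub>Loc\<^esub> y) = loc_extend B g x \<oplus>\<^bsub>B\<^esub> loc_extend B g y"
      by (simp add: xy loc_extend_frac ring_hom_mult [OF g] ring_hom_add [OF g] inv B.l_distr)
  next
    fix x assume "x \<in> carrier Loc"
    then show "loc_extend B g x \<in> carrier B" by (elim frac_cases) (simp add: loc_extend_frac)
  next
    show "loc_extend B g \<one>\<^bsub>Loc\<^esub> = \<one>\<^bsub>B\<^esub>"
      by (simp add: one_Loc loc_extend_frac ring_hom_one [OF g])
  qed
qed

end

end

section \<open>Denominators generated by a set\<close>

lemma mult_closure_closed:
  assumes "cring S" "A \<subseteq> carrier S"
  shows "cring_denominators S (mult_closure S A)"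
proof -
  interpret cring S by fact
  have closed: "s \<in> carrier S" if "s \<in> mult_closure S A" for s
    using that assms(2) by induction auto
  show ?thesis
  proof
    show "mult_closure S A \<subseteq> carrier S" using closed by blast
    show "\<one>\<^bsub>S\<^esub> \<in> mult_closure S A" by (rule mult_closure.one)
    show "s \<otimes>\<^bsub>S\<^esub> t \<in> mult_closure S A" if "s \<in> mult_closure S A" "t \<in> mult_closure S A" for s t
      using that(1)
    proof induction
      case (mult a s)
      moreover have "a \<in> carrier S" using assms(2) mult.hyps by blast
      ultimately show ?case
        using that(2) by (metis closed m_assoc mult_closure.mult)
    qed (simp add: that closed)
  qed
qed

lemma mult_closure_image:
  assumes "h \<in> ring_hom S B" "cring S" "A \<subseteq> carrier S" "cring B"
    and "\<And>a. a \<in> A \<Longrightarrow> h a \<in> Units B" and "s \<in> mult_closure S A"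
  shows "h s \<in> Units B"
proof -
  interpret S: cring S by fact
  interpret B: cring B by fact
  interpret cring_denominators S "mult_closure S A" by (rule mult_closure_closed) fact+
  show ?thesis using assms(6)
  proof induction
    case one
    then show ?case by (simp add: ring_hom_one [OF assms(1)])
  next
    case (mult a s)
    then have "h (a \<otimes>\<^bsub>S\<^esub> s) = h a \<otimes>\<^bsub>B\<^esub> h s"
      using assms(1,3) by (intro ring_hom_mult) auto
    then show ?case using mult assms(5) by simp
  qed
qed

section \<open>Formal group algebras\<close>

lemma type_ring_simps [simp]:
  "carrier type_ring = UNIV" "x \<otimes>\<^bsub>type_ring\<^esub> y = x * y" "\<one>\<^bsub>type_ring\<^esub> = 1"
  "\<zero>\<^bsub>type_ring\<^esub> = 0" "x \<oplus>\<^bsub>type_ring\<^esub> y = x + y"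
  by (simp_all add: type_ring_def)

lemma cring_type_ring: "cring type_ring"
proof (rule cringI)
  show "abelian_group type_ring"
    by (rule abelian_groupI) (auto simp: algebra_simps intro: exI [of _ "- _"])
  show "Group.comm_monoid type_ring"
    by (rule comm_monoidI) (auto simp: algebra_simps)
qed (simp add: algebra_simps)

interpretation type_ring: cring type_ring
  by (rule cring_type_ring)

lemma type_ring_a_inv [simp]: "\<ominus>\<^bsub>type_ring\<^esub> x = - x"
  by (rule type_ring.minus_equality) simp_all

lemma ideal_type_ringI:
  assumes "0 \<in> J" "\<And>f g. f \<in> J \<Longrightarrow> g \<in> J \<Longrightarrow> f + g \<in> J" "\<And>f g. g \<in> J \<Longrightarrow> f * g \<in> J"
  shows "ideal J type_ring"
proof (rule idealI)
  show "subgroup J (add_monoid type_ring)"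
  proof (rule type_ring.add.subgroupI)
    show "\<ominus>\<^bsub>type_ring\<^esub> f \<in> J" if "f \<in> J" for f
      using assms(3) [OF that, of "- 1"] by simp
  qed (use assms in auto)
qed (use assms in \<open>auto simp: mult.commute type_ring.ring_axioms\<close>)

lemma
  assumes "ideal J type_ring"
  shows ideal_type_ring_0: "0 \<in> J"
    and ideal_type_ring_add: "f \<in> J \<Longrightarrow> g \<in> J \<Longrightarrow> f + g \<in> J"
    and ideal_type_ring_mult: "g \<in> J \<Longrightarrow> f * g \<in> J"
    and ideal_type_ring_diff: "f \<in> J \<Longrightarrow> g \<in> J \<Longrightarrow> f - g \<in> J"
    and ideal_type_ring_dvd: "f \<in> J \<Longrightarrow> f dvd h \<Longrightarrow> h \<in> J"
proof -
  interpret ideal J type_ring by fact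
  show "0 \<in> J" using zero_closed by simp
  show *: "f \<in> J \<Longrightarrow> g \<in> J \<Longrightarrow> f + g \<in> J" for f g using a_closed by simp
  show **: "g \<in> J \<Longrightarrow> f * g \<in> J" for f g using I_l_closed [of g f] by simp
  show "f \<in> J \<Longrightarrow> g \<in> J \<Longrightarrow> f - g \<in> J" using * [of f "- g"] ** [of g "- 1"] by simp
  show "f \<in> J \<Longrightarrow> f dvd h \<Longrightarrow> h \<in> J" using ** [of f] by (auto simp: mult.commute elim!: dvdE)
qed

section \<open>Closed ideals and the ideal of relations\<close>

lemma subset_pclosure: "I \<subseteq> pclosure I"
  unfolding mem_pclosure_iff subset_iff using pcong_refl by blast

lemma pclosure_pclosure: "pclosure (pclosure I) = pclosure I"
proof
  show "pclosure (pclosure I) \<subseteq> pclosure I"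
  proof
    fix f assume f: "f \<in> pclosure (pclosure I)"
    have "\<exists>h\<in>I. pcong d f h" for d
    proof -
      obtain g where "g \<in> pclosure I" "pcong d f g"
        using f mem_pclosure_iff [of f "pclosure I"] by blast
      then show ?thesis unfolding mem_pclosure_iff by (meson pcong_trans)
    qed
    then show "f \<in> pclosure I" by (simp add: mem_pclosure_iff)
  qed
qed (rule subset_pclosure)

text \<open>Approximants of \<open>f\<close> and \<open>g\<close> below degree \<open>d\<close> can
  be added, and multiplied by any series, without losing precision.\<close>

lemma ideal_pclosure:
  assumes "ideal J (type_ring :: ('v, 'r :: comm_ring_1) pseries ring)"
  shows "ideal (pclosure J) type_ring"
proof (rule ideal_type_ringI)
  show "0 \<in> pclosure J" using subset_pclosure ideal_type_ring_0 [OF assms] by blast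
  show "f + g \<in> pclosure J" if "f \<in> pclosure J" "g \<in> pclosure J" for f g
    using that unfolding mem_pclosure_iff by (meson ideal_type_ring_add [OF assms] pcong_add)
  show "f * g \<in> pclosure J" if "g \<in> pclosure J" for f g
    using that unfolding mem_pclosure_iff by (meson ideal_type_ring_mult [OF assms] pcong_mult pcong_refl)
qed

abbreviation fga_relations :: "(xy, 'r :: comm_ring_1) pseries \<Rightarrow> ('m :: ab_group_add, 'r) pseries set" where
  "fga_relations F \<equiv> insert (Var 0) {fgl_plus F (Var a) (Var b) - Var (a + b) | a b. True}"

lemma ideal_fga_ideal: "ideal (fga_ideal F) type_ring"
  unfolding fga_ideal_def by (intro ideal_pclosure type_ring.genideal_ideal) simp

lemma fga_relations_subset: "fga_relations F \<subseteq> fga_ideal F"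
  unfolding fga_ideal_def
  by (rule subset_trans [OF type_ring.genideal_self subset_pclosure]) simp

lemma Var_0_fga_ideal: "Var 0 \<in> fga_ideal F"
  and fgl_plus_fga_ideal: "fgl_plus F (Var a) (Var b) - Var (a + b) \<in> fga_ideal F"
  using fga_relations_subset [of F] by auto

text \<open>The preimage of the target ideal is an ideal, so containing the relations it contains
  the ideal they generate. Continuity extends this to the closure, and the target is already closed.
  Hence only relations ever need checking.\<close>

lemma fga_ideal_mapsto:
  assumes h: "continuous_hom h" and "h (Var 0) \<in> fga_ideal G"
    and "\<And>a b. h (fgl_plus F (Var a) (Var b) - Var (a + b)) \<in> fga_ideal G"
    and f: "f \<in> fga_ideal F"
  shows "h f \<in> fga_ideal G"
proof -
  let ?J = "{f. h f \<in> fga_ideal G}"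
  note G = ideal_fga_ideal [of G]
  have "ideal ?J type_ring"
    by (rule ideal_type_ringI)
      (auto simp: continuous_hom_0 [OF h] continuous_hom_add [OF h] continuous_hom_mult [OF h]
        intro: ideal_type_ring_0 [OF G] ideal_type_ring_add [OF G] ideal_type_ring_mult [OF G])
  then have J: "genideal type_ring (fga_relations F) \<subseteq> ?J"
    by (rule type_ring.genideal_minimal) (use assms(2,3) in auto)
  have "\<exists>g\<in>fga_ideal G. pcong d (h f) g" for d
    using f J continuous_hom_pcong [OF h] unfolding fga_ideal_def [of F] mem_pclosure_iff by blast
  then have "h f \<in> pclosure (fga_ideal G)" by (simp add: mem_pclosure_iff)
  then show ?thesis by (simp add: fga_ideal_def pclosure_pclosure)
qed

section \<open>The quotient ring and induced maps\<close>

lemma cring_fga: "cring (fga F)"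
  unfolding fga_def using ideal_fga_ideal cring_type_ring by (rule ideal.quotient_is_cring)

lemma fga_class_hom: "fga_class F \<in> ring_hom type_ring (fga F)"
  unfolding fga_def fga_class_def using ideal.rcos_ring_hom [OF ideal_fga_ideal [of F]]
  by (simp add: fga_class_def [abs_def])

lemma fga_class_closed [simp]: "fga_class F f \<in> carrier (fga F)"
  using ring_hom_closed [OF fga_class_hom] by simp

lemma fga_class_mult: "fga_class F (f * g) = fga_class F f \<otimes>\<^bsub>fga F\<^esub> fga_class F g"
  and fga_class_add: "fga_class F (f + g) = fga_class F f \<oplus>\<^bsub>fga F\<^esub> fga_class F g"
  and fga_class_1: "fga_class F 1 = \<one>\<^bsub>fga F\<^esub>"
  using ring_hom_mult [OF fga_class_hom, of f g F] ring_hom_add [OF fga_class_hom, of f g F]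
    ring_hom_one [OF fga_class_hom, of F] by simp_all

lemma mem_fga_class_iff: "g \<in> fga_class F f \<longleftrightarrow> g - f \<in> fga_ideal F"
  unfolding fga_class_def a_r_coset_def' by (auto simp: algebra_simps intro: bexI [of _ "g - f"])

lemma fga_class_eq_iff: "fga_class F f = fga_class F g \<longleftrightarrow> f - g \<in> fga_ideal F"
proof
  note I = ideal_fga_ideal [of F]
  assume "fga_class F f = fga_class F g"
  moreover have "f \<in> fga_class F f" by (simp add: mem_fga_class_iff ideal_type_ring_0 [OF I])
  ultimately show "f - g \<in> fga_ideal F" by (simp add: mem_fga_class_iff)
next
  note I = ideal_fga_ideal [of F]
  assume fg: "f - g \<in> fga_ideal F"
  have "h - f \<in> fga_ideal F \<longleftrightarrow> h - g \<in> fga_ideal F" for h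
    using ideal_type_ring_add [OF I _ fg, of "h - f"] ideal_type_ring_diff [OF I _ fg, of "h - g"] by auto
  then show "fga_class F f = fga_class F g" by (auto simp: mem_fga_class_iff)
qed

lemma fga_cases:
  assumes "C \<in> carrier (fga F)"
  obtains f where "C = fga_class F f"
  using assms unfolding fga_def fga_class_def by (auto simp: FactRing_def A_RCOSETS_def')

lemma the_elem_fga_class:
  assumes h: "continuous_hom h" and I: "\<And>f. f \<in> fga_ideal F \<Longrightarrow> h f \<in> fga_ideal G"
  shows "the_elem ((\<lambda>f. fga_class G (h f)) ` fga_class F f) = fga_class G (h f)"
proof (rule the_elem_image_eq)
  show "f \<in> fga_class F f" by (simp add: mem_fga_class_iff ideal_type_ring_0 [OF ideal_fga_ideal])
  show "fga_class G (h g) = fga_class G (h f)" if "g \<in> fga_class F f" for g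
    using that I [of "g - f"] by (simp add: fga_class_eq_iff mem_fga_class_iff continuous_hom_diff [OF h])
qed

text \<open>The values on classes are a hypothesis so that one statement covers
  \<open>S_act\<close>, \<open>phi_S\<close> and \<open>psi_S\<close>, whose well-definedness is
  settled separately.\<close>

lemma fga_hom_induced:
  fixes h :: "('m :: ab_group_add, 'r :: comm_ring_1) pseries \<Rightarrow> ('n :: ab_group_add, 'r) pseries"
  assumes h: "continuous_hom h" and \<phi>: "\<And>f. \<phi> (fga_class F f) = fga_class G (h f)"
  shows "\<phi> \<in> ring_hom (fga F) (fga G)"
proof (rule ring_hom_memI)
  show "\<phi> \<one>\<^bsub>fga F\<^esub> = \<one>\<^bsub>fga G\<^esub>"
    by (simp add: \<phi> continuous_hom_1 [OF h] flip: fga_class_1)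
  fix C D :: "('m, 'r) pseries set" assume "C \<in> carrier (fga F)" "D \<in> carrier (fga F)"
  then obtain f g where [simp]: "C = fga_class F f" "D = fga_class F g" by (metis fga_cases)
  show "\<phi> C \<in> carrier (fga G)" by (simp add: \<phi>)
  show "\<phi> (C \<otimes>\<^bsub>fga F\<^esub> D) = \<phi> C \<otimes>\<^bsub>fga G\<^esub> \<phi> D"
    by (simp add: \<phi> continuous_hom_mult [OF h] flip: fga_class_mult)
  show "\<phi> (C \<oplus>\<^bsub>fga F\<^esub> D) = \<phi> C \<oplus>\<^bsub>fga G\<^esub> \<phi> D"
    by (simp add: \<phi> continuous_hom_add [OF h] flip: fga_class_add)
qed

text \<open>As functions of the law \<open>F\<close>, both sides are continuous homomorphisms that
  send \<open>X\<close> to \<open>h f\<close> and \<open>Y\<close> to \<open>h g\<close>.\<close>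

lemma continuous_hom_fgl_plus:
  assumes h: "continuous_hom h" and "no_const f" "no_const g" "no_const (h f)" "no_const (h g)"
  shows "h (fgl_plus F f g) = fgl_plus F (h f) (h g)"
proof -
  have nc: "no_const (case_xy f g v)" "no_const (case_xy (h f) (h g) v)" for v
    using assms by (cases v; simp)+
  have "h (psubst (case_xy f g) F) = psubst (case_xy (h f) (h g)) F"
  proof (rule continuous_hom_eqI [where h = "\<lambda>F. h (psubst (case_xy f g) F)"])
    show "h (psubst (case_xy f g) (Var v)) = psubst (case_xy (h f) (h g)) (Var v)" for v
      using nc by (cases v) (simp_all add: psubst_Var)
  qed (use nc in \<open>auto intro: continuous_hom_comp [OF h] continuous_hom_psubst\<close>)
  then show ?thesis by (simp add: fgl_plus_def)
qed

lemma fgl_plus_additive: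
  assumes "no_const f" "no_const g"
  shows "fgl_plus additive_fgl f g = f + g"
proof -
  have nc: "no_const (case_xy f g v)" for v using assms by (cases v) simp_all
  show ?thesis unfolding fgl_plus_def additive_fgl_def
    using nc by (simp add: psubst_add psubst_Var)
qed

section \<open>The change of formal group law\<close>

abbreviation lattice_subst :: "('l \<Rightarrow> 'l) \<Rightarrow> (int \<times> 'l, 'r :: comm_ring_1) pseries \<Rightarrow> (int \<times> 'l, 'r) pseries" where
  "lattice_subst w \<equiv> psubst (\<lambda>(k, a). Var (k, w a))"

lemma no_const_lattice_var: "no_const (case p of (k, a) \<Rightarrow> Var (k, w a))"
  by (cases p) simp

lemma continuous_hom_lattice_subst: "continuous_hom (lattice_subst w)"
  by (intro continuous_hom_psubst no_const_lattice_var)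

lemma lattice_subst_Var: "lattice_subst w (Var (k, a)) = Var (k, w a)"
  by (subst psubst_Var) (simp_all add: no_const_lattice_var)

text \<open>Additivity of \<open>w\<close> makes the permutation of variables carry each relation to
  the relation for the transformed lattice points.\<close>

lemma S_act_class:
  assumes "\<And>a b. w (a + b) = w a + w b"
  shows "S_act F w (fga_class F f) = fga_class F (lattice_subst w f)"
  unfolding S_act_def
proof (rule the_elem_fga_class [OF continuous_hom_lattice_subst])
  note hom = continuous_hom_lattice_subst [of w]
  have "w 0 = 0" using assms [of 0 0] by simp
  show "lattice_subst w f \<in> fga_ideal F" if "f \<in> fga_ideal F" for f
  proof (rule fga_ideal_mapsto [OF hom _ _ that])
    show "lattice_subst w (Var 0) \<in> fga_ideal F"
      using Var_0_fga_ideal [where 'a = "int \<times> 'a", of F] \<open>w 0 = 0\<close>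
      by (simp add: zero_prod_def lattice_subst_Var)
    fix p q :: "int \<times> 'a"
    obtain j a k b where [simp]: "p = (j, a)" "q = (k, b)" by (metis surj_pair)
    show "lattice_subst w (fgl_plus F (Var p) (Var q) - Var (p + q)) \<in> fga_ideal F"
      using fgl_plus_fga_ideal [of F "(j, w a)" "(k, w b)"]
      by (simp add: continuous_hom_diff [OF hom] continuous_hom_fgl_plus [OF hom] lattice_subst_Var assms)
  qed
qed

lemma S_act_hom:
  assumes "\<And>a b. w (a + b) = w a + w b"
  shows "S_act F w \<in> ring_hom (fga F) (fga F)"
  using continuous_hom_lattice_subst S_act_class [OF assms] by (rule fga_hom_induced)

text \<open>Here \<open>l\<close> is an exponential of \<open>F\<close>, turning ordinary sums into
  formal sums, and \<open>l'\<close> is the corresponding logarithm.\<close>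

locale exponential_fgl =
  fixes F :: "(xy, 'r :: comm_ring_1) pseries" and l l' :: "'r fps"
  assumes inverses: "compositional_inverses l l'"
    and F_eq: "F = fps_at l (fps_at l' (Var X) + fps_at l' (Var Y))"
begin

lemma l_0 [simp]: "fps_nth l 0 = 0" "fps_nth l' 0 = 0"
  using inverses by (simp_all add: compositional_inverses_def)

lemma l_l' [simp]:
  assumes "no_const g"
  shows "fps_at l (fps_at l' g) = g" "fps_at l' (fps_at l g) = g"
  using assms inverses by (simp_all add: compositional_inverses_def fps_at_compose fps_at_X)

text \<open>The inverse series applied to \<open>l(g)\<close> returns \<open>g\<close>, so
  \<open>l(g)\<close> divides \<open>g\<close>. Together with \<open>dvd_fps_at\<close>, the two are
  associates.\<close>

lemma fps_at_dvd: "no_const g \<Longrightarrow> fps_at l g dvd g" "no_const g \<Longrightarrow> fps_at l' g dvd g"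
  using dvd_fps_at [of l' "fps_at l g"] dvd_fps_at [of l "fps_at l' g"] by simp_all

lemma fgl_plus_eq:
  assumes "no_const f" "no_const g"
  shows "fgl_plus F f g = fps_at l (fps_at l' f + fps_at l' g)"
proof -
  have nc: "no_const (case_xy f g v)" for v using assms by (cases v) simp_all
  note hom = continuous_hom_psubst [of "case_xy f g", OF nc]
  show ?thesis unfolding fgl_plus_def F_eq
    using assms nc
    by (simp add: continuous_hom_fps_at [OF hom] continuous_hom_add [OF hom] psubst_Var)
qed

section \<open>The two mutually inverse substitutions\<close>

abbreviation \<Phi> :: "('m, 'r) pseries \<Rightarrow> ('m, 'r) pseries" where "\<Phi> \<equiv> psubst (\<lambda>a. fps_at l (Var a))"
abbreviation \<Psi> :: "('m, 'r) pseries \<Rightarrow> ('m, 'r) pseries" where "\<Psi> \<equiv> psubst (\<lambda>a. fps_at l' (Var a))"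

lemma continuous_hom_\<Phi>: "continuous_hom \<Phi>" and continuous_hom_\<Psi>: "continuous_hom \<Psi>"
  by (simp_all add: continuous_hom_psubst)

lemma \<Phi>_Var: "\<Phi> (Var a) = fps_at l (Var a)" and \<Psi>_Var: "\<Psi> (Var a) = fps_at l' (Var a)"
  by (simp_all add: psubst_Var)

lemma \<Psi>_\<Phi>: "\<Psi> (\<Phi> f) = f" and \<Phi>_\<Psi>: "\<Phi> (\<Psi> f) = f"
proof -
  show "\<Psi> (\<Phi> f) = f"
    by (rule continuous_hom_eqI [where h = "\<lambda>f. \<Psi> (\<Phi> f)" and k = "\<lambda>f. f"])
      (simp_all add: continuous_hom_comp [OF continuous_hom_\<Psi> continuous_hom_\<Phi>] continuous_hom_id
        \<Phi>_Var \<Psi>_Var continuous_hom_fps_at [OF continuous_hom_\<Psi>])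
  show "\<Phi> (\<Psi> f) = f"
    by (rule continuous_hom_eqI [where h = "\<lambda>f. \<Phi> (\<Psi> f)" and k = "\<lambda>f. f"])
      (simp_all add: continuous_hom_comp [OF continuous_hom_\<Phi> continuous_hom_\<Psi>] continuous_hom_id
        \<Phi>_Var \<Psi>_Var continuous_hom_fps_at [OF continuous_hom_\<Phi>])
qed

lemma \<Phi>_fga_ideal:
  assumes "f \<in> fga_ideal F"
  shows "\<Phi> f \<in> fga_ideal additive_fgl"
proof (rule fga_ideal_mapsto [OF continuous_hom_\<Phi> _ _ assms])
  note I = ideal_fga_ideal [of additive_fgl]
  show "\<Phi> (Var 0) \<in> fga_ideal additive_fgl"
    by (intro ideal_type_ring_dvd [OF I Var_0_fga_ideal]) (simp add: \<Phi>_Var dvd_fps_at)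
  fix a b :: 'a
  have "Var a + Var b - Var (a + b) \<in> fga_ideal additive_fgl"
    using fgl_plus_fga_ideal [of additive_fgl a b] by (simp add: fgl_plus_additive)
  moreover have "\<Phi> (fgl_plus F (Var a) (Var b)) = fgl_plus F (\<Phi> (Var a)) (\<Phi> (Var b))"
    by (rule continuous_hom_fgl_plus [OF continuous_hom_\<Phi>]) (simp_all add: \<Phi>_Var)
  then have "\<Phi> (fgl_plus F (Var a) (Var b) - Var (a + b))
      = fps_at l (Var a + Var b) - fps_at l (Var (a + b))"
    by (simp add: continuous_hom_diff [OF continuous_hom_\<Phi>] \<Phi>_Var fgl_plus_eq)
  ultimately show "\<Phi> (fgl_plus F (Var a) (Var b) - Var (a + b)) \<in> fga_ideal additive_fgl"
    by (simp only:) (rule ideal_type_ring_dvd [OF I _ diff_dvd_fps_at_diff]; simp)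
qed

text \<open>The shape of \<open>F\<close> gives \<open>l'(x_a) + l'(x_b) = l'(x_a +_F x_b)\<close>.
  So an additive relation becomes a difference of two values of \<open>l'\<close>, and their
  arguments differ by a relation of \<open>F\<close>.\<close>

lemma \<Psi>_fga_ideal:
  assumes "f \<in> fga_ideal additive_fgl"
  shows "\<Psi> f \<in> fga_ideal F"
proof (rule fga_ideal_mapsto [OF continuous_hom_\<Psi> _ _ assms])
  note I = ideal_fga_ideal [of F]
  show "\<Psi> (Var 0) \<in> fga_ideal F"
    by (intro ideal_type_ring_dvd [OF I Var_0_fga_ideal]) (simp add: \<Psi>_Var dvd_fps_at)
  fix a b :: 'a
  let ?s = "fgl_plus F (Var a) (Var b)"
  have s: "?s = fps_at l (fps_at l' (Var a) + fps_at l' (Var b))" by (simp add: fgl_plus_eq)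
  then have "\<Psi> (fgl_plus additive_fgl (Var a) (Var b) - Var (a + b)) = fps_at l' ?s - fps_at l' (Var (a + b))"
    by (simp add: fgl_plus_additive continuous_hom_add [OF continuous_hom_\<Psi>]
        continuous_hom_diff [OF continuous_hom_\<Psi>] \<Psi>_Var)
  moreover have "?s - Var (a + b) dvd fps_at l' ?s - fps_at l' (Var (a + b))"
    by (rule diff_dvd_fps_at_diff) (simp_all add: s)
  ultimately show "\<Psi> (fgl_plus additive_fgl (Var a) (Var b) - Var (a + b)) \<in> fga_ideal F"
    using ideal_type_ring_dvd [OF I fgl_plus_fga_ideal] by simp
qed

text \<open>An explicit inverse of \<open>phi_S\<close>, so that bijectivity reduces to two
  identities of substitutions and also passes to the localizations.\<close>

definition psi_S :: "('m :: ab_group_add, 'r) pseries set \<Rightarrow> ('m, 'r) pseries set" where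
  "psi_S C = the_elem ((\<lambda>f. fga_class F (\<Psi> f)) ` C)"

lemma phi_S_class: "phi_S l (fga_class F f) = fga_class additive_fgl (\<Phi> f)"
  unfolding phi_S_def by (intro the_elem_fga_class continuous_hom_\<Phi> \<Phi>_fga_ideal)

lemma psi_S_class: "psi_S (fga_class additive_fgl f) = fga_class F (\<Psi> f)"
  unfolding psi_S_def by (intro the_elem_fga_class continuous_hom_\<Psi> \<Psi>_fga_ideal)

lemma phi_S_hom: "phi_S l \<in> ring_hom (fga F) (fga additive_fgl)"
  using continuous_hom_\<Phi> phi_S_class by (rule fga_hom_induced)

lemma psi_S_hom: "psi_S \<in> ring_hom (fga additive_fgl) (fga F)"
  using continuous_hom_\<Psi> psi_S_class by (rule fga_hom_induced)

lemma psi_S_phi_S: "C \<in> carrier (fga F) \<Longrightarrow> psi_S (phi_S l C) = C"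
  by (elim fga_cases) (simp add: phi_S_class psi_S_class \<Psi>_\<Phi>)

lemma phi_S_psi_S: "C \<in> carrier (fga additive_fgl) \<Longrightarrow> phi_S l (psi_S C) = C"
  by (elim fga_cases) (simp add: phi_S_class psi_S_class \<Phi>_\<Psi>)

lemma phi_S_iso: "phi_S l \<in> ring_iso (fga F) (fga additive_fgl)"
  using phi_S_hom psi_S_hom psi_S_phi_S phi_S_psi_S by (rule ring_iso_if_inverses)

lemma phi_S_xg: "phi_S l (xg F a) = fga_class additive_fgl (fps_at l (Var a))"
  by (simp add: xg_def phi_S_class \<Phi>_Var)

text \<open>The Weyl group permutes variables while \<open>l\<close> is applied to each variable
  separately: both composites send \<open>x_(k,a)\<close> to \<open>l(x_(k,w a))\<close>.\<close>

lemma phi_S_S_act: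
  fixes w :: "'l :: ab_group_add \<Rightarrow> 'l"
  assumes w: "\<And>a b. w (a + b) = w a + w b" and "C \<in> carrier (fga F)"
  shows "phi_S l (S_act F w C) = S_act additive_fgl w (phi_S l C)"
proof -
  obtain f where C: "C = fga_class F f" using assms(2) by (rule fga_cases)
  note hom = continuous_hom_lattice_subst [of w]
  have "\<Phi> (lattice_subst w f) = lattice_subst w (\<Phi> f)"
  proof (rule continuous_hom_eqI [where h = "\<lambda>f. \<Phi> (lattice_subst w f)" and k = "\<lambda>f. lattice_subst w (\<Phi> f)"])
    fix p :: "int \<times> 'l"
    obtain k a where "p = (k, a)" by fastforce
    then show "\<Phi> (lattice_subst w (Var p)) = lattice_subst w (\<Phi> (Var p))"
      by (simp add: lattice_subst_Var \<Phi>_Var continuous_hom_fps_at [OF hom])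
  qed (rule continuous_hom_comp [OF continuous_hom_\<Phi> hom] continuous_hom_comp [OF hom continuous_hom_\<Phi>])+
  then show ?thesis by (simp add: C S_act_class [OF w] phi_S_class)
qed

end

section \<open>The Weyl group\<close>

lemma zscale_add: "zscale (j + k) x = zscale j x + zscale k x"
proof -
  let ?f = "\<lambda>n. \<Sum>i<n. x"
  have f: "?f (m + n) = ?f m + ?f n" for m n :: nat
    by (induction n) (simp_all add: algebra_simps)
  \<comment> \<open>A balanced identity of natural numbers: moving the truncated negative parts
    across avoids distinguishing the signs of \<open>j\<close>, \<open>k\<close> and
    \<open>j + k\<close>.\<close>
  have "nat (j + k) + nat (- j) + nat (- k) = nat j + nat k + nat (- (j + k))" by simp
  then have "?f (nat (j + k)) + ?f (nat (- j)) + ?f (nat (- k)) = ?f (nat j) + ?f (nat k) + ?f (nat (- (j + k)))"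
    by (metis f)
  then show ?thesis unfolding zscale_def by (simp add: algebra_simps)
qed

lemma zscale_uminus: "zscale (- k) x = - zscale k x"
  by (simp add: zscale_def)

lemma additive_zscale:
  fixes f :: "'l :: ab_group_add \<Rightarrow> int"
  assumes f: "\<And>x y. f (x + y) = f x + f y"
  shows "f (zscale k x) = k * f x"
proof -
  have 0: "f 0 = 0" using f [of 0 0] by simp
  have neg: "f (- y) = - f y" for y using f [of y "- y"] 0 by simp
  have "f (\<Sum>i<n. x) = int n * f x" for n :: nat
    by (induction n) (simp_all add: 0 f algebra_simps)
  then have "f (zscale k x) = int (nat k) * f x - int (nat (- k)) * f x"
    unfolding zscale_def diff_conv_add_uminus f neg by simp
  then show ?thesis by (cases "k \<ge> 0") auto
qed

lemma reflection_add:
  assumes "\<And>x y. cor \<alpha> (x + y) = cor \<alpha> x + cor \<alpha> y"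
  shows "reflection cor \<alpha> (x + y) = reflection cor \<alpha> x + reflection cor \<alpha> y"
  by (simp add: reflection_def assms zscale_add)

text \<open>The reflection negates the value of \<open>cor \<alpha>\<close>, because
  \<open>cor \<alpha> \<alpha> = 2\<close>, so the second subtraction undoes the first.\<close>

lemma reflection_reflection:
  assumes "\<And>x y. cor \<alpha> (x + y) = cor \<alpha> x + cor \<alpha> y" "cor \<alpha> \<alpha> = 2"
  shows "reflection cor \<alpha> (reflection cor \<alpha> x) = x"
proof -
  have "cor \<alpha> (reflection cor \<alpha> x) + cor \<alpha> (zscale (cor \<alpha> x) \<alpha>) = cor \<alpha> x"
    by (simp add: reflection_def flip: assms(1))
  then have "cor \<alpha> (reflection cor \<alpha> x) = - cor \<alpha> x"
    by (simp add: additive_zscale [of "cor \<alpha>", OF assms(1)] assms(2))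
  then show ?thesis
    by (simp add: reflection_def [of cor \<alpha> "reflection cor \<alpha> x"] zscale_uminus) (simp add: reflection_def)
qed

lemma weyl_group_id: "id \<in> weyl_group \<Sigma> cor"
  using generate.one [of "BijGroup UNIV" "reflection cor ` \<Sigma>"]
  by (simp add: weyl_group_def BijGroup_def restrict_UNIV id_def)

lemma
  assumes rd: "root_datum \<Sigma> cor"
  shows weyl_group_comp: "v \<in> weyl_group \<Sigma> cor \<Longrightarrow> w \<in> weyl_group \<Sigma> cor \<Longrightarrow> v \<circ> w \<in> weyl_group \<Sigma> cor"
    and weyl_group_add: "w \<in> weyl_group \<Sigma> cor \<Longrightarrow> w (a + b) = w a + w b"
    and weyl_group_roots: "w \<in> weyl_group \<Sigma> cor \<Longrightarrow> \<beta> \<in> \<Sigma> \<Longrightarrow> w \<beta> \<in> \<Sigma>"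
proof -
  let ?G = "BijGroup (UNIV :: 'a set)"
  interpret G: group ?G by (rule group_BijGroup)
  have carrier: "carrier ?G = {f. bij f}"
    by (auto simp: BijGroup_def Bij_def)
  have mult: "f \<otimes>\<^bsub>?G\<^esub> g = f \<circ> g" if "bij f" "bij g" for f g
    using that by (auto simp: BijGroup_def Bij_def compose_def restrict_UNIV)
  have one_G: "\<one>\<^bsub>?G\<^esub> = id" by (auto simp: BijGroup_def restrict_UNIV)
  have cor: "cor \<alpha> (x + y) = cor \<alpha> x + cor \<alpha> y" "cor \<alpha> \<alpha> = 2" if "\<alpha> \<in> \<Sigma>" for \<alpha> x y
    using rd that by (auto simp: root_datum_def)
  have refl: "reflection cor \<alpha> \<circ> reflection cor \<alpha> = id" if "\<alpha> \<in> \<Sigma>" for \<alpha>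
    using reflection_reflection [of cor \<alpha>] cor [OF that] by fastforce
  then have bij: "bij (reflection cor \<alpha>)" if "\<alpha> \<in> \<Sigma>" for \<alpha>
    using that o_bij by blast
  then have sub: "reflection cor ` \<Sigma> \<subseteq> carrier ?G" by (auto simp: carrier)
  have W: "bij w" if "w \<in> weyl_group \<Sigma> cor" for w
    using G.generate_in_carrier [OF sub] that by (auto simp: weyl_group_def carrier)
  show "v \<circ> w \<in> weyl_group \<Sigma> cor" if "v \<in> weyl_group \<Sigma> cor" "w \<in> weyl_group \<Sigma> cor" for v w
    using mult [of v w] W that generate.eng [of v ?G "reflection cor ` \<Sigma>" w]
    by (simp add: weyl_group_def)
  have "w \<in> weyl_group \<Sigma> cor \<Longrightarrow> (\<forall>a b. w (a + b) = w a + w b) \<and> w ` \<Sigma> \<subseteq> \<Sigma>" for w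
    unfolding weyl_group_def
  proof (induction rule: generate.induct)
    case one
    then show ?case by (simp add: one_G)
  next
    case (incl h)
    then obtain \<alpha> where "\<alpha> \<in> \<Sigma>" "h = reflection cor \<alpha>" by blast
    then show ?case using rd cor reflection_add [of cor \<alpha>] by (auto simp: root_datum_def)
  next
    case (inv h)
    then obtain \<alpha> where \<alpha>: "\<alpha> \<in> \<Sigma>" "h = reflection cor \<alpha>" by blast
    \<comment> \<open>Reflections are involutions, so the inverse of a generator is that
      generator.\<close>
    then have "inv\<^bsub>?G\<^esub> h = h"
      using refl [of \<alpha>] bij [of \<alpha>] by (intro G.inv_equality) (auto simp: mult one_G carrier)
    then show ?case using \<alpha> rd cor reflection_add [of cor \<alpha>] by (auto simp: root_datum_def)
  next
    case (eng v w)
    then have "v \<otimes>\<^bsub>?G\<^esub> w = v \<circ> w" using W by (simp add: mult weyl_group_def)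
    then show ?case using eng by (auto simp: image_subset_iff)
  qed
  then show "w \<in> weyl_group \<Sigma> cor \<Longrightarrow> w (a + b) = w a + w b"
    and "w \<in> weyl_group \<Sigma> cor \<Longrightarrow> \<beta> \<in> \<Sigma> \<Longrightarrow> w \<beta> \<in> \<Sigma>" for w a b \<beta>
    by blast+
qed

section \<open>Twisted group algebras\<close>

text \<open>Write \<open>a / b - 1 = (a - b) / b\<close>, and likewise for \<open>A\<close> and
  \<open>B\<close>. Then \<open>V\<close> changes the numerator, and \<open>1 / B = U / b\<close>
  changes the denominator.\<close>

lemma (in cring) diff_quotient_rescale:
  assumes carr: "a \<in> carrier R" "A \<in> carrier R" "V \<in> carrier R" "U \<in> carrier R"
    and units: "b \<in> Units R" "B \<in> Units R"
    and V: "A \<ominus> B = V \<otimes> (a \<ominus> b)" and U: "b = U \<otimes> B"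
  shows "(V \<otimes> U) \<otimes> (a \<otimes> inv b \<ominus> \<one>) = A \<otimes> inv B \<ominus> \<one>"
proof -
  have [simp]: "b \<in> carrier R" "B \<in> carrier R" using units by auto
  have quot: "x \<otimes> inv s \<ominus> \<one> = (x \<ominus> s) \<otimes> inv s" if "x \<in> carrier R" "s \<in> Units R" for x s
    using that by (simp add: a_minus_def l_distr l_minus Units_closed)
  have "inv B = U \<otimes> inv b"
    using inv_mult_swap [of B b \<one> U] units carr U by simp
  then have "A \<otimes> inv B \<ominus> \<one> = V \<otimes> (a \<ominus> b) \<otimes> (U \<otimes> inv b)"
    using quot [of A B] carr units V by simp
  moreover have "(V \<otimes> U) \<otimes> (a \<otimes> inv b \<ominus> \<one>) = V \<otimes> (a \<ominus> b) \<otimes> (U \<otimes> inv b)"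
    using carr units by (simp add: quot m_ac)
  ultimately show ?thesis by simp
qed

text \<open>With \<open>e\<close> and \<open>d\<close> the coefficients of 1 and of the reflection
  at one group element, this is \<open>T = 1 + (q - 1)(1 - \<delta>)\<close> read off
  coefficientwise.\<close>

lemma (in cring) interpolate_eq:
  assumes "q \<in> carrier R" "e \<in> carrier R" "d \<in> carrier R"
  shows "q \<otimes> (e \<ominus> d) \<oplus> d = e \<oplus> (q \<ominus> \<one>) \<otimes> (e \<ominus> d)"
  using assms by (simp add: a_minus_def l_distr l_minus minus_add a_ac r_neg1 r_neg2)

text \<open>Formulated for any law, so that one copy serves \<open>F\<close> and another the
  additive law, over the same root datum.\<close>

locale twisted_group_algebra =
  fixes \<Sigma> :: "'l :: ab_group_add set" and cor :: "'l \<Rightarrow> 'l \<Rightarrow> int" and F :: "(xy, 'r :: comm_ring_1) pseries"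
  assumes root_datum: "root_datum \<Sigma> cor"
begin

abbreviation S :: "('l, 'r) selem ring" where "S \<equiv> fga F"
abbreviation Q :: "('l, 'r) qelem ring" where "Q \<equiv> Q_ring \<Sigma> F"
abbreviation QW :: "('l, 'r) qwelem ring" where "QW \<equiv> QW_ring \<Sigma> cor F"
abbreviation W :: "('l \<Rightarrow> 'l) set" where "W \<equiv> weyl_group \<Sigma> cor"

sublocale S: cring S by (rule cring_fga)

section \<open>The localized coefficient ring and the Weyl action\<close>

lemma x_closed [simp]: "x_gamma F \<in> carrier S" "x_lat F \<beta> \<in> carrier S"
  by (simp_all add: x_gamma_def x_lat_def xg_def)

sublocale D: cring_denominators S "x_denoms \<Sigma> F"
  unfolding x_denoms_def by (rule mult_closure_closed [OF cring_fga]) auto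

sublocale Q: cring Q
  unfolding Q_ring_def by (rule D.cring_Loc)

lemma q_of_hom: "q_of \<Sigma> F \<in> ring_hom S Q"
  using D.loc_of_hom unfolding q_frac_def Q_ring_def .

lemma q_of_closed [simp]: "a \<in> carrier S \<Longrightarrow> q_of \<Sigma> F a \<in> carrier Q"
  using ring_hom_closed [OF q_of_hom] .

lemma x_lat_denoms:
  assumes "\<beta> \<in> \<Sigma>"
  shows "x_lat F \<beta> \<in> x_denoms \<Sigma> F"
proof -
  have "x_lat F \<beta> \<otimes>\<^bsub>S\<^esub> \<one>\<^bsub>S\<^esub> \<in> mult_closure S (x_lat F ` \<Sigma>)"
    by (intro mult_closure.mult mult_closure.one imageI assms)
  then show ?thesis by (simp add: x_denoms_def)
qed

lemma q_of_x_lat_Units: "\<beta> \<in> \<Sigma> \<Longrightarrow> q_of \<Sigma> F (x_lat F \<beta>) \<in> Units Q"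
  using D.loc_of_Units x_lat_denoms unfolding q_frac_def Q_ring_def by blast

lemma q_frac_x_lat:
  "a \<in> carrier S \<Longrightarrow> \<beta> \<in> \<Sigma> \<Longrightarrow>
    q_frac \<Sigma> F a (x_lat F \<beta>) = q_of \<Sigma> F a \<otimes>\<^bsub>Q\<^esub> inv\<^bsub>Q\<^esub> q_of \<Sigma> F (x_lat F \<beta>)"
  using D.frac_eq_mult_inv x_lat_denoms unfolding q_frac_def Q_ring_def by blast

lemma Q_hom_eqI:
  assumes "cring B" "h \<in> ring_hom Q B" "k \<in> ring_hom Q B"
    and "\<And>a. a \<in> carrier S \<Longrightarrow> h (q_of \<Sigma> F a) = k (q_of \<Sigma> F a)" and "p \<in> carrier Q"
  shows "h p = k p"
  using assms unfolding q_frac_def Q_ring_def by (rule D.loc_hom_eqI)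

lemma
  assumes B: "cring B" and g: "g \<in> ring_hom S B" and units: "\<And>\<beta>. \<beta> \<in> \<Sigma> \<Longrightarrow> g (x_lat F \<beta>) \<in> Units B"
  shows Q_extend_hom: "loc_extend B g \<in> ring_hom Q B"
    and Q_extend_of: "a \<in> carrier S \<Longrightarrow> loc_extend B g (q_of \<Sigma> F a) = g a"
proof -
  have "g ` x_denoms \<Sigma> F \<subseteq> Units B"
    unfolding x_denoms_def
  proof clarify
    fix s assume "s \<in> mult_closure S (x_lat F ` \<Sigma>)"
    then show "g s \<in> Units B"
      by (rule mult_closure_image [OF g cring_fga _ B, rotated -1]) (use units in auto)
  qed
  note * = D.loc_extend_hom [OF B g this] D.loc_extend_of [OF B g this]
  show "loc_extend B g \<in> ring_hom Q B"
    and "a \<in> carrier S \<Longrightarrow> loc_extend B g (q_of \<Sigma> F a) = g a"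
    using * unfolding q_frac_def Q_ring_def by blast+
qed

lemma W_comp [simp]: "v \<in> W \<Longrightarrow> w \<in> W \<Longrightarrow> v \<circ> w \<in> W"
  and W_id [simp]: "id \<in> W"
  and W_add: "w \<in> W \<Longrightarrow> w (a + b) = w a + w b"
  and W_roots: "w \<in> W \<Longrightarrow> \<beta> \<in> \<Sigma> \<Longrightarrow> w \<beta> \<in> \<Sigma>"
  using weyl_group_comp weyl_group_id weyl_group_add weyl_group_roots root_datum
  by blast+

text \<open>Elements of the Weyl group permute the roots, so \<open>x_\<beta>\<close> goes to some
  \<open>x_(w \<beta>)\<close> that is inverted too; hence the action extends to fractions.\<close>

lemma
  assumes w: "w \<in> W"
  shows Q_act_hom: "Q_act \<Sigma> F w \<in> ring_hom Q Q"
    and Q_act_of: "a \<in> carrier S \<Longrightarrow> Q_act \<Sigma> F w (q_of \<Sigma> F a) = q_of \<Sigma> F (S_act F w a)"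
proof -
  have g: "q_of \<Sigma> F \<circ> S_act F w \<in> ring_hom S Q"
    by (rule ring_hom_trans [OF S_act_hom q_of_hom]) (rule W_add [OF w])
  have units: "(q_of \<Sigma> F \<circ> S_act F w) (x_lat F \<beta>) \<in> Units Q" if "\<beta> \<in> \<Sigma>" for \<beta>
    using q_of_x_lat_Units [OF W_roots [OF w that]]
    by (simp add: x_lat_def xg_def S_act_class [OF W_add [OF w]] lattice_subst_Var)
  show "Q_act \<Sigma> F w \<in> ring_hom Q Q"
    unfolding Q_act_def by (rule Q_extend_hom [OF Q.is_cring g]) (rule units)
  show "Q_act \<Sigma> F w (q_of \<Sigma> F a) = q_of \<Sigma> F (S_act F w a)" if "a \<in> carrier S"
    unfolding Q_act_def by (subst Q_extend_of [OF Q.is_cring g _ that]) (rule units, assumption, simp)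
qed

lemma Q_act_id:
  assumes "p \<in> carrier Q"
  shows "Q_act \<Sigma> F id p = p"
proof (rule Q_hom_eqI [where k = "\<lambda>p. p", OF Q.is_cring Q_act_hom [OF W_id] _ _ assms])
  show "(\<lambda>p. p) \<in> ring_hom Q Q" by (rule ring_hom_memI) simp_all
  fix a assume a: "a \<in> carrier S"
  then obtain f where f: "a = fga_class F f" by (rule fga_cases)
  have "lattice_subst id f = f"
    by (rule continuous_hom_eqI [OF continuous_hom_lattice_subst continuous_hom_id])
      (metis lattice_subst_Var id_apply surj_pair)
  then show "Q_act \<Sigma> F id (q_of \<Sigma> F a) = q_of \<Sigma> F a"
    using a f by (simp add: Q_act_of S_act_class)
qed

section \<open>Elements as families of coefficients\<close>

lemma carrier_QW: "carrier QW = {f \<in> W \<rightarrow>\<^sub>E carrier Q. finite {w \<in> W. f w \<noteq> \<zero>\<^bsub>Q\<^esub>}}"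
  and QW_mult: "f \<otimes>\<^bsub>QW\<^esub> g = (\<lambda>v\<in>W. finsum Q (\<lambda>(w, w'). f w \<otimes>\<^bsub>Q\<^esub> Q_act \<Sigma> F w (g w'))
           {(w, w') \<in> W \<times> W. w \<circ> w' = v \<and> f w \<noteq> \<zero>\<^bsub>Q\<^esub> \<and> g w' \<noteq> \<zero>\<^bsub>Q\<^esub>})"
  and QW_one: "\<one>\<^bsub>QW\<^esub> = (\<lambda>v\<in>W. if v = id then \<one>\<^bsub>Q\<^esub> else \<zero>\<^bsub>Q\<^esub>)"
  and QW_zero: "\<zero>\<^bsub>QW\<^esub> = (\<lambda>v\<in>W. \<zero>\<^bsub>Q\<^esub>)"
  and QW_add: "f \<oplus>\<^bsub>QW\<^esub> g = (\<lambda>v\<in>W. f v \<oplus>\<^bsub>Q\<^esub> g v)"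
  by (simp_all add: QW_ring_def Let_def)

lemma QW_closed [simp]: "f \<in> carrier QW \<Longrightarrow> v \<in> W \<Longrightarrow> f v \<in> carrier Q"
  by (auto simp: carrier_QW)

lemma QW_eqI: "f \<in> carrier QW \<Longrightarrow> g \<in> carrier QW \<Longrightarrow> (\<And>v. v \<in> W \<Longrightarrow> f v = g v) \<Longrightarrow> f = g"
  unfolding carrier_QW by (auto intro: PiE_ext)

lemma QW_carrierI:
  assumes "\<And>v. v \<in> W \<Longrightarrow> f v \<in> carrier Q" "finite A" "\<And>v. v \<in> W \<Longrightarrow> f v \<noteq> \<zero>\<^bsub>Q\<^esub> \<Longrightarrow> v \<in> A"
  shows "(\<lambda>v\<in>W. f v) \<in> carrier QW"
proof -
  have "{w \<in> W. restrict f W w \<noteq> \<zero>\<^bsub>Q\<^esub>} \<subseteq> A" using assms(3) by auto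
  then have "finite {w \<in> W. restrict f W w \<noteq> \<zero>\<^bsub>Q\<^esub>}" using assms(2) by (rule finite_subset)
  then show ?thesis using assms(1) unfolding carrier_QW by simp
qed

abbreviation supp :: "('l, 'r) qwelem \<Rightarrow> ('l \<Rightarrow> 'l) set" where
  "supp f \<equiv> {w \<in> W. f w \<noteq> \<zero>\<^bsub>Q\<^esub>}"

lemma finite_supp: "f \<in> carrier QW \<Longrightarrow> finite (supp f)"
  by (simp add: carrier_QW)

lemma QW_add_closed: "f \<in> carrier QW \<Longrightarrow> g \<in> carrier QW \<Longrightarrow> f \<oplus>\<^bsub>QW\<^esub> g \<in> carrier QW"
  unfolding QW_add by (rule QW_carrierI [where A = "supp f \<union> supp g"]) (auto simp: finite_supp)

lemma QW_uminus_closed: "f \<in> carrier QW \<Longrightarrow> (\<lambda>v\<in>W. \<ominus>\<^bsub>Q\<^esub> f v) \<in> carrier QW"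
  by (rule QW_carrierI [where A = "supp f"]) (auto simp: finite_supp)

lemma QW_zero_closed: "\<zero>\<^bsub>QW\<^esub> \<in> carrier QW"
  unfolding QW_zero by (rule QW_carrierI [where A = "{}"]) auto

lemma QW_one_closed [simp]: "\<one>\<^bsub>QW\<^esub> \<in> carrier QW"
  unfolding QW_one by (rule QW_carrierI [where A = "{id}"]) (auto split: if_splits)

text \<open>A nonzero coefficient at \<open>v\<close> forces a nonempty index set, so
  \<open>v\<close> is a product of members of the two finite supports.\<close>

lemma QW_mult_closed [simp]:
  assumes f: "f \<in> carrier QW" and g: "g \<in> carrier QW"
  shows "f \<otimes>\<^bsub>QW\<^esub> g \<in> carrier QW"
  unfolding QW_mult
proof (rule QW_carrierI [where A = "(\<lambda>(w, w'). w \<circ> w') ` (supp f \<times> supp g)"])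
  let ?t = "\<lambda>(w, w'). f w \<otimes>\<^bsub>Q\<^esub> Q_act \<Sigma> F w (g w')"
  let ?A = "\<lambda>v. {(w, w') \<in> W \<times> W. w \<circ> w' = v \<and> f w \<noteq> \<zero>\<^bsub>Q\<^esub> \<and> g w' \<noteq> \<zero>\<^bsub>Q\<^esub>}"
  show "finsum Q ?t (?A v) \<in> carrier Q" for v
    using f g by (intro Q.finsum_closed) (auto intro!: Q.m_closed ring_hom_closed [OF Q_act_hom])
  show "v \<in> (\<lambda>(w, w'). w \<circ> w') ` (supp f \<times> supp g)" if "finsum Q ?t (?A v) \<noteq> \<zero>\<^bsub>Q\<^esub>" for v
  proof -
    have "?A v \<noteq> {}" using that Q.finsum_empty by metis
    then show ?thesis by auto
  qed
qed (use f g finite_supp in auto)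

sublocale QW: abelian_group QW
proof (rule abelian_groupI)
  fix f assume f: "f \<in> carrier QW"
  show "\<exists>g\<in>carrier QW. g \<oplus>\<^bsub>QW\<^esub> f = \<zero>\<^bsub>QW\<^esub>"
    using f by (intro bexI [OF _ QW_uminus_closed]) (auto simp: QW_add QW_zero Q.l_neg intro!: restrict_ext)
  show "\<zero>\<^bsub>QW\<^esub> \<oplus>\<^bsub>QW\<^esub> f = f"
    using f by (intro QW_eqI QW_add_closed QW_zero_closed) (auto simp: QW_add QW_zero)
qed (auto simp: QW_add_closed QW_zero_closed, auto simp: QW_add Q.a_ac intro!: restrict_ext)

lemma QW_uminus: "f \<in> carrier QW \<Longrightarrow> \<ominus>\<^bsub>QW\<^esub> f = (\<lambda>v\<in>W. \<ominus>\<^bsub>Q\<^esub> f v)"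
  by (rule QW.minus_equality)
    (auto simp: QW_uminus_closed, auto simp: QW_add QW_zero Q.l_neg intro!: restrict_ext)

lemma QW_add_apply [simp]: "v \<in> W \<Longrightarrow> (f \<oplus>\<^bsub>QW\<^esub> g) v = f v \<oplus>\<^bsub>Q\<^esub> g v"
  and QW_uminus_apply [simp]: "f \<in> carrier QW \<Longrightarrow> v \<in> W \<Longrightarrow> (\<ominus>\<^bsub>QW\<^esub> f) v = \<ominus>\<^bsub>Q\<^esub> f v"
  and QW_minus_apply [simp]: "g \<in> carrier QW \<Longrightarrow> v \<in> W \<Longrightarrow> (f \<ominus>\<^bsub>QW\<^esub> g) v = f v \<ominus>\<^bsub>Q\<^esub> g v"
  and QW_one_apply: "v \<in> W \<Longrightarrow> \<one>\<^bsub>QW\<^esub> v = (if v = id then \<one>\<^bsub>Q\<^esub> else \<zero>\<^bsub>Q\<^esub>)"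
  by (simp_all add: QW_add QW_uminus QW_one a_minus_def)

lemma qw_closed [simp]: "u \<in> carrier Q \<Longrightarrow> qw \<Sigma> cor F u w \<in> carrier QW"
  unfolding qw_def by (rule QW_carrierI [where A = "{w}"]) (auto split: if_splits)

lemma qw_apply: "v \<in> W \<Longrightarrow> qw \<Sigma> cor F u w v = (if v = w then u else \<zero>\<^bsub>Q\<^esub>)"
  by (simp add: qw_def)

lemma delta_closed [simp]: "delta \<Sigma> cor F w \<in> carrier QW"
  by (simp add: delta_def)

lemma delta_apply: "v \<in> W \<Longrightarrow> delta \<Sigma> cor F w v = (if v = w then \<one>\<^bsub>Q\<^esub> else \<zero>\<^bsub>Q\<^esub>)"
  by (simp add: delta_def qw_apply)

text \<open>A left factor supported at the identity leaves only the pair \<open>(id, v)\<close>, on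
  which the twist is trivial. The defining sum omits zero coefficients, so a vanishing
  \<open>p\<close> or \<open>f v\<close> leaves an empty sum, to be treated apart.\<close>

lemma qw_id_mult_apply [simp]:
  assumes p: "p \<in> carrier Q" and f: "f \<in> carrier QW" and v: "v \<in> W"
  shows "(qw \<Sigma> cor F p id \<otimes>\<^bsub>QW\<^esub> f) v = p \<otimes>\<^bsub>Q\<^esub> f v"
proof -
  let ?A = "{(w, w') \<in> W \<times> W. w \<circ> w' = v \<and> qw \<Sigma> cor F p id w \<noteq> \<zero>\<^bsub>Q\<^esub> \<and> f w' \<noteq> \<zero>\<^bsub>Q\<^esub>}"
  have "(w, w') \<in> ?A \<longleftrightarrow> p \<noteq> \<zero>\<^bsub>Q\<^esub> \<and> f v \<noteq> \<zero>\<^bsub>Q\<^esub> \<and> w = id \<and> w' = v" for w w'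
    using v by (cases "w = id") (auto simp: qw_apply)
  then have A: "?A = (if p \<noteq> \<zero>\<^bsub>Q\<^esub> \<and> f v \<noteq> \<zero>\<^bsub>Q\<^esub> then {(id, v)} else {})"
    by (simp add: set_eq_iff split_paired_all)
  have "finsum Q (\<lambda>(w, w'). qw \<Sigma> cor F p id w \<otimes>\<^bsub>Q\<^esub> Q_act \<Sigma> F w (f w')) ?A = p \<otimes>\<^bsub>Q\<^esub> f v"
  proof (cases "p \<noteq> \<zero>\<^bsub>Q\<^esub> \<and> f v \<noteq> \<zero>\<^bsub>Q\<^esub>")
    case True
    then show ?thesis
      unfolding A using p f v
      by (simp add: Q.finsum_insert [where F = "{}"] qw_apply Q_act_id)
  next
    case False
    then have "p \<otimes>\<^bsub>Q\<^esub> f v = \<zero>\<^bsub>Q\<^esub>" using p f v by (metis QW_closed Q.l_null Q.r_null)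
    then show ?thesis unfolding A using False by (simp only: if_False Q.finsum_empty)
  qed
  then show ?thesis using v by (simp add: QW_mult)
qed

text \<open>The element of which \<open>T_elt\<close> is the case \<open>p = x\<^sub>\<gamma> / x\<^sub>\<alpha>\<close>.\<close>

definition demazure :: "('l, 'r) qelem \<Rightarrow> ('l \<Rightarrow> 'l) \<Rightarrow> ('l, 'r) qwelem" where
  "demazure p r = qw \<Sigma> cor F p id \<otimes>\<^bsub>QW\<^esub> (\<one>\<^bsub>QW\<^esub> \<ominus>\<^bsub>QW\<^esub> delta \<Sigma> cor F r) \<oplus>\<^bsub>QW\<^esub> delta \<Sigma> cor F r"

lemma demazure_closed [simp]: "p \<in> carrier Q \<Longrightarrow> demazure p r \<in> carrier QW"
  by (simp add: demazure_def)

lemma demazure_apply: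
  assumes "p \<in> carrier Q" "v \<in> W"
  shows "demazure p r v = p \<otimes>\<^bsub>Q\<^esub> (\<one>\<^bsub>QW\<^esub> v \<ominus>\<^bsub>Q\<^esub> delta \<Sigma> cor F r v) \<oplus>\<^bsub>Q\<^esub> delta \<Sigma> cor F r v"
  using assms by (simp add: demazure_def)

lemma T_elt_eq_demazure:
  "\<beta> \<in> \<Sigma> \<Longrightarrow> T_elt \<Sigma> cor F \<beta>
    = demazure (q_of \<Sigma> F (x_gamma F) \<otimes>\<^bsub>Q\<^esub> inv\<^bsub>Q\<^esub> q_of \<Sigma> F (x_lat F \<beta>)) (reflection cor \<beta>)"
  by (simp add: T_elt_def demazure_def q_frac_x_lat)

text \<open>The element \<open>demazure p r - 1\<close> is \<open>(p - 1) (1 - \<delta>\<^sub>r)\<close>, hence linear in \<open>p - 1\<close>.\<close>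

lemma demazure_rescale:
  assumes [simp]: "p \<in> carrier Q" "p' \<in> carrier Q" "c \<in> carrier Q"
    and c: "c \<otimes>\<^bsub>Q\<^esub> (p \<ominus>\<^bsub>Q\<^esub> \<one>\<^bsub>Q\<^esub>) = p' \<ominus>\<^bsub>Q\<^esub> \<one>\<^bsub>Q\<^esub>"
  shows "demazure p' r = \<one>\<^bsub>QW\<^esub> \<oplus>\<^bsub>QW\<^esub> qw \<Sigma> cor F c id \<otimes>\<^bsub>QW\<^esub> (demazure p r \<oplus>\<^bsub>QW\<^esub> \<ominus>\<^bsub>QW\<^esub> \<one>\<^bsub>QW\<^esub>)"
proof (rule QW_eqI)
  fix v assume [simp]: "v \<in> W"
  define e d where ed: "e = \<one>\<^bsub>QW\<^esub> v" "d = delta \<Sigma> cor F r v"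
  then have [simp]: "e \<in> carrier Q" "d \<in> carrier Q" by simp_all
  note * = Q.interpolate_eq [of _ e d]
  have "demazure p' r v = e \<oplus>\<^bsub>Q\<^esub> c \<otimes>\<^bsub>Q\<^esub> ((p \<ominus>\<^bsub>Q\<^esub> \<one>\<^bsub>Q\<^esub>) \<otimes>\<^bsub>Q\<^esub> (e \<ominus>\<^bsub>Q\<^esub> d))"
    by (simp add: demazure_apply * flip: ed c Q.m_assoc)
  also have "(p \<ominus>\<^bsub>Q\<^esub> \<one>\<^bsub>Q\<^esub>) \<otimes>\<^bsub>Q\<^esub> (e \<ominus>\<^bsub>Q\<^esub> d) = demazure p r v \<oplus>\<^bsub>Q\<^esub> \<ominus>\<^bsub>Q\<^esub> e"
  proof -
    have "demazure p r v = e \<oplus>\<^bsub>Q\<^esub> (p \<ominus>\<^bsub>Q\<^esub> \<one>\<^bsub>Q\<^esub>) \<otimes>\<^bsub>Q\<^esub> (e \<ominus>\<^bsub>Q\<^esub> d)"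
      by (simp add: demazure_apply * flip: ed)
    then show ?thesis by (simp add: Q.a_comm [of _ "\<ominus>\<^bsub>Q\<^esub> e"] Q.r_neg1)
  qed
  finally show "demazure p' r v
      = (\<one>\<^bsub>QW\<^esub> \<oplus>\<^bsub>QW\<^esub> qw \<Sigma> cor F c id \<otimes>\<^bsub>QW\<^esub> (demazure p r \<oplus>\<^bsub>QW\<^esub> \<ominus>\<^bsub>QW\<^esub> \<one>\<^bsub>QW\<^esub>)) v"
    by (simp flip: ed)
qed simp_all

text \<open>The coefficient at the reflection is \<open>1 - a / b = (b - a) / b\<close>; this turns
  the defining expression of \<open>T\<close> into the two-term formula.\<close>

lemma demazure_quotient:
  assumes [simp]: "a \<in> carrier Q" "b \<in> Units Q"
  shows "demazure (a \<otimes>\<^bsub>Q\<^esub> inv\<^bsub>Q\<^esub> b) r = qw \<Sigma> cor F (a \<otimes>\<^bsub>Q\<^esub> inv\<^bsub>Q\<^esub> b) id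
    \<oplus>\<^bsub>QW\<^esub> qw \<Sigma> cor F ((b \<ominus>\<^bsub>Q\<^esub> a) \<otimes>\<^bsub>Q\<^esub> inv\<^bsub>Q\<^esub> b) r"
proof (rule QW_eqI)
  have [simp]: "b \<in> carrier Q" by (simp add: Q.Units_closed)
  show "demazure (a \<otimes>\<^bsub>Q\<^esub> inv\<^bsub>Q\<^esub> b) r \<in> carrier QW" by simp
  show "qw \<Sigma> cor F (a \<otimes>\<^bsub>Q\<^esub> inv\<^bsub>Q\<^esub> b) id \<oplus>\<^bsub>QW\<^esub> qw \<Sigma> cor F ((b \<ominus>\<^bsub>Q\<^esub> a) \<otimes>\<^bsub>Q\<^esub> inv\<^bsub>Q\<^esub> b) r \<in> carrier QW"
    by simp
  fix v assume [simp]: "v \<in> W"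
  have "(b \<ominus>\<^bsub>Q\<^esub> a) \<otimes>\<^bsub>Q\<^esub> inv\<^bsub>Q\<^esub> b = \<one>\<^bsub>Q\<^esub> \<ominus>\<^bsub>Q\<^esub> a \<otimes>\<^bsub>Q\<^esub> inv\<^bsub>Q\<^esub> b"
    by (simp add: a_minus_def Q.l_distr Q.l_minus)
  then show "demazure (a \<otimes>\<^bsub>Q\<^esub> inv\<^bsub>Q\<^esub> b) r v = (qw \<Sigma> cor F (a \<otimes>\<^bsub>Q\<^esub> inv\<^bsub>Q\<^esub> b) id
    \<oplus>\<^bsub>QW\<^esub> qw \<Sigma> cor F ((b \<ominus>\<^bsub>Q\<^esub> a) \<otimes>\<^bsub>Q\<^esub> inv\<^bsub>Q\<^esub> b) r) v"
    by (simp add: demazure_apply qw_apply delta_apply QW_one_apply a_minus_def Q.r_minus Q.r_neg Q.a_ac)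
qed

lemma QW_of_S_closed [simp]: "a \<in> carrier S \<Longrightarrow> QW_of_S \<Sigma> cor F a \<in> carrier QW"
  by (simp add: QW_of_S_def)

lemma q_of_dvd_Units:
  assumes "f dvd g" "q_of \<Sigma> F (fga_class F g) \<in> Units Q"
  shows "q_of \<Sigma> F (fga_class F f) \<in> Units Q"
proof -
  obtain k where "g = f * k" using assms(1) by (rule dvdE)
  then have "q_of \<Sigma> F (fga_class F g) = q_of \<Sigma> F (fga_class F f) \<otimes>\<^bsub>Q\<^esub> q_of \<Sigma> F (fga_class F k)"
    by (simp add: fga_class_mult ring_hom_mult [OF q_of_hom])
  with assms(2) show ?thesis
    by (metis Q.Units_factor(1) fga_class_closed q_of_closed)
qed

lemma q_of_class_diff:
  "q_of \<Sigma> F (fga_class F (f - g)) = q_of \<Sigma> F (fga_class F f) \<ominus>\<^bsub>Q\<^esub> q_of \<Sigma> F (fga_class F g)"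
proof -
  have "q_of \<Sigma> F (fga_class F f) = q_of \<Sigma> F (fga_class F (f - g)) \<oplus>\<^bsub>Q\<^esub> q_of \<Sigma> F (fga_class F g)"
    by (simp flip: fga_class_add ring_hom_add [OF q_of_hom])
  then show ?thesis by (simp add: a_minus_def Q.a_assoc Q.r_neg)
qed

end


section \<open>Generated subrings\<close>

lemma generate_ring_subset:
  assumes "H \<subseteq> generate_ring A K"
  shows "generate_ring A H \<subseteq> generate_ring A K"
proof
  fix x assume "x \<in> generate_ring A H"
  then show "x \<in> generate_ring A K"
    by induction (use assms in \<open>auto intro: generate_ring.intros\<close>)
qed

lemma ring_hom_a_inv:
  assumes "abelian_group A" "abelian_group B" "h \<in> ring_hom A B" "x \<in> carrier A"
  shows "h (\<ominus>\<^bsub>A\<^esub> x) = \<ominus>\<^bsub>B\<^esub> h x"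
proof -
  interpret A: abelian_group A by fact
  interpret B: abelian_group B by fact
  interpret group_hom "add_monoid A" "add_monoid B" h
    using assms(3) A.a_group B.a_group
    by (auto simp: group_hom_def group_hom_axioms_def hom_def ring_hom_def)
  show ?thesis using hom_inv [of x] assms(4) by (simp add: a_inv_def)
qed

text \<open>Each closure rule has a counterpart on the other side that the homomorphism matches; the
  hypotheses on the unit and on products keep every element so generated inside the carrier.\<close>

lemma generate_ring_image:
  assumes A: "abelian_group A" and B: "abelian_group B" and h: "h \<in> ring_hom A B"
    and one: "\<one>\<^bsub>A\<^esub> \<in> carrier A"
    and mult: "\<And>x y. x \<in> carrier A \<Longrightarrow> y \<in> carrier A \<Longrightarrow> x \<otimes>\<^bsub>A\<^esub> y \<in> carrier A"
    and H: "H \<subseteq> carrier A"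
  shows "generate_ring A H \<subseteq> carrier A" "h ` generate_ring A H = generate_ring B (h ` H)"
proof -
  interpret A: abelian_group A by fact
  note hom = ring_hom_one [OF h] ring_hom_add [OF h] ring_hom_mult [OF h] ring_hom_a_inv [OF A B h]
  have *: "x \<in> carrier A \<and> h x \<in> generate_ring B (h ` H)" if "x \<in> generate_ring A H" for x
    using that by induction (use one mult H in \<open>auto simp: hom intro: generate_ring.intros\<close>)
  then show carrier: "generate_ring A H \<subseteq> carrier A" by blast
  show "h ` generate_ring A H = generate_ring B (h ` H)"
  proof
    show "h ` generate_ring A H \<subseteq> generate_ring B (h ` H)" using * by blast
    show "generate_ring B (h ` H) \<subseteq> h ` generate_ring A H"
    proof
      fix y assume "y \<in> generate_ring B (h ` H)"
      then show "y \<in> h ` generate_ring A H"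
      proof induction
        case one
        show ?case by (rule image_eqI [where x = "\<one>\<^bsub>A\<^esub>"]) (simp_all add: hom generate_ring.one)
      next
        case (incl y)
        then show ?case by (auto intro: generate_ring.incl)
      next
        case (a_inv y)
        then obtain x where "x \<in> generate_ring A H" "y = h x" by blast
        then show ?case
          by (intro image_eqI [OF _ generate_ring.a_inv]) (simp_all add: hom subsetD [OF carrier])
      next
        case (eng_add y y')
        then obtain x x' where "x \<in> generate_ring A H" "y = h x" "x' \<in> generate_ring A H" "y' = h x'"
          by blast
        then show ?case
          by (intro image_eqI [OF _ generate_ring.eng_add [of x _ _ x']]) (simp_all add: hom subsetD [OF carrier])
      next
        case (eng_mult y y')
        then obtain x x' where "x \<in> generate_ring A H" "y = h x" "x' \<in> generate_ring A H" "y' = h x'"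
          by blast
        then show ?case
          by (intro image_eqI [OF _ generate_ring.eng_mult [of x _ _ x']]) (simp_all add: hom subsetD [OF carrier])
      qed
    qed
  qed
qed

section \<open>The isomorphism\<close>

locale exponential_twisted =
  exponential_fgl F l l' + F: twisted_group_algebra \<Sigma> cor F + G: twisted_group_algebra \<Sigma> cor "additive_fgl :: (xy, 'r) pseries"
  for F :: "(xy, 'r :: comm_ring_1) pseries" and l l' :: "'r fps"
    and \<Sigma> :: "'l :: ab_group_add set" and cor :: "'l \<Rightarrow> 'l \<Rightarrow> int"
begin

section \<open>Comparison of the localizations\<close>

text \<open>\<open>l(x_\<beta>)\<close> divides the inverted element \<open>x_\<beta>\<close>, and a
  divisor of a unit is a unit.\<close>

lemma l_x_Units:
  assumes "\<beta> \<in> \<Sigma>"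
  shows "l_x \<Sigma> l (0, \<beta>) \<in> Units G.Q"
  unfolding l_x_def
proof (rule G.q_of_dvd_Units [OF fps_at_dvd(1)])
  show "q_of \<Sigma> additive_fgl (fga_class additive_fgl (Var (0, \<beta>))) \<in> Units G.Q"
    using G.q_of_x_lat_Units [OF assms] by (simp add: x_lat_def xg_def)
qed simp

lemma phi_units:
  assumes "\<beta> \<in> \<Sigma>"
  shows "(q_of \<Sigma> additive_fgl \<circ> phi_S l) (x_lat F \<beta>) \<in> Units G.Q"
  using l_x_Units [OF assms] by (simp add: x_lat_def phi_S_xg l_x_def)

lemma psi_units:
  assumes "\<beta> \<in> \<Sigma>"
  shows "(q_of \<Sigma> F \<circ> psi_S) (x_lat additive_fgl \<beta>) \<in> Units F.Q"
  using F.q_of_x_lat_Units [OF assms] F.q_of_dvd_Units [OF fps_at_dvd(2) [of "Var (0, \<beta>)"]]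
  by (simp add: x_lat_def xg_def psi_S_class \<Psi>_Var)

lemma phi_Q_hom: "phi_Q \<Sigma> l \<in> ring_hom F.Q G.Q"
  unfolding phi_Q_def
  by (rule F.Q_extend_hom [OF G.Q.is_cring ring_hom_trans [OF phi_S_hom G.q_of_hom]]) (rule phi_units)

lemma phi_Q_of:
  assumes "a \<in> carrier F.S"
  shows "phi_Q \<Sigma> l (q_of \<Sigma> F a) = q_of \<Sigma> additive_fgl (phi_S l a)"
  unfolding phi_Q_def
  by (subst F.Q_extend_of [OF G.Q.is_cring ring_hom_trans [OF phi_S_hom G.q_of_hom] _ assms])
    (rule phi_units, assumption, simp)

definition psi_Q :: "('l, 'r) qelem \<Rightarrow> ('l, 'r) qelem" where
  "psi_Q = loc_extend F.Q (q_of \<Sigma> F \<circ> psi_S)"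

lemma psi_Q_hom: "psi_Q \<in> ring_hom G.Q F.Q"
  unfolding psi_Q_def
  by (rule G.Q_extend_hom [OF F.Q.is_cring ring_hom_trans [OF psi_S_hom F.q_of_hom]]) (rule psi_units)

lemma psi_Q_of:
  assumes "a \<in> carrier G.S"
  shows "psi_Q (q_of \<Sigma> additive_fgl a) = q_of \<Sigma> F (psi_S a)"
  unfolding psi_Q_def
  by (subst G.Q_extend_of [OF F.Q.is_cring ring_hom_trans [OF psi_S_hom F.q_of_hom] _ assms])
    (rule psi_units, assumption, simp)

lemma psi_Q_phi_Q:
  assumes "p \<in> carrier F.Q"
  shows "psi_Q (phi_Q \<Sigma> l p) = p"
proof -
  have "(psi_Q \<circ> phi_Q \<Sigma> l) p = id p"
  proof (rule F.Q_hom_eqI [OF F.Q.is_cring ring_hom_trans [OF phi_Q_hom psi_Q_hom] _ _ assms])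
    show "(psi_Q \<circ> phi_Q \<Sigma> l) (q_of \<Sigma> F a) = id (q_of \<Sigma> F a)" if "a \<in> carrier F.S" for a
      using that by (simp add: phi_Q_of psi_Q_of psi_S_phi_S ring_hom_closed [OF phi_S_hom])
  qed (rule ring_hom_memI; simp)
  then show ?thesis by simp
qed

lemma phi_Q_psi_Q:
  assumes "p \<in> carrier G.Q"
  shows "phi_Q \<Sigma> l (psi_Q p) = p"
proof -
  have "(phi_Q \<Sigma> l \<circ> psi_Q) p = id p"
  proof (rule G.Q_hom_eqI [OF G.Q.is_cring ring_hom_trans [OF psi_Q_hom phi_Q_hom] _ _ assms])
    show "(phi_Q \<Sigma> l \<circ> psi_Q) (q_of \<Sigma> additive_fgl a) = id (q_of \<Sigma> additive_fgl a)"
      if "a \<in> carrier G.S" for a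
      using that by (simp add: phi_Q_of psi_Q_of phi_S_psi_S ring_hom_closed [OF psi_S_hom])
  qed (rule ring_hom_memI; simp)
  then show ?thesis by simp
qed

lemma phi_Q_iso: "phi_Q \<Sigma> l \<in> ring_iso F.Q G.Q"
  using phi_Q_hom psi_Q_hom psi_Q_phi_Q phi_Q_psi_Q by (rule ring_iso_if_inverses)

lemma phi_Q_closed [simp]: "p \<in> carrier F.Q \<Longrightarrow> phi_Q \<Sigma> l p \<in> carrier G.Q"
  using phi_Q_hom by (rule ring_hom_closed)

lemma phi_Q_zero [simp]: "phi_Q \<Sigma> l \<zero>\<^bsub>F.Q\<^esub> = \<zero>\<^bsub>G.Q\<^esub>"
  by (rule ring_hom_zero [OF phi_Q_hom F.Q.ring_axioms G.Q.ring_axioms])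

text \<open>The product of coefficient families sums over supports, so the comparison map has to
  preserve supports exactly.\<close>

lemma phi_Q_eq_0_iff: "p \<in> carrier F.Q \<Longrightarrow> phi_Q \<Sigma> l p = \<zero>\<^bsub>G.Q\<^esub> \<longleftrightarrow> p = \<zero>\<^bsub>F.Q\<^esub>"
  using psi_Q_phi_Q phi_Q_zero F.Q.zero_closed by metis

text \<open>Both composites extend the same map on the formal group algebra, where the two
  operations commute, so they agree on fractions by uniqueness.\<close>

lemma phi_Q_Q_act:
  assumes w: "w \<in> F.W" and p: "p \<in> carrier F.Q"
  shows "phi_Q \<Sigma> l (Q_act \<Sigma> F w p) = Q_act \<Sigma> additive_fgl w (phi_Q \<Sigma> l p)"
proof -
  have "(phi_Q \<Sigma> l \<circ> Q_act \<Sigma> F w) p = (Q_act \<Sigma> additive_fgl w \<circ> phi_Q \<Sigma> l) p"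
  proof (rule F.Q_hom_eqI [OF G.Q.is_cring _ _ _ p])
    show "phi_Q \<Sigma> l \<circ> Q_act \<Sigma> F w \<in> ring_hom F.Q G.Q"
      by (rule ring_hom_trans [OF F.Q_act_hom [OF w] phi_Q_hom])
    show "Q_act \<Sigma> additive_fgl w \<circ> phi_Q \<Sigma> l \<in> ring_hom F.Q G.Q"
      by (rule ring_hom_trans [OF phi_Q_hom G.Q_act_hom [OF w]])
    fix a assume a: "a \<in> carrier F.S"
    have "S_act F w a \<in> carrier F.S"
      by (rule ring_hom_closed [OF S_act_hom a]) (rule F.W_add [OF w])
    moreover have "phi_S l a \<in> carrier G.S" using phi_S_hom a by (rule ring_hom_closed)
    ultimately show "(phi_Q \<Sigma> l \<circ> Q_act \<Sigma> F w) (q_of \<Sigma> F a) = (Q_act \<Sigma> additive_fgl w \<circ> phi_Q \<Sigma> l) (q_of \<Sigma> F a)"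
      using a by (simp add: F.Q_act_of [OF w] G.Q_act_of [OF w] phi_Q_of phi_S_S_act [OF F.W_add [OF w]])
  qed
  then show ?thesis by simp
qed

section \<open>Comparison of the twisted group algebras\<close>

abbreviation \<phi> :: "('l, 'r) qwelem \<Rightarrow> ('l, 'r) qwelem" where "\<phi> \<equiv> phi_QW \<Sigma> cor l"

lemma phi_QW_apply [simp]: "v \<in> F.W \<Longrightarrow> \<phi> f v = phi_Q \<Sigma> l (f v)"
  by (simp add: phi_QW_def)

lemma phi_QW_closed [simp]: "f \<in> carrier F.QW \<Longrightarrow> \<phi> f \<in> carrier G.QW"
  unfolding phi_QW_def by (rule G.QW_carrierI [where A = "F.supp f"]) (auto simp: F.finite_supp)

lemma phi_QW_hom: "\<phi> \<in> ring_hom F.QW G.QW"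
proof (rule ring_hom_memI)
  fix f g assume f [simp]: "f \<in> carrier F.QW" and g [simp]: "g \<in> carrier F.QW"
  show "\<phi> (f \<oplus>\<^bsub>F.QW\<^esub> g) = \<phi> f \<oplus>\<^bsub>G.QW\<^esub> \<phi> g"
    by (rule G.QW_eqI) (simp_all add: ring_hom_add [OF phi_Q_hom] F.QW_add_closed G.QW_add_closed)
  show "\<phi> (f \<otimes>\<^bsub>F.QW\<^esub> g) = \<phi> f \<otimes>\<^bsub>G.QW\<^esub> \<phi> g"
  proof (rule G.QW_eqI)
    fix v assume v: "v \<in> F.W"
    let ?t = "\<lambda>(w, w'). f w \<otimes>\<^bsub>F.Q\<^esub> Q_act \<Sigma> F w (g w')"
    let ?t' = "\<lambda>(w, w'). \<phi> f w \<otimes>\<^bsub>G.Q\<^esub> Q_act \<Sigma> additive_fgl w (\<phi> g w')"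
    let ?A = "{(w, w') \<in> F.W \<times> F.W. w \<circ> w' = v \<and> f w \<noteq> \<zero>\<^bsub>F.Q\<^esub> \<and> g w' \<noteq> \<zero>\<^bsub>F.Q\<^esub>}"
    let ?A' = "{(w, w') \<in> F.W \<times> F.W. w \<circ> w' = v \<and> \<phi> f w \<noteq> \<zero>\<^bsub>G.Q\<^esub> \<and> \<phi> g w' \<noteq> \<zero>\<^bsub>G.Q\<^esub>}"
    \<comment> \<open>Injectivity on coefficients makes both sums run over the same index
      set.\<close>
    have A: "?A' = ?A" by (auto simp: phi_Q_eq_0_iff)
    interpret h: ring_hom_cring F.Q G.Q "phi_Q \<Sigma> l"
      by (simp add: ring_hom_cring_def ring_hom_cring_axioms_def phi_Q_hom F.Q.is_cring G.Q.is_cring)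
    have "phi_Q \<Sigma> l (finsum F.Q ?t ?A) = finsum G.Q (phi_Q \<Sigma> l \<circ> ?t) ?A"
      by (rule h.hom_finsum) (auto intro!: F.Q.m_closed ring_hom_closed [OF F.Q_act_hom])
    also have "\<dots> = finsum G.Q ?t' ?A"
    proof (rule G.Q.finsum_cong' [OF refl])
      show "?t' \<in> ?A \<rightarrow> carrier G.Q"
        by (auto intro!: G.Q.m_closed ring_hom_closed [OF G.Q_act_hom])
      fix p assume "p \<in> ?A"
      then obtain w w' where p: "p = (w, w')" "w \<in> F.W" "w' \<in> F.W" by blast
      then have "Q_act \<Sigma> F w (g w') \<in> carrier F.Q" by (auto intro: ring_hom_closed [OF F.Q_act_hom])
      then show "(phi_Q \<Sigma> l \<circ> ?t) p = ?t' p"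
        using p by (simp add: ring_hom_mult [OF phi_Q_hom] phi_Q_Q_act)
    qed
    finally show "\<phi> (f \<otimes>\<^bsub>F.QW\<^esub> g) v = (\<phi> f \<otimes>\<^bsub>G.QW\<^esub> \<phi> g) v"
      using v by (simp only: phi_QW_apply F.QW_mult G.QW_mult restrict_apply if_True A)
  qed simp_all
next
  show "\<phi> \<one>\<^bsub>F.QW\<^esub> = \<one>\<^bsub>G.QW\<^esub>"
    by (rule G.QW_eqI) (simp_all add: F.QW_one_apply G.QW_one_apply ring_hom_one [OF phi_Q_hom])
qed simp

lemma phi_QW_inj: "inj_on \<phi> (carrier F.QW)"
proof (rule inj_onI)
  fix f g assume *: "f \<in> carrier F.QW" "g \<in> carrier F.QW" "\<phi> f = \<phi> g"
  show "f = g"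
  proof (rule F.QW_eqI [OF *(1,2)])
    fix v assume v: "v \<in> F.W"
    from fun_cong [OF *(3), of v] v have "phi_Q \<Sigma> l (f v) = phi_Q \<Sigma> l (g v)" by simp
    then have "psi_Q (phi_Q \<Sigma> l (f v)) = psi_Q (phi_Q \<Sigma> l (g v))" by simp
    with v *(1,2) show "f v = g v" by (simp add: psi_Q_phi_Q)
  qed
qed

lemma phi_QW_surj: "\<phi> ` carrier F.QW = carrier G.QW"
proof
  show "carrier G.QW \<subseteq> \<phi> ` carrier F.QW"
  proof
    fix f assume f: "f \<in> carrier G.QW"
    have psi_closed: "psi_Q p \<in> carrier F.Q" if "p \<in> carrier G.Q" for p
      using psi_Q_hom that by (rule ring_hom_closed)
    \<comment> \<open>Preservation of zero keeps the support of the candidate preimage inside that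
      of \<open>f\<close>, hence finite.\<close>
    have "psi_Q \<zero>\<^bsub>G.Q\<^esub> = \<zero>\<^bsub>F.Q\<^esub>"
      by (rule ring_hom_zero [OF psi_Q_hom G.Q.ring_axioms F.Q.ring_axioms])
    then have closed: "(\<lambda>v\<in>F.W. psi_Q (f v)) \<in> carrier F.QW"
      using f by (intro F.QW_carrierI [where A = "G.supp f"]) (auto simp: G.finite_supp psi_closed)
    have "f = \<phi> (\<lambda>v\<in>F.W. psi_Q (f v))"
      using f closed by (intro G.QW_eqI phi_QW_closed) (auto simp: phi_Q_psi_Q)
    then show "f \<in> \<phi> ` carrier F.QW" using closed by (rule image_eqI)
  qed
qed auto

lemma phi_QW_iso: "\<phi> \<in> ring_iso F.QW G.QW"
  using phi_QW_hom phi_QW_inj phi_QW_surj by (simp add: ring_iso_def bij_betw_def)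

lemma phi_QW_qw:
  assumes "u \<in> carrier F.Q"
  shows "\<phi> (qw \<Sigma> cor F u w) = qw \<Sigma> cor additive_fgl (phi_Q \<Sigma> l u) w"
  using assms by (intro G.QW_eqI) (simp_all add: F.qw_apply G.qw_apply)

lemma phi_QW_QW_of_S:
  "a \<in> carrier F.S \<Longrightarrow> \<phi> (QW_of_S \<Sigma> cor F a) = QW_of_S \<Sigma> cor additive_fgl (phi_S l a)"
  by (simp add: QW_of_S_def phi_QW_qw phi_Q_of)

lemma phi_QW_scalar: "\<phi> (QW_scalar \<Sigma> cor F r) = QW_scalar \<Sigma> cor additive_fgl r"
  by (simp add: QW_scalar_def phi_QW_QW_of_S phi_S_class continuous_hom_Const [OF continuous_hom_\<Phi>])

lemma phi_QW_delta: "\<phi> (delta \<Sigma> cor F w) = delta \<Sigma> cor additive_fgl w"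
  by (simp add: delta_def phi_QW_qw ring_hom_one [OF phi_Q_hom])

section \<open>Images of the Hecke generators\<close>

lemma phi_QW_demazure:
  assumes "p \<in> carrier F.Q"
  shows "\<phi> (F.demazure p r) = G.demazure (phi_Q \<Sigma> l p) r"
proof -
  have *: "\<phi> (f \<ominus>\<^bsub>F.QW\<^esub> g) = \<phi> f \<ominus>\<^bsub>G.QW\<^esub> \<phi> g" if "f \<in> carrier F.QW" "g \<in> carrier F.QW" for f g
    using that by (simp add: a_minus_def ring_hom_add [OF phi_QW_hom]
        ring_hom_a_inv [OF F.QW.abelian_group_axioms G.QW.abelian_group_axioms phi_QW_hom])
  show ?thesis
    using assms by (simp add: F.demazure_def G.demazure_def ring_hom_add [OF phi_QW_hom]
        ring_hom_mult [OF phi_QW_hom] ring_hom_one [OF phi_QW_hom] * phi_QW_qw phi_QW_delta)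
qed

text \<open>Stating the image again as a \<open>demazure\<close> element, for the same reflection,
  lets \<open>demazure_rescale\<close> compare it with the additive generator.\<close>

lemma phi_QW_T_elt:
  assumes "\<beta> \<in> \<Sigma>"
  shows "\<phi> (T_elt \<Sigma> cor F \<beta>)
    = G.demazure (l_x \<Sigma> l (1, 0) \<otimes>\<^bsub>G.Q\<^esub> inv\<^bsub>G.Q\<^esub> l_x \<Sigma> l (0, \<beta>)) (reflection cor \<beta>)"
proof -
  have x: "phi_Q \<Sigma> l (q_of \<Sigma> F (x_gamma F)) = l_x \<Sigma> l (1, 0)"
    "phi_Q \<Sigma> l (q_of \<Sigma> F (x_lat F \<beta>)) = l_x \<Sigma> l (0, \<beta>)"
    by (simp_all add: phi_Q_of) (simp_all add: x_gamma_def x_lat_def phi_S_xg l_x_def)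
  note u = F.q_of_x_lat_Units [OF assms]
  have "phi_Q \<Sigma> l (inv\<^bsub>F.Q\<^esub> q_of \<Sigma> F (x_lat F \<beta>)) = inv\<^bsub>G.Q\<^esub> l_x \<Sigma> l (0, \<beta>)"
  proof (rule G.Q.comm_inv_char [symmetric])
    show "l_x \<Sigma> l (0, \<beta>) \<otimes>\<^bsub>G.Q\<^esub> phi_Q \<Sigma> l (inv\<^bsub>F.Q\<^esub> q_of \<Sigma> F (x_lat F \<beta>)) = \<one>\<^bsub>G.Q\<^esub>"
      using u by (simp flip: x ring_hom_mult [OF phi_Q_hom] add: ring_hom_one [OF phi_Q_hom])
  qed (use u l_x_Units [OF assms] in auto)
  then show ?thesis
    using u assms by (simp add: F.T_elt_eq_demazure phi_QW_demazure ring_hom_mult [OF phi_Q_hom] x)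
qed

text \<open>
  Both \<open>T\<^sub>\<beta> - 1\<close> and \<open>\<phi> T\<^sub>\<beta> - 1\<close> are multiples of \<open>1 - \<delta>\<close>, the factors being \<open>(x\<^sub>\<gamma> - x\<^sub>\<beta>) / x\<^sub>\<beta>\<close> and the
  same expression in \<open>l(x\<^sub>\<gamma>)\<close> and \<open>l(x\<^sub>\<beta>)\<close>. Since \<open>g - h\<close> and \<open>l(g) - l(h)\<close> divide each other, so
  do the factors, already over the formal group algebra.
\<close>

lemma T_elt_rescale:
  fixes \<beta>
  assumes "\<beta> \<in> \<Sigma>"
  defines "p \<equiv> q_of \<Sigma> additive_fgl (x_gamma additive_fgl) \<otimes>\<^bsub>G.Q\<^esub> inv\<^bsub>G.Q\<^esub> q_of \<Sigma> additive_fgl (x_lat additive_fgl \<beta>)"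
    and "p' \<equiv> l_x \<Sigma> l (1, 0) \<otimes>\<^bsub>G.Q\<^esub> inv\<^bsub>G.Q\<^esub> l_x \<Sigma> l (0, \<beta>)"
  obtains c c' where "c \<in> carrier G.S" "c' \<in> carrier G.S"
    "q_of \<Sigma> additive_fgl c \<otimes>\<^bsub>G.Q\<^esub> (p \<ominus>\<^bsub>G.Q\<^esub> \<one>\<^bsub>G.Q\<^esub>) = p' \<ominus>\<^bsub>G.Q\<^esub> \<one>\<^bsub>G.Q\<^esub>"
    "q_of \<Sigma> additive_fgl c' \<otimes>\<^bsub>G.Q\<^esub> (p' \<ominus>\<^bsub>G.Q\<^esub> \<one>\<^bsub>G.Q\<^esub>) = p \<ominus>\<^bsub>G.Q\<^esub> \<one>\<^bsub>G.Q\<^esub>"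
proof -
  let ?q = "\<lambda>f. q_of \<Sigma> additive_fgl (fga_class additive_fgl f)"
  have q_mult: "?q (f * g) = ?q f \<otimes>\<^bsub>G.Q\<^esub> ?q g" for f g
    by (simp add: fga_class_mult ring_hom_mult [OF G.q_of_hom])
  have rescale: "\<exists>f. ?q f \<otimes>\<^bsub>G.Q\<^esub> (?q a \<otimes>\<^bsub>G.Q\<^esub> inv\<^bsub>G.Q\<^esub> ?q b \<ominus>\<^bsub>G.Q\<^esub> \<one>\<^bsub>G.Q\<^esub>)
      = ?q A \<otimes>\<^bsub>G.Q\<^esub> inv\<^bsub>G.Q\<^esub> ?q B \<ominus>\<^bsub>G.Q\<^esub> \<one>\<^bsub>G.Q\<^esub>"
    if "a - b dvd A - B" "B dvd b" "?q b \<in> Units G.Q" "?q B \<in> Units G.Q" for a b A B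
  proof -
    \<comment> \<open>\<open>V\<close> compares the numerators and \<open>U\<close> the
      denominators; the factor \<open>V * U\<close> is a series, so its class lies in the formal
      group algebra.\<close>
    from that(1,2) obtain V U where "A - B = V * (a - b)" "b = U * B" by (metis dvdE mult.commute)
    then have "?q (V * U) \<otimes>\<^bsub>G.Q\<^esub> (?q a \<otimes>\<^bsub>G.Q\<^esub> inv\<^bsub>G.Q\<^esub> ?q b \<ominus>\<^bsub>G.Q\<^esub> \<one>\<^bsub>G.Q\<^esub>)
        = ?q A \<otimes>\<^bsub>G.Q\<^esub> inv\<^bsub>G.Q\<^esub> ?q B \<ominus>\<^bsub>G.Q\<^esub> \<one>\<^bsub>G.Q\<^esub>"
      unfolding q_mult using that(3,4)
      by (intro G.Q.diff_quotient_rescale) (simp_all flip: G.q_of_class_diff q_mult)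
    then show ?thesis by blast
  qed
  let ?x = "Var (1, 0) :: (int \<times> 'l, 'r) pseries" and ?y = "Var (0, \<beta>) :: (int \<times> 'l, 'r) pseries"
  have xy: "?q ?x = q_of \<Sigma> additive_fgl (x_gamma additive_fgl)" "?q ?y = q_of \<Sigma> additive_fgl (x_lat additive_fgl \<beta>)"
    "?q (fps_at l ?x) = l_x \<Sigma> l (1, 0)" "?q (fps_at l ?y) = l_x \<Sigma> l (0, \<beta>)"
    by (simp_all add: x_gamma_def x_lat_def xg_def l_x_def)
  have units: "?q ?y \<in> Units G.Q" "?q (fps_at l ?y) \<in> Units G.Q"
    using G.q_of_x_lat_Units [OF assms(1)] l_x_Units [OF assms(1)] by (simp_all only: xy)
  \<comment> \<open>The second divisibility is the first one for \<open>l'\<close>, taken at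
    \<open>l(x)\<close> and \<open>l(y)\<close>.\<close>
  have "?x - ?y dvd fps_at l ?x - fps_at l ?y" "fps_at l ?x - fps_at l ?y dvd ?x - ?y"
    using diff_dvd_fps_at_diff [of l ?x ?y] diff_dvd_fps_at_diff [of l' "fps_at l ?x" "fps_at l ?y"] by simp_all
  moreover have "?y dvd fps_at l ?y" "fps_at l ?y dvd ?y" by (simp_all add: dvd_fps_at fps_at_dvd)
  ultimately obtain f f' where
    "?q f \<otimes>\<^bsub>G.Q\<^esub> (p \<ominus>\<^bsub>G.Q\<^esub> \<one>\<^bsub>G.Q\<^esub>) = p' \<ominus>\<^bsub>G.Q\<^esub> \<one>\<^bsub>G.Q\<^esub>"
    "?q f' \<otimes>\<^bsub>G.Q\<^esub> (p' \<ominus>\<^bsub>G.Q\<^esub> \<one>\<^bsub>G.Q\<^esub>) = p \<ominus>\<^bsub>G.Q\<^esub> \<one>\<^bsub>G.Q\<^esub>"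
    using rescale [of ?x ?y "fps_at l ?x" "fps_at l ?y"] rescale [of "fps_at l ?x" "fps_at l ?y" ?x ?y] units
    unfolding p_def p'_def xy by blast
  then show ?thesis by (rule that [OF fga_class_closed fga_class_closed])
qed

text \<open>Scalars and the formal group algebra are mapped onto their counterparts, so only the
  generators \<open>T_i\<close> and their images must be expressed through each other.\<close>

lemma phi_QW_hecke_set:
  assumes \<alpha>: "\<alpha> ` {1..n} \<subseteq> \<Sigma>"
  shows "hecke_set \<Sigma> cor n \<alpha> F \<subseteq> carrier F.QW"
    and "\<phi> ` hecke_set \<Sigma> cor n \<alpha> F = hecke_set \<Sigma> cor n \<alpha> additive_fgl"
proof -
  let ?gens = "\<lambda>G. range (QW_scalar \<Sigma> cor G) \<union> QW_of_S \<Sigma> cor G ` carrier (fga G) \<union>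
      (\<lambda>i. T_elt \<Sigma> cor G (\<alpha> i)) ` {1..n}"
  let ?H = "?gens F" and ?K = "?gens additive_fgl"
  have \<alpha>i: "\<alpha> i \<in> \<Sigma>" if "i \<in> {1..n}" for i using \<alpha> that by blast
  have "T_elt \<Sigma> cor F \<beta> \<in> carrier F.QW" if "\<beta> \<in> \<Sigma>" for \<beta>
    using that F.q_of_x_lat_Units by (simp add: F.T_elt_eq_demazure)
  then have H: "?H \<subseteq> carrier F.QW"
    using \<alpha>i by (auto simp: QW_scalar_def)
  note gen = generate_ring_image [OF F.QW.abelian_group_axioms G.QW.abelian_group_axioms phi_QW_hom
      F.QW_one_closed F.QW_mult_closed H]
  have image: "\<phi> ` generate_ring F.QW ?H = generate_ring G.QW (\<phi> ` ?H)" by (rule gen(2))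
  show "hecke_set \<Sigma> cor n \<alpha> F \<subseteq> carrier F.QW" unfolding hecke_set_def by (rule gen(1))
  have S: "\<phi> ` QW_of_S \<Sigma> cor F ` carrier F.S = QW_of_S \<Sigma> cor additive_fgl ` carrier G.S"
  proof -
    have "phi_S l ` carrier F.S = carrier G.S"
      using phi_S_iso by (auto simp: ring_iso_def bij_betw_def)
    moreover have "\<phi> ` QW_of_S \<Sigma> cor F ` carrier F.S = QW_of_S \<Sigma> cor additive_fgl ` phi_S l ` carrier F.S"
      by (simp add: image_image phi_QW_QW_of_S cong: image_cong)
    ultimately show ?thesis by simp
  qed
  have scalar: "\<phi> ` range (QW_scalar \<Sigma> cor F) = range (QW_scalar \<Sigma> cor additive_fgl)"
    by (simp add: image_image phi_QW_scalar)
  \<comment> \<open>\<open>T' = 1 + c (T - 1)\<close> is built by ring operations from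
    \<open>T\<close> and the element \<open>c\<close> of the formal group algebra. Leaving
    \<open>A\<close> arbitrary lets the step be used with either generating set.\<close>
  have step: "G.demazure p' r \<in> generate_ring G.QW A"
    if A: "QW_of_S \<Sigma> cor additive_fgl ` carrier G.S \<subseteq> A" "G.demazure p r \<in> A"
      and c: "c \<in> carrier G.S" and p: "p \<in> carrier G.Q" "p' \<in> carrier G.Q"
      and rescale: "q_of \<Sigma> additive_fgl c \<otimes>\<^bsub>G.Q\<^esub> (p \<ominus>\<^bsub>G.Q\<^esub> \<one>\<^bsub>G.Q\<^esub>) = p' \<ominus>\<^bsub>G.Q\<^esub> \<one>\<^bsub>G.Q\<^esub>"
    for p p' c r A
  proof -
    have "qw \<Sigma> cor additive_fgl (q_of \<Sigma> additive_fgl c) id \<in> A"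
      using A(1) c by (auto simp: QW_of_S_def)
    then show ?thesis
      unfolding G.demazure_rescale [OF p G.q_of_closed [OF c] rescale]
      by (intro generate_ring.intros A)
  qed
  have T: "T_elt \<Sigma> cor additive_fgl \<beta> \<in> A \<Longrightarrow> \<phi> (T_elt \<Sigma> cor F \<beta>) \<in> generate_ring G.QW A"
    "\<phi> (T_elt \<Sigma> cor F \<beta>) \<in> A \<Longrightarrow> T_elt \<Sigma> cor additive_fgl \<beta> \<in> generate_ring G.QW A"
    if \<beta>: "\<beta> \<in> \<Sigma>" and A: "QW_of_S \<Sigma> cor additive_fgl ` carrier G.S \<subseteq> A" for \<beta> A
  proof -
    let ?p = "q_of \<Sigma> additive_fgl (x_gamma additive_fgl)
        \<otimes>\<^bsub>G.Q\<^esub> inv\<^bsub>G.Q\<^esub> q_of \<Sigma> additive_fgl (x_lat additive_fgl \<beta>)"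
    let ?p' = "l_x \<Sigma> l (1, 0) \<otimes>\<^bsub>G.Q\<^esub> inv\<^bsub>G.Q\<^esub> l_x \<Sigma> l (0, \<beta>)"
    obtain c c' where c: "c \<in> carrier G.S" "c' \<in> carrier G.S"
      and rescale: "q_of \<Sigma> additive_fgl c \<otimes>\<^bsub>G.Q\<^esub> (?p \<ominus>\<^bsub>G.Q\<^esub> \<one>\<^bsub>G.Q\<^esub>) = ?p' \<ominus>\<^bsub>G.Q\<^esub> \<one>\<^bsub>G.Q\<^esub>"
      "q_of \<Sigma> additive_fgl c' \<otimes>\<^bsub>G.Q\<^esub> (?p' \<ominus>\<^bsub>G.Q\<^esub> \<one>\<^bsub>G.Q\<^esub>) = ?p \<ominus>\<^bsub>G.Q\<^esub> \<one>\<^bsub>G.Q\<^esub>"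
      by (rule T_elt_rescale [OF \<beta>])
    have p: "?p \<in> carrier G.Q" "?p' \<in> carrier G.Q"
      using G.q_of_x_lat_Units [OF \<beta>] l_x_Units [OF \<beta>] by (simp_all add: l_x_def)
    show "T_elt \<Sigma> cor additive_fgl \<beta> \<in> A \<Longrightarrow> \<phi> (T_elt \<Sigma> cor F \<beta>) \<in> generate_ring G.QW A"
      "\<phi> (T_elt \<Sigma> cor F \<beta>) \<in> A \<Longrightarrow> T_elt \<Sigma> cor additive_fgl \<beta> \<in> generate_ring G.QW A"
      unfolding phi_QW_T_elt [OF \<beta>] G.T_elt_eq_demazure [OF \<beta>]
      using step [OF A _ c(1) p rescale(1)] step [OF A _ c(2) p(2,1) rescale(2)] by blast+
  qed
  let ?B = "range (QW_scalar \<Sigma> cor additive_fgl) \<union> QW_of_S \<Sigma> cor additive_fgl ` carrier G.S"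
  let ?K' = "?B \<union> (\<lambda>i. \<phi> (T_elt \<Sigma> cor F (\<alpha> i))) ` {1..n}"
  have "\<phi> ` ?H = ?K'" unfolding image_Un scalar S by (simp add: image_image)
  moreover have "generate_ring G.QW ?K' = generate_ring G.QW ?K"
  \<comment> \<open>Each generated ring contains the generators of the other; the common part
    \<open>?B\<close> is immediate, and the two families of \<open>T_i\<close> use the rescaling in
    opposite directions.\<close>
  proof (intro equalityI generate_ring_subset Un_least image_subsetI)
    show "\<phi> (T_elt \<Sigma> cor F (\<alpha> i)) \<in> generate_ring G.QW ?K" if "i \<in> {1..n}" for i
      using that by (intro T(1) [OF \<alpha>i]) auto
    show "T_elt \<Sigma> cor additive_fgl (\<alpha> i) \<in> generate_ring G.QW ?K'" if "i \<in> {1..n}" for i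
      using that by (intro T(2) [OF \<alpha>i]) auto
  qed (auto intro: generate_ring.incl)
  ultimately show "\<phi> ` hecke_set \<Sigma> cor n \<alpha> F = hecke_set \<Sigma> cor n \<alpha> additive_fgl"
    unfolding hecke_set_def image by simp
qed

lemma phi_QW_hecke_iso:
  assumes "\<alpha> ` {1..n} \<subseteq> \<Sigma>"
  shows "\<phi> \<in> ring_iso (hecke_algebra \<Sigma> cor n \<alpha> F) (hecke_algebra \<Sigma> cor n \<alpha> additive_fgl)"
proof -
  note H = phi_QW_hecke_set [OF assms]
  have "\<phi> \<in> ring_hom (hecke_algebra \<Sigma> cor n \<alpha> F) (hecke_algebra \<Sigma> cor n \<alpha> additive_fgl)"
    unfolding hecke_algebra_def using H
    by (intro ring_hom_memI)
      (auto simp: ring_hom_mult [OF phi_QW_hom] ring_hom_add [OF phi_QW_hom] ring_hom_one [OF phi_QW_hom] subset_iff)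
  then show ?thesis
    using H inj_on_subset [OF phi_QW_inj H(1)] by (simp add: ring_iso_def bij_betw_def hecke_algebra_def)
qed

end

theorem theorem5p6:
  fixes F :: "(xy, 'r :: comm_ring_1) pseries"
    and l l' :: "'r fps"
    and \<Sigma> :: "'l :: ab_group_add set"
    and cor :: "'l \<Rightarrow> 'l \<Rightarrow> int"
    and n :: nat
    and \<alpha> :: "nat \<Rightarrow> 'l"
  assumes "formal_group_law F"
    and "semisimple_root_datum \<Sigma> cor"
    and "simple_roots \<Sigma> n \<alpha>"
    and "\<forall>\<beta>\<in>\<Sigma>. \<forall>u\<in>carrier (fga F :: ('l, 'r) pseries set ring).
           u \<otimes>\<^bsub>fga F\<^esub> xg F \<beta> = \<zero>\<^bsub>fga F\<^esub> \<longrightarrow> u = \<zero>\<^bsub>fga F\<^esub>"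
    and "rational_algebra TYPE('r)"
    and "compositional_inverses l l'"
    and "F = fps_at l (fps_at l' (Var X) + fps_at l' (Var Y))"
  shows
    \<comment> \<open>the isomorphisms between the formal group algebras and between their localizations\<close>
    "phi_S l \<in> ring_iso (fga F :: ('l, 'r) selem ring) (fga additive_fgl) \<and>
     (\<forall>a :: int \<times> 'l. phi_S l (xg F a) = fga_class additive_fgl (fps_at l (Var a))) \<and>
     phi_Q \<Sigma> l \<in> ring_iso (Q_ring \<Sigma> F) (Q_ring \<Sigma> additive_fgl) \<and>
     (\<forall>a\<in>carrier (fga F). phi_Q \<Sigma> l (q_of \<Sigma> F a) = q_of \<Sigma> additive_fgl (phi_S l a)) \<and>
     \<comment> \<open>the isomorphism between the twisted group algebras\<close>
     phi_QW \<Sigma> cor l \<in> ring_iso (QW_ring \<Sigma> cor F) (QW_ring \<Sigma> cor additive_fgl) \<and>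
     (\<forall>r. phi_QW \<Sigma> cor l (QW_scalar \<Sigma> cor F r) = QW_scalar \<Sigma> cor additive_fgl r) \<and>
     (\<forall>u\<in>carrier (Q_ring \<Sigma> F). \<forall>w\<in>weyl_group \<Sigma> cor.
        phi_QW \<Sigma> cor l (qw \<Sigma> cor F u w) = qw \<Sigma> cor additive_fgl (phi_Q \<Sigma> l u) w) \<and>
     \<comment> \<open>its restriction to the formal affine Hecke algebras\<close>
     phi_QW \<Sigma> cor l \<in> ring_iso (hecke_algebra \<Sigma> cor n \<alpha> F) (hecke_algebra \<Sigma> cor n \<alpha> additive_fgl) \<and>
     (\<forall>i\<in>{1..n}.
        l_x \<Sigma> l (0, \<alpha> i) \<in> Units (Q_ring \<Sigma> additive_fgl) \<and>
        phi_QW \<Sigma> cor l (T_elt \<Sigma> cor F (\<alpha> i)) =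
          qw \<Sigma> cor additive_fgl
            (l_x \<Sigma> l (1, 0) \<otimes>\<^bsub>Q_ring \<Sigma> additive_fgl\<^esub> inv\<^bsub>Q_ring \<Sigma> additive_fgl\<^esub> l_x \<Sigma> l (0, \<alpha> i)) id
          \<oplus>\<^bsub>QW_ring \<Sigma> cor additive_fgl\<^esub>
          qw \<Sigma> cor additive_fgl
            ((l_x \<Sigma> l (0, \<alpha> i) \<ominus>\<^bsub>Q_ring \<Sigma> additive_fgl\<^esub> l_x \<Sigma> l (1, 0))
               \<otimes>\<^bsub>Q_ring \<Sigma> additive_fgl\<^esub> inv\<^bsub>Q_ring \<Sigma> additive_fgl\<^esub> l_x \<Sigma> l (0, \<alpha> i))
            (reflection cor (\<alpha> i)))"
proof -
  have "root_datum \<Sigma> cor" using assms(2) by (simp add: semisimple_root_datum_def)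
  then interpret exponential_twisted F l l' \<Sigma> cor
    by unfold_locales (use assms in auto)
  have \<alpha>: "\<alpha> ` {1..n} \<subseteq> \<Sigma>" using assms(3) by (simp add: simple_roots_def)
  then have \<alpha>i: "\<alpha> i \<in> \<Sigma>" if "i \<in> {1..n}" for i using that by blast
  have "l_x \<Sigma> l (1, 0) \<in> carrier G.Q" by (simp add: l_x_def)
  then have T: "\<phi> (T_elt \<Sigma> cor F (\<alpha> i)) =
      qw \<Sigma> cor additive_fgl (l_x \<Sigma> l (1, 0) \<otimes>\<^bsub>G.Q\<^esub> inv\<^bsub>G.Q\<^esub> l_x \<Sigma> l (0, \<alpha> i)) id
      \<oplus>\<^bsub>G.QW\<^esub> qw \<Sigma> cor additive_fgl
        ((l_x \<Sigma> l (0, \<alpha> i) \<ominus>\<^bsub>G.Q\<^esub> l_x \<Sigma> l (1, 0)) \<otimes>\<^bsub>G.Q\<^esub> inv\<^bsub>G.Q\<^esub> l_x \<Sigma> l (0, \<alpha> i))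
        (reflection cor (\<alpha> i))" if "i \<in> {1..n}" for i
    using \<alpha>i [OF that] by (simp only: phi_QW_T_elt G.demazure_quotient l_x_Units)
  show ?thesis
    by (intro conjI allI ballI phi_S_iso phi_S_xg phi_Q_iso phi_Q_of phi_QW_iso phi_QW_scalar phi_QW_qw
        phi_QW_hecke_iso \<alpha> l_x_Units \<alpha>i T)
qed

end
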